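(* For all $d\ge 3$ and $r\ge 2$, the Hessian map $h_{d,r}:\Sigma(d,r)\dashrightarrow\Sigma((r+1)(d-2),r)$ is generically finite onto its image. In other words, the Hessian variety $H_{d,r}$ (the closure of the image of $h_{d,r}$) has dimension $N(d,r)=\binom{d+r}{d}-1=\dim\Sigma(d,r)$.
   Context: Work over an algebraically closed field $k$ of characteristic zero. $\Sigma(d,r)$ is the projective space, of dimension $N(d,r)=\binom{d+r}{d}-1$, of nonzero homogeneous polynomials of degree $d$ in $x_0,\dots,x_r$ up to scalars. $\operatorname{hess}(f)=\det(\partial^2 f/\partial x_i\partial x_j)_{0\le i,j\le r}$, and the Hessian map is the rational map $h_{d,r}:[f]\mapsto[\operatorname{hess}(f)]$. *)

theory Defs
  imports
    "HOL-Analysis.Abstract_Topology"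
    "HOL-Library.Extended_Nat"
    "HOL-Library.Poly_Mapping"
    "Jordan_Normal_Form.Determinant"
begin

section \<open>Polynomials in several variables\<close>

text \<open>
  A power product in variables of type \<open>'v\<close> is a finitely supported exponent vector
  \<open>'v \<Rightarrow>\<^sub>0 nat\<close>; a polynomial is the finitely supported family of its coefficients.
  The ring structure is the convolution product of \<^theory>\<open>HOL-Library.Poly_Mapping\<close>.
\<close>

type_synonym 'v pp = "'v \<Rightarrow>\<^sub>0 nat"
type_synonym ('v, 'a) mpol = "('v \<Rightarrow>\<^sub>0 nat) \<Rightarrow>\<^sub>0 'a"

definition pp_deg :: "'v pp \<Rightarrow> nat" where
  "pp_deg m = (\<Sum>v\<in>Poly_Mapping.keys m. Poly_Mapping.lookup m v)"

definition homogeneous :: "nat \<Rightarrow> ('v, 'a::zero) mpol \<Rightarrow> bool" where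
  "homogeneous n F \<longleftrightarrow> (\<forall>m\<in>Poly_Mapping.keys F. pp_deg m = n)"

definition peval :: "('v, 'a::comm_ring_1) mpol \<Rightarrow> ('v \<Rightarrow> 'a) \<Rightarrow> 'a" where
  "peval F x = (\<Sum>m\<in>Poly_Mapping.keys F.
     Poly_Mapping.lookup F m * (\<Prod>v\<in>Poly_Mapping.keys m. x v ^ Poly_Mapping.lookup m v))"

text \<open>
  Subtraction of exponents truncates, but a term in which \<open>x\<^sub>i\<close> does not occur gets
  coefficient \<open>0\<close>.
\<close>

definition partial :: "'v \<Rightarrow> ('v, 'a::comm_ring_1) mpol \<Rightarrow> ('v, 'a) mpol" where
  "partial i f = (\<Sum>m\<in>Poly_Mapping.keys f.
     Poly_Mapping.single (m - Poly_Mapping.single i 1)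
       (of_nat (Poly_Mapping.lookup m i) * Poly_Mapping.lookup f m))"

definition hess :: "nat \<Rightarrow> (nat, 'a::comm_ring_1) mpol \<Rightarrow> (nat, 'a) mpol" where
  "hess r f = det (Matrix.mat (r + 1) (r + 1) (\<lambda>(i, j). partial i (partial j f)))"

lemma pp_deg_superset:
  "finite A \<Longrightarrow> Poly_Mapping.keys m \<subseteq> A \<Longrightarrow> pp_deg m = sum (Poly_Mapping.lookup m) A"
  unfolding pp_deg_def by (rule sum.mono_neutral_left) (auto simp: in_keys_iff)

lemma pp_deg_add: "pp_deg (m + n) = pp_deg m + pp_deg n"
proof -
  let ?A = "Poly_Mapping.keys m \<union> Poly_Mapping.keys n"
  have "pp_deg (m + n) = sum (Poly_Mapping.lookup (m + n)) ?A"
    by (rule pp_deg_superset) (auto simp: Poly_Mapping.keys_add)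
  also have "\<dots> = sum (Poly_Mapping.lookup m) ?A + sum (Poly_Mapping.lookup n) ?A"
    by (simp add: lookup_add sum.distrib)
  also have "\<dots> = pp_deg m + pp_deg n"
    by (simp add: pp_deg_superset[of ?A m] pp_deg_superset[of ?A n])
  finally show ?thesis .
qed

lemma pp_deg_single [simp]: "pp_deg (Poly_Mapping.single v n) = n"
  by (cases "n = 0") (auto simp: pp_deg_def)

lemma homogeneous_mult:
  fixes F G :: "('v, 'a::comm_ring_1) mpol"
  shows "homogeneous a F \<Longrightarrow> homogeneous b G \<Longrightarrow> homogeneous (a + b) (F * G)"
  unfolding homogeneous_def using keys_mult[of F G] by (fastforce simp: pp_deg_add)

lemma pp_monomial_superset:
  fixes x :: "'v \<Rightarrow> 'a::comm_ring_1"
  shows "finite A \<Longrightarrow> Poly_Mapping.keys m \<subseteq> A \<Longrightarrow>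
    (\<Prod>v\<in>Poly_Mapping.keys m. x v ^ Poly_Mapping.lookup m v)
      = (\<Prod>v\<in>A. x v ^ Poly_Mapping.lookup m v)"
  by (rule prod.mono_neutral_left) (auto simp: in_keys_iff)

lemma pp_monomial_add:
  fixes x :: "'v \<Rightarrow> 'a::comm_ring_1"
  shows "(\<Prod>v\<in>Poly_Mapping.keys (m + n). x v ^ Poly_Mapping.lookup (m + n) v)
    = (\<Prod>v\<in>Poly_Mapping.keys m. x v ^ Poly_Mapping.lookup m v)
      * (\<Prod>v\<in>Poly_Mapping.keys n. x v ^ Poly_Mapping.lookup n v)"
proof -
  let ?A = "Poly_Mapping.keys m \<union> Poly_Mapping.keys n"
  have "(\<Prod>v\<in>Poly_Mapping.keys (m + n). x v ^ Poly_Mapping.lookup (m + n) v)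
      = (\<Prod>v\<in>?A. x v ^ Poly_Mapping.lookup (m + n) v)"
    by (rule pp_monomial_superset) (auto simp: Poly_Mapping.keys_add)
  also have "\<dots> = (\<Prod>v\<in>?A. x v ^ Poly_Mapping.lookup m v) * (\<Prod>v\<in>?A. x v ^ Poly_Mapping.lookup n v)"
    by (simp add: lookup_add power_add prod.distrib)
  also have "\<dots> = (\<Prod>v\<in>Poly_Mapping.keys m. x v ^ Poly_Mapping.lookup m v)
      * (\<Prod>v\<in>Poly_Mapping.keys n. x v ^ Poly_Mapping.lookup n v)"
    by (simp add: pp_monomial_superset[of ?A m] pp_monomial_superset[of ?A n])
  finally show ?thesis .
qed

lemma peval_superset:
  "finite A \<Longrightarrow> Poly_Mapping.keys F \<subseteq> A \<Longrightarrow> peval F x = (\<Sum>m\<in>A.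
     Poly_Mapping.lookup F m * (\<Prod>v\<in>Poly_Mapping.keys m. x v ^ Poly_Mapping.lookup m v))"
  unfolding peval_def by (rule sum.mono_neutral_left) (auto simp: in_keys_iff)

lemma peval_add: "peval (F + G) x = peval F x + peval G x"
proof -
  let ?A = "Poly_Mapping.keys F \<union> Poly_Mapping.keys G"
  have "Poly_Mapping.keys (F + G) \<subseteq> ?A" by (rule Poly_Mapping.keys_add)
  then show ?thesis
    by (simp add: peval_superset[of ?A] lookup_add distrib_right sum.distrib)
qed

lemma peval_zero [simp]: "peval 0 x = 0"
  by (simp add: peval_def)

lemma peval_sum: "peval (\<Sum>i\<in>A. F i) x = (\<Sum>i\<in>A. peval (F i) x)"
  by (induction A rule: infinite_finite_induct) (auto simp: peval_add)

lemma peval_single: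
  "peval (Poly_Mapping.single m c) x
    = c * (\<Prod>v\<in>Poly_Mapping.keys m. x v ^ Poly_Mapping.lookup m v)"
  by (simp add: peval_def)

lemma mpol_sum_single:
  fixes F :: "('v, 'a::comm_ring_1) mpol"
  shows "F = (\<Sum>m\<in>Poly_Mapping.keys F. Poly_Mapping.single m (Poly_Mapping.lookup F m))"
  by (rule poly_mapping_eqI)
    (simp add: lookup_sum lookup_single when_def sum.delta in_keys_iff)

lemma peval_mult: "peval (F * G) x = peval F x * peval G x"
proof -
  have "F * G = (\<Sum>m\<in>Poly_Mapping.keys F. \<Sum>n\<in>Poly_Mapping.keys G.
      Poly_Mapping.single (m + n) (Poly_Mapping.lookup F m * Poly_Mapping.lookup G n))"
    by (subst mpol_sum_single[of F], subst mpol_sum_single[of G])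
      (simp add: sum_product mult_single)
  then have "peval (F * G) x = (\<Sum>m\<in>Poly_Mapping.keys F. \<Sum>n\<in>Poly_Mapping.keys G.
      peval (Poly_Mapping.single m (Poly_Mapping.lookup F m)) x
      * peval (Poly_Mapping.single n (Poly_Mapping.lookup G n)) x)"
    by (simp only: peval_sum peval_single pp_monomial_add) (simp add: ac_simps)
  also have "\<dots> = peval F x * peval G x"
    by (simp add: peval_def[of F] peval_def[of G] peval_single sum_product)
  finally show ?thesis .
qed

lemma peval_scale:
  assumes "homogeneous n F"
  shows "peval F (\<lambda>v. c * x v) = c ^ n * peval F x"
proof -
  have "(\<Prod>v\<in>Poly_Mapping.keys m. (c * x v) ^ Poly_Mapping.lookup m v)
      = c ^ n * (\<Prod>v\<in>Poly_Mapping.keys m. x v ^ Poly_Mapping.lookup m v)"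
    if "m \<in> Poly_Mapping.keys F" for m
    using assms that
    by (auto simp: homogeneous_def pp_deg_def power_mult_distrib prod.distrib power_sum)
  then show ?thesis
    by (simp add: peval_def sum_distrib_left ac_simps)
qed


section \<open>Projective space with its Zariski topology\<close>

text \<open>
  For a finite index set \<open>I\<close>, the vectors of \<open>k\<^sup>I\<close> are the finitely supported functions with
  support in \<open>I\<close>, and a point of the projective space on \<open>k\<^sup>I\<close> is the set of all nonzero multiples
  of a nonzero vector.
\<close>

definition proj_class :: "('v \<Rightarrow>\<^sub>0 'a::field) \<Rightarrow> ('v \<Rightarrow>\<^sub>0 'a) set" where
  "proj_class f = {Poly_Mapping.map ((*) c) f |c. c \<noteq> 0}"

definition proj_points :: "'v set \<Rightarrow> ('v \<Rightarrow>\<^sub>0 'a::field) set set" where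
  "proj_points I = {proj_class f |f. f \<noteq> 0 \<and> Poly_Mapping.keys f \<subseteq> I}"

definition zero_locus :: "'v set \<Rightarrow> ('v, 'a::field) mpol set \<Rightarrow> ('v \<Rightarrow>\<^sub>0 'a) set set" where
  "zero_locus I S =
     {p \<in> proj_points I. \<forall>F\<in>S. \<forall>f\<in>p. peval F (Poly_Mapping.lookup f) = 0}"

text \<open>
  The polynomials below may involve variables outside \<open>I\<close>; such variables vanish identically
  on \<open>k\<^sup>I\<close>, so no further closed sets arise.
\<close>

definition zariski :: "'v set \<Rightarrow> ('v \<Rightarrow>\<^sub>0 'a::field) set topology" where
  "zariski I = topology (\<lambda>U. \<exists>S. (\<forall>F\<in>S. \<exists>n. homogeneous n F)
                               \<and> U = proj_points I - zero_locus I S)"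

lemma lookup_map_mult:
  fixes c :: "'a::field"
  shows "Poly_Mapping.lookup (Poly_Mapping.map ((*) c) f) k = c * Poly_Mapping.lookup f k"
  by (simp add: Poly_Mapping.map.rep_eq when_def)

lemma proj_class_self: "f \<in> proj_class f"
proof -
  have "f = Poly_Mapping.map ((*) 1) f"
    by (rule poly_mapping_eqI) (simp add: lookup_map_mult)
  then show ?thesis
    unfolding proj_class_def by (metis (mono_tags, lifting) mem_Collect_eq zero_neq_one)
qed

lemma peval_proj_class:
  assumes "homogeneous n F" "p \<in> proj_points I" "f \<in> p" "g \<in> p"
  shows "peval F (Poly_Mapping.lookup f) = 0 \<longleftrightarrow> peval F (Poly_Mapping.lookup g) = 0"
proof -
  from assms obtain h a b where "a \<noteq> 0" "b \<noteq> 0"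
    "f = Poly_Mapping.map ((*) a) h" "g = Poly_Mapping.map ((*) b) h"
    by (auto simp: proj_points_def proj_class_def)
  moreover have "Poly_Mapping.lookup (Poly_Mapping.map ((*) c) h)
      = (\<lambda>v. c * Poly_Mapping.lookup h v)" for c
    by (rule ext) (rule lookup_map_mult)
  ultimately show ?thesis
    by (simp add: peval_scale[OF assms(1)])
qed

lemma zero_locus_mult:
  assumes "\<forall>F\<in>S. \<exists>n. homogeneous n F" "\<forall>F\<in>T. \<exists>n. homogeneous n F"
  shows "zero_locus I {F * G |F G. F \<in> S \<and> G \<in> T} = zero_locus I S \<union> zero_locus I T"
proof (intro equalityI subsetI)
  fix p assume p: "p \<in> zero_locus I {F * G |F G. F \<in> S \<and> G \<in> T}"
  show "p \<in> zero_locus I S \<union> zero_locus I T"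
  proof (cases "p \<in> zero_locus I S")
    case False
    with p obtain F f where F: "F \<in> S" "f \<in> p" "peval F (Poly_Mapping.lookup f) \<noteq> 0"
      by (auto simp: zero_locus_def)
    have "peval G (Poly_Mapping.lookup g) = 0" if "G \<in> T" "g \<in> p" for G g
    proof -
      from p F that(1) have "peval (F * G) (Poly_Mapping.lookup f) = 0"
        unfolding zero_locus_def by blast
      with F have "peval G (Poly_Mapping.lookup f) = 0" by (simp add: peval_mult)
      with assms(2) p F that show ?thesis
        using peval_proj_class[of _ G p I f g] by (auto simp: zero_locus_def)
    qed
    with p show ?thesis by (auto simp: zero_locus_def)
  qed simp
qed (auto simp: zero_locus_def peval_mult)

lemma istopology_zariski:
  "istopology (\<lambda>U. \<exists>S. (\<forall>F\<in>S. \<exists>n. homogeneous n F)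
                     \<and> U = proj_points I - zero_locus I (S :: ('v, 'a::field) mpol set))"
  (is "istopology ?L")
  unfolding istopology_def
proof (intro conjI allI impI)
  fix U V assume "?L U" "?L V"
  then obtain S T where S: "\<forall>F\<in>S. \<exists>n. homogeneous n F" "U = proj_points I - zero_locus I S"
    and T: "\<forall>F\<in>T. \<exists>n. homogeneous n F" "V = proj_points I - zero_locus I T"
    by blast
  have "U \<inter> V = proj_points I - zero_locus I {F * G |F G. F \<in> S \<and> G \<in> T}"
    using S T by (auto simp: zero_locus_mult)
  moreover have "\<forall>H\<in>{F * G |F G. F \<in> S \<and> G \<in> T}. \<exists>n. homogeneous n H"
    using S(1) T(1) homogeneous_mult by blast
  ultimately show "?L (U \<inter> V)" by blast
next
  fix \<K> :: "('v \<Rightarrow>\<^sub>0 'a) set set set" assume K: "\<forall>U\<in>\<K>. ?L U"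
  define \<S> where "\<S> = {S :: ('v, 'a) mpol set. (\<forall>F\<in>S. \<exists>n. homogeneous n F)
                        \<and> proj_points I - zero_locus I S \<in> \<K>}"
  have "\<Union>\<K> = (\<Union>S\<in>\<S>. proj_points I - zero_locus I S)"
    using K unfolding \<S>_def by (auto 4 4)
  also have "\<dots> = proj_points I - zero_locus I (\<Union>\<S>)"
    by (auto simp: zero_locus_def)
  finally show "?L (\<Union>\<K>)"
    unfolding \<S>_def by (intro exI[of _ "\<Union>\<S>"]) (auto simp: \<S>_def)
qed

lemma openin_zariski:
  "openin (zariski I) U \<longleftrightarrow> (\<exists>S. (\<forall>F\<in>S. \<exists>n. homogeneous n F)
                              \<and> U = proj_points I - zero_locus I S)"
  by (simp add: zariski_def istopology_zariski)

lemma topspace_zariski [simp]: "topspace (zariski I) = proj_points I"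
proof -
  have "zero_locus I {1} = {}"
    using proj_class_self by (force simp: zero_locus_def peval_def proj_points_def)
  moreover have "homogeneous 0 1"
    by (auto simp: homogeneous_def pp_deg_def)
  ultimately have "openin (zariski I) (proj_points I)"
    unfolding openin_zariski by (intro exI[of _ "{1}"]) auto
  then show ?thesis
    unfolding topspace_def using openin_zariski[of I] by blast
qed

lemma closedin_zariski:
  fixes C :: "('v \<Rightarrow>\<^sub>0 'a::field) set set"
  shows "closedin (zariski I) C \<longleftrightarrow> (\<exists>S. (\<forall>F\<in>S. \<exists>n. homogeneous n F) \<and> C = zero_locus I S)"
proof -
  have "zero_locus I S \<subseteq> proj_points I" for S :: "('v, 'a) mpol set"
    by (auto simp: zero_locus_def)
  then show ?thesis
    unfolding closedin_def openin_zariski topspace_zariski by (metis double_diff order_refl Diff_subset)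
qed


section \<open>Dimension and generic finiteness\<close>

definition irreducible_space :: "'p topology \<Rightarrow> bool" where
  "irreducible_space X \<longleftrightarrow> topspace X \<noteq> {} \<and>
     (\<forall>A B. closedin X A \<and> closedin X B \<and> A \<union> B = topspace X
            \<longrightarrow> A = topspace X \<or> B = topspace X)"

text \<open>
  Krull dimension: the supremum of the lengths \<open>n\<close> of strict chains \<open>Z 0 \<subset> \<dots> \<subset> Z n\<close> of irreducible
  closed subsets. (The empty space gets dimension \<open>0\<close>.)
\<close>

definition top_dim :: "'p topology \<Rightarrow> enat" where
  "top_dim X = Sup {enat n |n. \<exists>Z :: nat \<Rightarrow> 'p set.
     (\<forall>i\<le>n. closedin X (Z i) \<and> irreducible_space (subtopology X (Z i)))
     \<and> (\<forall>i<n. Z i \<subset> Z (Suc i))}"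

text \<open>
  For a map \<open>\<phi>\<close> into \<open>Y\<close>, defined on \<open>D\<close>: the fibres over some nonempty open subset of the
  closure of the image are finite. Nonemptiness of \<open>V\<close> includes that \<open>D\<close> is nonempty.
\<close>

definition generically_finite_onto_image ::
    "'q topology \<Rightarrow> 'p set \<Rightarrow> ('p \<Rightarrow> 'q) \<Rightarrow> bool" where
  "generically_finite_onto_image Y D \<phi> \<longleftrightarrow>
     (\<exists>V. openin (subtopology Y (Y closure_of (\<phi> ` D))) V \<and> V \<noteq> {}
        \<and> (\<forall>y\<in>V. finite {p \<in> D. \<phi> p = y}))"


section \<open>The Hessian map\<close>

definition monomials :: "nat \<Rightarrow> nat \<Rightarrow> nat pp set" where
  "monomials d r = {m. Poly_Mapping.keys m \<subseteq> {0..r} \<and> pp_deg m = d}"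

abbreviation hypersurfaces :: "nat \<Rightarrow> nat \<Rightarrow> (nat, 'a::field) mpol set topology" where
  "hypersurfaces d r \<equiv> zariski (monomials d r)"

definition hessian_domain :: "nat \<Rightarrow> nat \<Rightarrow> (nat, 'a::field) mpol set set" where
  "hessian_domain d r = {p \<in> topspace (hypersurfaces d r). \<forall>f\<in>p. hess r f \<noteq> 0}"

text \<open>
  All representatives of \<open>p\<close> give the same class, so the union below is a single class; see
  \<open>hessian_map_proj_class\<close>.
\<close>

definition hessian_map :: "nat \<Rightarrow> (nat, 'a::field) mpol set \<Rightarrow> (nat, 'a) mpol set" where
  "hessian_map r p = (\<Union>f\<in>p. proj_class (hess r f))"

definition hessian_variety :: "nat \<Rightarrow> nat \<Rightarrow> (nat, 'a::field) mpol set set" where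
  "hessian_variety d r =
     hypersurfaces ((r + 1) * (d - 2)) r closure_of (hessian_map r ` hessian_domain d r)"

lemma partial_scale:
  fixes f :: "(nat, 'a::field) mpol"
  assumes "c \<noteq> 0"
  shows "partial i (Poly_Mapping.map ((*) c) f) = Poly_Mapping.single 0 c * partial i f"
proof -
  have "Poly_Mapping.keys (Poly_Mapping.map ((*) c) f) = Poly_Mapping.keys f"
    using assms by (auto simp: in_keys_iff lookup_map_mult)
  then show ?thesis
    by (simp add: partial_def lookup_map_mult sum_distrib_left mult_single ac_simps)
qed

lemma hess_scale:
  fixes f :: "(nat, 'a::field) mpol"
  assumes "c \<noteq> 0"
  shows "hess r (Poly_Mapping.map ((*) c) f) = Poly_Mapping.map ((*) (c ^ (r + 1))) (hess r f)"
proof -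
  have *: "partial i (partial j (Poly_Mapping.map ((*) c) f))
      = Poly_Mapping.single 0 c * partial i (partial j f)" for i j
    using partial_scale[OF assms, of i "partial j f"] partial_scale[OF assms, of j f]
    by (simp add: mult_map_scale_conv_mult)
  have "Matrix.mat (r + 1) (r + 1) (\<lambda>(i, j). partial i (partial j (Poly_Mapping.map ((*) c) f)))
      = Poly_Mapping.single 0 c \<cdot>\<^sub>m
          Matrix.mat (r + 1) (r + 1) (\<lambda>(i, j). partial i (partial j f))"
    by (rule eq_matI) (auto simp: *)
  moreover have "Poly_Mapping.single (0 :: nat pp) c ^ n = Poly_Mapping.single 0 (c ^ n)" for n
    by (induction n) (auto simp: mult_single)
  ultimately show ?thesis
    by (simp add: hess_def mult_map_scale_conv_mult del: power_Suc)
qed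

lemma proj_class_scale:
  fixes f :: "'v \<Rightarrow>\<^sub>0 'a::field"
  assumes "a \<noteq> 0"
  shows "proj_class (Poly_Mapping.map ((*) a) f) = proj_class f"
proof -
  have *: "Poly_Mapping.map ((*) c) (Poly_Mapping.map ((*) b) g) = Poly_Mapping.map ((*) (c * b)) g"
    for b c and g :: "'v \<Rightarrow>\<^sub>0 'a"
    by (rule poly_mapping_eqI) (simp add: lookup_map_mult)
  have "\<exists>b. c = b * a \<and> b \<noteq> 0" if "c \<noteq> 0" for c
    using assms that by (intro exI[of _ "c / a"]) auto
  then show ?thesis
    using assms unfolding proj_class_def * by (auto; metis mult_eq_0_iff)
qed

lemma hessian_map_proj_class:
  fixes f :: "(nat, 'a::field) mpol"
  shows "hessian_map r (proj_class f) = proj_class (hess r f)"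
proof -
  have "proj_class (hess r g) = proj_class (hess r f)" if "g \<in> proj_class f" for g
    using that by (auto simp: proj_class_def[of f] hess_scale proj_class_scale simp del: power_Suc)
  moreover have "proj_class f \<noteq> {}"
    using proj_class_self by blast
  ultimately show ?thesis
    unfolding hessian_map_def by auto
qed

lemma keys_partial:
  "Poly_Mapping.keys (partial i f)
     \<subseteq> {m. m + Poly_Mapping.single i 1 \<in> Poly_Mapping.keys f}"
proof
  fix k assume "k \<in> Poly_Mapping.keys (partial i f)"
  then have "Poly_Mapping.lookup (partial i f) k \<noteq> 0" by (simp add: in_keys_iff)
  then obtain m where m: "m \<in> Poly_Mapping.keys f"
    "k = m - Poly_Mapping.single i 1" "Poly_Mapping.lookup m i \<noteq> 0"
    unfolding partial_def lookup_sum lookup_single when_def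
    by (elim sum.not_neutral_contains_not_neutral) (auto split: if_splits intro!: that gr0I)
  have "k + Poly_Mapping.single i 1 = m"
    by (rule poly_mapping_eqI)
      (use m in \<open>auto simp: lookup_add lookup_minus lookup_single when_def\<close>)
  with m show "k \<in> {m. m + Poly_Mapping.single i 1 \<in> Poly_Mapping.keys f}" by simp
qed

lemma monomials_partial:
  assumes "Poly_Mapping.keys f \<subseteq> monomials d r"
  shows "Poly_Mapping.keys (partial i f) \<subseteq> monomials (d - 1) r"
proof
  fix k assume "k \<in> Poly_Mapping.keys (partial i f)"
  with keys_partial[of i f] assms have *: "k + Poly_Mapping.single i 1 \<in> monomials d r" by blast
  have "Poly_Mapping.keys k \<subseteq> Poly_Mapping.keys (k + Poly_Mapping.single i 1)"
    by (auto simp: in_keys_iff lookup_add)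
  with * show "k \<in> monomials (d - 1) r"
    by (auto simp: monomials_def pp_deg_add)
qed

lemma monomials_mult:
  fixes f g :: "(nat, 'a::comm_ring_1) mpol"
  assumes "Poly_Mapping.keys f \<subseteq> monomials a r" "Poly_Mapping.keys g \<subseteq> monomials b r"
  shows "Poly_Mapping.keys (f * g) \<subseteq> monomials (a + b) r"
proof
  fix k assume "k \<in> Poly_Mapping.keys (f * g)"
  with keys_mult[of f g] obtain m n
    where "k = m + n" "m \<in> Poly_Mapping.keys f" "n \<in> Poly_Mapping.keys g" by blast
  with assms show "k \<in> monomials (a + b) r"
    using Poly_Mapping.keys_add[of m n] by (fastforce simp: monomials_def pp_deg_add)
qed

lemma monomials_hess:
  fixes f :: "(nat, 'a::comm_ring_1) mpol"
  assumes "Poly_Mapping.keys f \<subseteq> monomials d r"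
  shows "Poly_Mapping.keys (hess r f) \<subseteq> monomials ((r + 1) * (d - 2)) r"
proof -
  have one: "Poly_Mapping.keys (1 :: (nat, 'a) mpol) \<subseteq> monomials 0 r"
    by (auto simp: monomials_def pp_deg_def)
  have part: "Poly_Mapping.keys (partial i (partial j f)) \<subseteq> monomials (d - 2) r" for i j
    using monomials_partial[OF monomials_partial[OF assms]] by (simp add: numeral_2_eq_2)
  have prod: "Poly_Mapping.keys (\<Prod>i = 0..<n. partial i (partial (p i) f)) \<subseteq> monomials (n * (d - 2)) r"
    for n and p :: "nat \<Rightarrow> nat"
  proof (induction n)
    case (Suc n)
    from monomials_mult[OF this part[of n "p n"]] show ?case
      by (simp add: ac_simps)
  qed (use one in simp)
  have sgn: "Poly_Mapping.keys (signof p * g) = Poly_Mapping.keys g"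
    for p :: "nat \<Rightarrow> nat" and g :: "(nat, 'a) mpol"
    by (auto simp: sign_def in_keys_iff)
  have sum: "Poly_Mapping.keys (sum G P) \<subseteq> M"
    if "\<And>p. p \<in> P \<Longrightarrow> Poly_Mapping.keys (G p) \<subseteq> M"
    for G :: "(nat \<Rightarrow> nat) \<Rightarrow> (nat, 'a) mpol" and P M
    using that
  proof (induction P rule: infinite_finite_induct)
    case (insert p P)
    then show ?case using Poly_Mapping.keys_add[of "G p" "sum G P"] by fastforce
  qed auto
  have "hess r f = (\<Sum>p\<in>{p. p permutes {0..<r + 1}}.
      signof p * (\<Prod>i = 0..<r + 1. partial i (partial (p i) f)))"
    unfolding hess_def det_def
    by (auto intro!: sum.cong prod.cong arg_cong2[where f = "(*)"] dest: permutes_in_image)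
  then show ?thesis
    by (auto intro!: sum simp only: sgn intro: prod[THEN subsetD])
qed

lemma hessian_map_in_topspace:
  assumes "p \<in> hessian_domain d r"
  shows "hessian_map r p \<in> topspace (hypersurfaces ((r + 1) * (d - 2)) r)"
proof -
  from assms obtain f where f: "Poly_Mapping.keys f \<subseteq> monomials d r" "p = proj_class f"
    by (auto simp: hessian_domain_def proj_points_def)
  with assms proj_class_self[of f] have "hess r f \<noteq> 0" by (simp add: hessian_domain_def)
  with f monomials_hess[OF f(1)] show ?thesis
    by (auto simp: hessian_map_proj_class proj_points_def simp del: add_mult_distrib)
qed

end

theory Submission
  imports Defs
begin

text \<open>
  Everything is deduced from the injectivity of the differential of \<open>f \<mapsto> hess f\<close> at one point. The
  chosen point is \<open>\<Sum> t\<^bsup>\<omega> \<alpha>\<^esup> x\<^sup>\<alpha>\<close>, where \<open>\<omega>\<close> is \<open>0\<close> on the powers \<open>x\<^sub>i\<^sup>d\<close>, \<open>1\<close> on the squarefree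
  monomials and \<open>2\<close> on all others. In logarithmic coordinates \<open>u\<^sub>\<alpha> = da\<^sub>\<alpha>/a\<^sub>\<alpha>\<close>, with \<open>u\<^sub>i\<close> belonging to
  \<open>x\<^sub>i\<^sup>d\<close>, the lowest-order terms in \<open>t\<close> of suitable coefficients of the Hessian have the differentials
  \<open>\<Sum> u\<^sub>i - u\<^sub>l + u\<^sub>\<alpha>\<close> (if \<open>x\<^sub>l\<^sup>2\<close> divides \<open>x\<^sup>\<alpha>\<close>) and \<open>\<Sum> u\<^sub>i - u\<^sub>l - u\<^sub>m + 2 u\<^sub>I\<close> (if \<open>x\<^sup>I\<close> is squarefree and
  divisible by \<open>x\<^sub>l x\<^sub>m\<close>). If they all vanish then \<open>u = 0\<close>: all \<open>u\<^sub>i\<close> agree because of \<open>x\<^sub>l\<^sup>2 x\<^sub>m\<^sup>d\<^sup>-\<^sup>2\<close> for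
  \<open>d \<ge> 4\<close> and because of \<open>x\<^sub>l x\<^sub>m x\<^sub>k\<close> for \<open>d = 3\<close>, and then \<open>\<Sum> u\<^sub>i = 0\<close>.

  Dimension theory is replaced by counting: \<open>n + 1\<close> forms of the same degree in \<open>n\<close> variables satisfy a
  homogeneous relation. A chain of irreducible closed sets of length \<open>n\<close> in the closure of an image of
  projective \<open>(n - 1)\<close>-space would give \<open>n + 1\<close> independent forms there. Conversely, injectivity of the
  differential makes suitable forms on the images of a flag of linear subspaces independent, so the
  closures of these images form a strict chain. The same count, applied to these forms and a power of a
  coordinate, yields an equation for that coordinate on the generic fibre.
\<close>

section \<open>Forms and relations between them\<close>

abbreviation keys :: "('v \<Rightarrow>\<^sub>0 'a::zero) \<Rightarrow> 'v set" where
  "keys \<equiv> Poly_Mapping.keys"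

abbreviation lookup :: "('v \<Rightarrow>\<^sub>0 'a::zero) \<Rightarrow> 'v \<Rightarrow> 'a" where
  "lookup \<equiv> Poly_Mapping.lookup"

definition pps :: "'v set \<Rightarrow> nat \<Rightarrow> 'v pp set" where
  "pps I D = {m. keys m \<subseteq> I \<and> pp_deg m = D}"

definition forms :: "'v set \<Rightarrow> nat \<Rightarrow> ('v, 'a::comm_ring_1) mpol set" where
  "forms I D = {F. keys F \<subseteq> pps I D}"

abbreviation var :: "'v \<Rightarrow> ('v, 'a::comm_ring_1) mpol" where
  "var v \<equiv> Poly_Mapping.single (Poly_Mapping.single v (Suc 0)) 1"

abbreviation const :: "'a \<Rightarrow> ('v, 'a::comm_ring_1) mpol" where
  "const c \<equiv> Poly_Mapping.single 0 c"

lemma peval_const [simp]: "peval (const c) x = c"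
  by (simp add: peval_single)

lemma peval_one [simp]: "peval 1 x = 1"
  by (simp add: single_one[symmetric] del: single_one)

lemma peval_var [simp]: "peval (var v) x = x v"
  by (simp add: peval_single)

lemma peval_power: "peval (F ^ n) x = peval F x ^ n"
  by (induction n) (simp_all add: peval_mult)

lemma peval_prod: "peval (\<Prod>i\<in>A. F i) x = (\<Prod>i\<in>A. peval (F i) x)"
  by (induction A rule: infinite_finite_induct) (simp_all add: peval_mult)

lemmas peval_hom = peval_add peval_mult peval_sum peval_prod peval_power

lemma peval_cong_keys:
  assumes "\<And>m v. m \<in> keys F \<Longrightarrow> v \<in> keys m \<Longrightarrow> x v = y v"
  shows "peval F x = peval F y"
  unfolding peval_def using assms by (intro sum.cong refl arg_cong2[where f = "(*)"] prod.cong) auto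

lemma forms_imp_homogeneous: "F \<in> forms I D \<Longrightarrow> homogeneous D F"
  by (auto simp: forms_def homogeneous_def pps_def)

lemma forms_add: "F \<in> forms I D \<Longrightarrow> G \<in> forms I D \<Longrightarrow> F + G \<in> forms I D"
  unfolding forms_def using Poly_Mapping.keys_add[of F G] by blast

lemma forms_zero [simp]: "0 \<in> forms I D"
  by (simp add: forms_def)

lemma forms_sum: "(\<And>i. i \<in> A \<Longrightarrow> F i \<in> forms I D) \<Longrightarrow> (\<Sum>i\<in>A. F i) \<in> forms I D"
  by (induction A rule: infinite_finite_induct) (simp_all add: forms_add)

lemma pps_add: "m \<in> pps I D \<Longrightarrow> n \<in> pps I E \<Longrightarrow> m + n \<in> pps I (D + E)"
  unfolding pps_def using Poly_Mapping.keys_add[of m n] by (auto simp: pp_deg_add)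

lemma forms_mult: "F \<in> forms I D \<Longrightarrow> G \<in> forms I E \<Longrightarrow> F * G \<in> forms I (D + E)"
  unfolding forms_def using keys_mult[of F G] pps_add by fastforce

lemma zero_in_pps [simp]: "0 \<in> pps I 0"
  by (simp add: pps_def pp_deg_def)

lemma forms_const [simp]: "const c \<in> forms I 0"
  by (simp add: forms_def)

lemma forms_const_mult: "F \<in> forms I D \<Longrightarrow> const c * F \<in> forms I D"
  using forms_mult[OF forms_const] by fastforce

lemma forms_one [simp]: "1 \<in> forms I 0"
  by (simp add: single_one[symmetric] del: single_one)

lemma forms_var: "v \<in> I \<Longrightarrow> var v \<in> forms I 1"
  by (simp add: forms_def pps_def)

lemma forms_power: "F \<in> forms I D \<Longrightarrow> F ^ n \<in> forms I (n * D)"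
  by (induction n) (simp_all add: forms_mult)

lemma forms_prod:
  "finite A \<Longrightarrow> (\<And>i. i \<in> A \<Longrightarrow> F i \<in> forms I (D i)) \<Longrightarrow> (\<Prod>i\<in>A. F i) \<in> forms I (\<Sum>i\<in>A. D i)"
  by (induction A rule: finite_induct) (simp_all add: forms_mult)

lemma forms_mono: "I \<subseteq> J \<Longrightarrow> forms I D \<subseteq> forms J D"
  by (auto simp: forms_def pps_def)

lemma forms_single: "m \<in> pps I D \<Longrightarrow> Poly_Mapping.single m c \<in> forms I D"
  by (simp add: forms_def)

definition psubst :: "('v, 'a::comm_ring_1) mpol \<Rightarrow> ('v \<Rightarrow> ('w, 'a) mpol) \<Rightarrow> ('w, 'a) mpol" where
  "psubst F G = (\<Sum>m\<in>keys F. const (lookup F m) * (\<Prod>v\<in>keys m. G v ^ lookup m v))"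

lemma peval_psubst: "peval (psubst F G) x = peval F (\<lambda>v. peval (G v) x)"
  by (simp add: psubst_def peval_hom peval_def[of F])

lemma psubst_forms:
  assumes "homogeneous D F" "\<And>v. G v \<in> forms I E"
  shows "psubst F G \<in> forms I (D * E)"
  unfolding psubst_def
proof (intro forms_sum forms_const_mult)
  fix m assume "m \<in> keys F"
  then have "D = (\<Sum>v\<in>keys m. lookup m v)"
    using assms(1) by (auto simp: homogeneous_def pp_deg_def)
  then show "(\<Prod>v\<in>keys m. G v ^ lookup m v) \<in> forms I (D * E)"
    using forms_prod[of "keys m" "\<lambda>v. G v ^ lookup m v" I "\<lambda>v. lookup m v * E"] forms_power[OF assms(2)]
    by (simp add: sum_distrib_right)
qed

lemma peval_forms:
  assumes "F \<in> forms I D" "finite (pps I D)"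
  shows "peval F x = (\<Sum>m\<in>pps I D. lookup F m * (\<Prod>v\<in>keys m. x v ^ lookup m v))"
  using assms by (intro peval_superset) (auto simp: forms_def)

section \<open>Counting power products of a given degree\<close>

lemma pps_inj_on_lookup:
  assumes "finite I" "a \<in> I"
  shows "inj_on (\<lambda>m. restrict (lookup m) (I - {a})) (pps I D)"
proof (rule inj_onI, rule poly_mapping_eqI)
  fix m n v assume m: "m \<in> pps I D" and n: "n \<in> pps I D"
    and eq: "restrict (lookup m) (I - {a}) = restrict (lookup n) (I - {a})"
  have *: "lookup m w = lookup n w" if "w \<noteq> a" for w
  proof (cases "w \<in> I")
    case True then show ?thesis using fun_cong[OF eq, of w] that by auto
  next
    case False then show ?thesis using m n unfolding pps_def by (metis (mono_tags) in_keys_iff mem_Collect_eq subsetD)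
  qed
  have "sum (lookup m) I = D" "sum (lookup n) I = D"
    using m n assms(1) by (auto simp: pps_def pp_deg_superset)
  \<comment> \<open>As the degree is fixed, the exponent of \<open>a\<close> is determined by the
    other exponents.\<close>
  then have "lookup m a + sum (lookup m) (I - {a}) = lookup n a + sum (lookup n) (I - {a})"
    using assms by (metis sum.remove)
  moreover have "sum (lookup m) (I - {a}) = sum (lookup n) (I - {a})"
    by (intro sum.cong) (auto intro: *)
  ultimately show "lookup m v = lookup n v" using * by (cases "v = a") auto
qed

lemma pps_lookup_le:
  assumes "finite I" "m \<in> pps I D" shows "lookup m v \<le> D"
proof (cases "v \<in> I")
  case True
  then have "lookup m v \<le> sum (lookup m) I" using assms by (intro member_le_sum) auto
  then show ?thesis using assms by (auto simp: pps_def pp_deg_superset)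
next
  case False then show ?thesis using assms(2) unfolding pps_def
    by (metis (mono_tags) in_keys_iff mem_Collect_eq subsetD zero_le)
qed

lemma pps_image_subset:
  assumes "finite I"
  shows "(\<lambda>m. restrict (lookup m) (I - {a})) ` pps I D \<subseteq> PiE (I - {a}) (\<lambda>_. {..D})"
  using pps_lookup_le[OF assms] by (intro image_subsetI restrict_PiE_iff[THEN iffD2]) auto

lemma finite_pps:
  assumes "finite I" shows "finite (pps I D)"
proof (cases "I = {}")
  case True
  then have "pps I D \<subseteq> {0}" by (auto simp: pps_def)
  then show ?thesis using finite_subset by blast
next
  case False
  then obtain a where a: "a \<in> I" by blast
  have "finite (PiE (I - {a}) (\<lambda>_. {..D}))" using assms by (intro finite_PiE) auto
  then show ?thesis
    using finite_subset[OF pps_image_subset[OF assms]] finite_imageD[OF _ pps_inj_on_lookup[OF assms a]] by blast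
qed

text \<open>The exponent of one chosen variable is not free, hence the power
  \<open>card I - 1\<close>. Against the power \<open>card I\<close> in \<open>card_pps_ge\<close>
  this decides the count in \<open>forms_dependent\<close>.\<close>

lemma card_pps_le:
  assumes "finite I" "I \<noteq> {}" shows "card (pps I D) \<le> (D + 1) ^ (card I - 1)"
proof -
  obtain a where a: "a \<in> I" using assms by blast
  have "card (pps I D) \<le> card (PiE (I - {a}) (\<lambda>_. {..D}))"
    using assms by (intro card_inj_on_le[OF pps_inj_on_lookup[OF assms(1) a] pps_image_subset[OF assms(1)]] finite_PiE) auto
  also have "\<dots> = (D + 1) ^ (card I - 1)"
    using assms a by (simp add: card_PiE)
  finally show ?thesis .
qed

lemma lookup_sum_single:
  assumes "finite I" shows "lookup (\<Sum>v\<in>I. Poly_Mapping.single v (f v)) w = (if w \<in> I then f w else (0::'a::comm_monoid_add))"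
  using assms by (simp add: lookup_sum lookup_single when_def sum.delta)

lemma keys_sum_single: "finite I \<Longrightarrow> keys (\<Sum>v\<in>I. Poly_Mapping.single v (f v)) \<subseteq> I"
  by (metis (mono_tags) in_keys_iff lookup_sum_single subsetI)

text \<open>Arbitrary exponents at most \<open>s\<close> on \<open>I\<close> have sum at most
  \<open>card I * s\<close>, and the additional variable \<open>a\<close> takes up the
  difference.\<close>

lemma card_pps_ge:
  assumes "finite I" "a \<notin> I"
  shows "(s + 1) ^ card I \<le> card (pps (insert a I) (card I * s))"
proof -
  define f where "f g = (\<Sum>v\<in>insert a I. Poly_Mapping.single v (if v = a then card I * s - sum g I else g v))" for g
  have lk: "lookup (f g) v = (if v = a then card I * s - sum g I else if v \<in> I then g v else 0)" for g v
    unfolding f_def using assms by (subst lookup_sum_single) auto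
  have "inj_on f (PiE I (\<lambda>_. {..s}))"
  proof (rule inj_onI)
    fix g h assume g: "g \<in> PiE I (\<lambda>_. {..s})" "h \<in> PiE I (\<lambda>_. {..s})" "f g = f h"
    show "g = h"
    proof (rule PiE_ext[OF g(1,2)])
      fix v assume "v \<in> I"
      then show "g v = h v" using lk[of g v] lk[of h v] g(3) assms(2) by (auto split: if_splits)
    qed
  qed
  moreover have "f ` PiE I (\<lambda>_. {..s}) \<subseteq> pps (insert a I) (card I * s)"
  proof
    fix m assume "m \<in> f ` PiE I (\<lambda>_. {..s})"
    then obtain g where g: "g \<in> PiE I (\<lambda>_. {..s})" "m = f g" by blast
    have "keys m \<subseteq> insert a I" unfolding g f_def using assms by (intro keys_sum_single) auto
    moreover have "sum g I \<le> card I * s"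
      using sum_bounded_above[of I g s] g(1) by (fastforce simp: PiE_iff)
    moreover have "sum (lookup m) I = sum g I" unfolding g using assms by (intro sum.cong) (auto simp: lk)
    ultimately show "m \<in> pps (insert a I) (card I * s)"
      using assms lk[of g a] by (simp add: pps_def pp_deg_superset[of "insert a I"] g)
  qed
  ultimately have "card (PiE I (\<lambda>_. {..s})) \<le> card (pps (insert a I) (card I * s))"
    using assms by (intro card_inj_on_le finite_pps) auto
  then show ?thesis using assms by (simp add: card_PiE)
qed

section \<open>Linear relations, and relations between forms\<close>

lemma nontrivial_relation:
  fixes M :: "'a \<Rightarrow> 'b \<Rightarrow> 'k::field"
  assumes "finite B" "finite A" "card B < card A"
  shows "\<exists>c. (\<exists>a\<in>A. c a \<noteq> 0) \<and> (\<forall>b\<in>B. (\<Sum>a\<in>A. c a * M a b) = 0)"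
  using assms
proof (induction B arbitrary: A M rule: finite_induct)
  case empty
  then have "A \<noteq> {}" by auto
  then show ?case by (intro exI[of _ "\<lambda>_. 1"]) auto
next
  case (insert b B)
  show ?case
  proof (cases "\<forall>a\<in>A. M a b = 0")
    case True
    have "card B < card A" using insert by simp
    with insert obtain c where "\<exists>a\<in>A. c a \<noteq> 0" "\<forall>b\<in>B. (\<Sum>a\<in>A. c a * M a b) = 0" by blast
    with True show ?thesis by (intro exI[of _ c]) auto
  next
    case False
    then obtain p where p: "p \<in> A" "M p b \<noteq> 0" by blast
    \<comment> \<open>Equation \<open>b\<close> eliminates the unknown \<open>p\<close>. The system
      that remains is \<open>?M\<close>, and \<open>?c\<close> recovers the value at
      \<open>p\<close> from equation \<open>b\<close>.\<close>
    let ?A = "A - {p}" and ?M = "\<lambda>a x. M a x - M a b / M p b * M p x"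
    have "card B < card ?A" using insert p by simp
    with insert.IH[of ?A ?M] insert.prems obtain c where c: "\<exists>a\<in>?A. c a \<noteq> 0" "\<forall>x\<in>B. (\<Sum>a\<in>?A. c a * ?M a x) = 0"
      by blast
    let ?c = "c(p := - (\<Sum>a\<in>?A. c a * M a b) / M p b)"
    have eq: "(\<Sum>a\<in>A. ?c a * M a x) = (\<Sum>a\<in>?A. c a * ?M a x)" for x
    proof -
      have "(\<Sum>a\<in>A. ?c a * M a x) = ?c p * M p x + (\<Sum>a\<in>?A. c a * M a x)"
        using insert p by (simp add: sum.remove[of A p])
      also have "\<dots> = (\<Sum>a\<in>?A. c a * ?M a x)"
        by (simp add: right_diff_distrib sum_subtractf sum_distrib_right sum_divide_distrib sum_negf mult.assoc)
      finally show ?thesis .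
    qed
    have "(\<Sum>a\<in>A. ?c a * M a b) = 0" unfolding eq using p by simp
    moreover have "\<forall>x\<in>B. (\<Sum>a\<in>A. ?c a * M a x) = 0" using c eq by simp
    moreover have "\<exists>a\<in>A. ?c a \<noteq> 0" using c(1) by auto
    ultimately show ?thesis by (intro exI[of _ ?c]) auto
  qed
qed

text \<open>For large \<open>t\<close> the products of degree \<open>t\<close> in more than
  \<open>card A\<close> forms outnumber the monomials of degree \<open>t * D\<close> in the
  variables \<open>A\<close>, since their number grows like a higher power of \<open>t\<close>. The
  coefficients of a linear relation between these products are those of
  \<open>\<Phi>\<close>.\<close>

lemma forms_dependent:
  fixes G :: "'w \<Rightarrow> ('v, 'k::field) mpol"
  assumes A: "finite A" "A \<noteq> {}" and J: "finite J" "card A < card J"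
    and G: "\<And>j. j \<in> J \<Longrightarrow> G j \<in> forms A D"
  shows "\<exists>t \<Phi>. \<Phi> \<in> forms J t \<and> \<Phi> \<noteq> 0 \<and> (\<forall>x. peval \<Phi> (\<lambda>j. peval (G j) x) = 0)"
proof -
  define n where "n = card A"
  have n: "n > 0" using A by (auto simp: n_def)
  have "n + 1 \<le> card J" using J by (simp add: n_def)
  then obtain J' where J': "J' \<subseteq> J" "card J' = n + 1" by (meson obtain_subset_with_card_n)
  then obtain a where "a \<in> J'" by fastforce
  define I where "I = J' - {a}"
  have aI: "J' = insert a I" "a \<notin> I" using \<open>a \<in> J'\<close> by (simp_all add: I_def insert_absorb)
  have fin: "finite I" using finite_subset[OF J'(1) J(1)] by (simp add: I_def)
  have cI: "card I = n" using J' aI fin by simp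
  \<comment> \<open>With \<open>t = n * s\<close> this choice gives \<open>(t * D + 1) ^ (n - 1)
    \<le> s * (s + 1) ^ (n - 1) < (s + 1) ^ n\<close>, because
    \<open>t * D + 1 \<le> (D * n + 1) * (s + 1)\<close>.\<close>
  define s where "s = (D * n + 1) ^ (n - 1)"
  define t where "t = n * s"
  have "card (pps A (t * D)) \<le> (t * D + 1) ^ (n - 1)"
    using card_pps_le[OF A] by (simp add: n_def)
  also have "\<dots> \<le> ((D * n + 1) * (s + 1)) ^ (n - 1)"
    by (intro power_mono) (auto simp: t_def algebra_simps)
  also have "\<dots> = s * (s + 1) ^ (n - 1)"
    by (simp only: power_mult_distrib s_def)
  also have "\<dots> < (s + 1) * (s + 1) ^ (n - 1)" by simp
  also have "\<dots> = (s + 1) ^ n" using n by (metis power_minus_mult mult.commute)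
  also have "\<dots> \<le> card (pps J' t)" using card_pps_ge[OF fin aI(2), of s] by (simp add: cI aI t_def)
  finally have less: "card (pps A (t * D)) < card (pps J' t)" .
  have finJ': "finite J'" by (rule finite_subset[OF J'(1) J(1)])
  define H where "H m = (\<Prod>j\<in>keys m. G j ^ lookup m j)" for m
  obtain c where c: "\<exists>m\<in>pps J' t. c m \<noteq> 0"
      "\<forall>k\<in>pps A (t * D). (\<Sum>m\<in>pps J' t. c m * lookup (H m) k) = 0"
    using nontrivial_relation[OF finite_pps[OF A(1)] finite_pps[OF finJ'] less, of "\<lambda>m k. lookup (H m) k"]
    by blast
  define \<Phi> where "\<Phi> = (\<Sum>m\<in>pps J' t. Poly_Mapping.single m (c m))"
  have lk: "lookup \<Phi> m = (if m \<in> pps J' t then c m else 0)" for m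
    unfolding \<Phi>_def by (rule lookup_sum_single[OF finite_pps[OF finJ']])
  have "\<Phi> \<in> forms J' t" unfolding \<Phi>_def by (intro forms_sum forms_single)
  then have "\<Phi> \<in> forms J t" using forms_mono[OF J'(1)] by blast
  moreover have "\<Phi> \<noteq> 0"
  proof
    assume "\<Phi> = 0"
    then have "lookup \<Phi> m = 0" for m by simp
    then show False using c(1) unfolding lk by metis
  qed
  moreover have "peval \<Phi> (\<lambda>j. peval (G j) x) = 0" for x
  proof -
    have H: "H m \<in> forms A (t * D)" if "m \<in> pps J' t" for m
    proof -
      have "(\<Prod>j\<in>keys m. G j ^ lookup m j) \<in> forms A (\<Sum>j\<in>keys m. lookup m j * D)"
        using that J' by (intro forms_prod forms_power G) (auto simp: pps_def)
      then show ?thesis using that by (simp add: H_def pps_def pp_deg_def flip: sum_distrib_right)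
    qed
    have "peval \<Phi> (\<lambda>j. peval (G j) x) = (\<Sum>m\<in>pps J' t. c m * peval (H m) x)"
      by (simp add: \<Phi>_def peval_sum peval_single H_def peval_hom)
    also have "\<dots> = (\<Sum>m\<in>pps J' t. \<Sum>k\<in>pps A (t * D). c m * (lookup (H m) k * (\<Prod>v\<in>keys k. x v ^ lookup k v)))"
      by (intro sum.cong refl) (simp only: peval_forms[OF H finite_pps[OF A(1)]] sum_distrib_left)
    also have "\<dots> = (\<Sum>k\<in>pps A (t * D). (\<Sum>m\<in>pps J' t. c m * lookup (H m) k) * (\<Prod>v\<in>keys k. x v ^ lookup k v))"
      by (subst sum.swap) (simp add: sum_distrib_right mult.assoc)
    also have "\<dots> = 0" using c(2) by simp
    finally show ?thesis .
  qed
  ultimately show ?thesis by blast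
qed

section \<open>Nonvanishing of polynomials, tested on lines and curves\<close>

lemma peval_poly:
  fixes F :: "('v, 'a::comm_ring_1) mpol" and p :: "'v \<Rightarrow> 'a poly"
  obtains q where "\<And>s. peval F (\<lambda>v. poly (p v) s) = poly q s"
proof -
  let ?q = "\<Sum>m\<in>keys F. smult (lookup F m) (\<Prod>v\<in>keys m. p v ^ lookup m v)"
  have "peval F (\<lambda>v. poly (p v) s) = poly ?q s" for s
    by (simp add: peval_def poly_sum poly_prod)
  then show ?thesis by (rule that)
qed

lemma poly_zero_if_zero_away_from_0:
  fixes p :: "'a::field_char_0 poly"
  assumes "\<And>s. s \<noteq> 0 \<Longrightarrow> poly p s = 0" shows "p = 0"
proof (rule ccontr)
  assume "p \<noteq> 0"
  then have "finite (insert 0 {s. poly p s = 0})" by (simp add: poly_roots_finite)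
  moreover have "insert 0 {s. poly p s = 0} = UNIV" using assms by auto
  ultimately show False using infinite_UNIV_char_0[where 'a = 'a] by simp
qed

text \<open>On the line through \<open>x\<close> and \<open>y\<close> both become nonzero
  polynomials in \<open>s\<close>, and so does their product. This is the irreducibility of affine
  space in the form used below: two open conditions that can be met separately can be met
  together.\<close>

lemma peval_both_nonzero:
  fixes F G :: "('v, 'k::field_char_0) mpol"
  assumes "peval F x \<noteq> 0" "peval G y \<noteq> 0"
  shows "\<exists>s. peval F (\<lambda>v. x v + s * (y v - x v)) \<noteq> 0 \<and> peval G (\<lambda>v. x v + s * (y v - x v)) \<noteq> 0"
proof -
  obtain p where p: "\<And>s. peval F (\<lambda>v. x v + s * (y v - x v)) = poly p s"
    using peval_poly[of F "\<lambda>v. [:x v, y v - x v:]"] by (auto simp: mult.commute)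
  obtain q where q: "\<And>s. peval G (\<lambda>v. x v + s * (y v - x v)) = poly q s"
    using peval_poly[of G "\<lambda>v. [:x v, y v - x v:]"] by (auto simp: mult.commute)
  have "p \<noteq> 0" "q \<noteq> 0"
    using assms p[of 0] q[of 1] by auto
  then have "p * q \<noteq> 0" by simp
  then obtain s where "poly (p * q) s \<noteq> 0" using poly_all_0_iff_0 by blast
  then show ?thesis using p q by (intro exI[of _ s]) auto
qed

lemma peval_prod_nonzero:
  fixes F :: "'i \<Rightarrow> ('v, 'k::field_char_0) mpol"
  assumes "finite A" "\<And>i. i \<in> A \<Longrightarrow> \<exists>x. peval (F i) x \<noteq> 0"
  shows "\<exists>x. peval (\<Prod>i\<in>A. F i) x \<noteq> 0"
  using assms
proof (induction A rule: finite_induct)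
  case (insert i A)
  then obtain x y where "peval (F i) x \<noteq> 0" "peval (\<Prod>i\<in>A. F i) y \<noteq> 0" by blast
  from peval_both_nonzero[OF this] insert(1,2) show ?case by (auto simp: peval_mult)
qed simp

text \<open>\<open>g\<close> is the exact power of the variable \<open>v\<close> that divides
  \<open>F\<close>, so the quotient \<open>F'\<close> stays nonzero at \<open>v = 0\<close>, where
  it becomes \<open>F0\<close>. This removes a variable from a relation without making the relation
  trivial.\<close>

lemma split_variable:
  fixes F :: "('v, 'a::comm_ring_1) mpol"
  assumes "F \<noteq> 0"
  obtains g F' F0 where "\<And>x. peval F x = x v ^ g * peval F' x" "F0 \<noteq> 0"
    "\<And>x. x v = 0 \<Longrightarrow> peval F' x = peval F0 x"
    "\<And>m. m \<in> keys F0 \<Longrightarrow> v \<notin> keys m \<and> keys m \<subseteq> \<Union>(keys ` keys F)"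
    "\<And>I D. F \<in> forms I D \<Longrightarrow> F' \<in> forms I (D - g) \<and> F0 \<in> forms (I - {v}) (D - g)"
proof -
  define g where "g = Min ((\<lambda>m. lookup m v) ` keys F)"
  have ne: "keys F \<noteq> {}" using assms by simp
  have g_le: "g \<le> lookup m v" if "m \<in> keys F" for m
    unfolding g_def using that by (intro Min_le) auto
  have "g \<in> (\<lambda>m. lookup m v) ` keys F"
    unfolding g_def using ne by (intro Min_in) auto
  then obtain m0 where m0: "m0 \<in> keys F" "lookup m0 v = g" by blast
  define sh where "sh m = m - Poly_Mapping.single v g" for m :: "'v pp"
  have sh: "sh m + Poly_Mapping.single v g = m" if "m \<in> keys F" for m
    using g_le[OF that] by (intro poly_mapping_eqI) (auto simp: sh_def lookup_add lookup_minus lookup_single when_def)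
  define F' where "F' = (\<Sum>m\<in>keys F. Poly_Mapping.single (sh m) (lookup F m))"
  define N where "N = {m \<in> keys F. lookup m v = g}"
  define F0 where "F0 = (\<Sum>m\<in>N. Poly_Mapping.single (sh m) (lookup F m))"
  have finN: "finite N" by (simp add: N_def)
  have lsh: "lookup (sh m) w = (if w = v then lookup m v - g else lookup m w)" for m w
    by (simp add: sh_def lookup_minus lookup_single when_def)
  have ksh: "keys (sh m) \<subseteq> keys m" for m
    by (auto simp: in_keys_iff lsh split: if_splits)
  have 1: "peval F x = x v ^ g * peval F' x" for x
  proof -
    have "(\<Sum>m\<in>keys F. Poly_Mapping.single (sh m + Poly_Mapping.single v g) (lookup F m)) = F"
      using sh by (subst (3) mpol_sum_single) (auto intro!: sum.cong)
    then have "peval F x = peval (\<Sum>m\<in>keys F. Poly_Mapping.single (sh m + Poly_Mapping.single v g) (lookup F m)) x"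
      by (rule arg_cong[OF sym])
    also have "\<dots> = (\<Sum>m\<in>keys F. peval (Poly_Mapping.single (sh m + Poly_Mapping.single v g) (lookup F m)) x)"
      by (rule peval_sum)
    also have "\<dots> = (\<Sum>m\<in>keys F. peval (Poly_Mapping.single (sh m) (lookup F m) * Poly_Mapping.single (Poly_Mapping.single v g) 1) x)"
      by (simp add: mult_single)
    also have "\<dots> = (\<Sum>m\<in>keys F. peval (Poly_Mapping.single (sh m) (lookup F m)) x) * x v ^ g"
      by (simp add: peval_mult peval_single[of "Poly_Mapping.single v g"] flip: sum_distrib_right)
    finally show ?thesis by (simp add: F'_def peval_sum mult.commute)
  qed
  \<comment> \<open>The shift is injective on the keys of \<open>F\<close>, so the coefficient of
    \<open>m0\<close> cannot cancel.\<close>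
  have "lookup F0 (sh m0) = lookup F m0"
  proof -
    have "lookup F0 (sh m0) = (\<Sum>m\<in>N. lookup F m when sh m = sh m0)"
      by (simp add: F0_def lookup_sum lookup_single)
    also have "\<dots> = (\<Sum>m\<in>N. lookup F m when m = m0)"
    proof (intro sum.cong refl arg_cong2[where f = "(when)"])
      fix m assume "m \<in> N"
      then have "sh m + Poly_Mapping.single v g = m" using sh by (simp add: N_def)
      then show "(sh m = sh m0) = (m = m0)" using sh[OF m0(1)] by metis
    qed
    also have "\<dots> = lookup F m0"
      using m0 finN by (simp add: when_def N_def)
    finally show ?thesis .
  qed
  then have 2: "F0 \<noteq> 0" using m0 by (auto simp: in_keys_iff)
  have 3: "peval F' x = peval F0 x" if "x v = 0" for x
  proof -
    have "peval (Poly_Mapping.single (sh m) (lookup F m)) x = 0" if "m \<in> keys F - N" for m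
    proof -
      have "lookup m v \<noteq> g" "g \<le> lookup m v" using that g_le by (auto simp: N_def)
      then have "v \<in> keys (sh m)" by (simp add: in_keys_iff lsh)
      then have "(\<Prod>w\<in>keys (sh m). x w ^ lookup (sh m) w) = 0"
        using \<open>x v = 0\<close> by (intro prod_zero bexI[of _ v]) (auto simp: in_keys_iff power_0_left)
      then show ?thesis by (simp only: peval_single mult_zero_right)
    qed
    then show ?thesis
      unfolding F'_def F0_def peval_sum by (intro sum.mono_neutral_right) (auto simp: N_def)
  qed
  have kF0: "\<exists>m'\<in>N. m = sh m'" if "m \<in> keys F0" for m
  proof -
    have "m \<in> (\<Union>m'\<in>N. keys (Poly_Mapping.single (sh m') (lookup F m')))"
      using that keys_sum[of "\<lambda>m'. Poly_Mapping.single (sh m') (lookup F m')" N] by (auto simp: F0_def)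
    then show ?thesis by (auto split: if_splits)
  qed
  have 4: "v \<notin> keys m \<and> keys m \<subseteq> \<Union>(keys ` keys F)" if "m \<in> keys F0" for m
    using kF0[OF that] ksh by (fastforce simp: N_def in_keys_iff lsh)
  have 5: "F' \<in> forms I (D - g) \<and> F0 \<in> forms (I - {v}) (D - g)" if "F \<in> forms I D" for I D
  proof
    have deg: "sh m \<in> pps I (D - g)" if "m \<in> keys F" for m
      using that \<open>F \<in> forms I D\<close> ksh[of m] pp_deg_add[of "sh m" "Poly_Mapping.single v g"] sh[OF that]
      by (auto simp: forms_def pps_def)
    show "F' \<in> forms I (D - g)"
      unfolding F'_def by (intro forms_sum forms_single deg)
    have "sh m \<in> pps (I - {v}) (D - g)" if "m \<in> N" for m
      using deg[of m] that by (auto simp: N_def pps_def in_keys_iff lsh)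
    then show "F0 \<in> forms (I - {v}) (D - g)"
      unfolding F0_def by (intro forms_sum forms_single)
  qed
  show ?thesis
  proof (rule that)
    show "peval F x = x v ^ g * peval F' x" for x by (rule 1)
    show "F0 \<noteq> 0" by (rule 2)
    show "peval F' x = peval F0 x" if "x v = 0" for x using that by (rule 3)
    show "v \<notin> keys m \<and> keys m \<subseteq> \<Union>(keys ` keys F)" if "m \<in> keys F0" for m using that by (rule 4)
    show "F' \<in> forms I (D - g) \<and> F0 \<in> forms (I - {v}) (D - g)" if "F \<in> forms I D" for I D using that by (rule 5)
  qed
qed

lemma peval_zero_imp_zero:
  fixes F :: "('v, 'k::field_char_0) mpol"
  assumes "finite I" "\<And>m. m \<in> keys F \<Longrightarrow> keys m \<subseteq> I" "\<And>x. peval F x = 0"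
  shows "F = 0"
  using assms
proof (induction I arbitrary: F rule: finite_induct)
  case empty
  then have "keys F \<subseteq> {0}" by auto
  then have "peval F (\<lambda>_. 0) = lookup F 0"
    by (subst peval_superset[of "{0}"]) auto
  then have "lookup F 0 = 0" using empty.prems(2) by simp
  then show ?case using \<open>keys F \<subseteq> {0}\<close> by (intro poly_mapping_eqI) (auto simp: in_keys_iff)
next
  case (insert v I)
  show ?case
  proof (rule ccontr)
    assume "F \<noteq> 0"
    then obtain g F' F0 where s: "\<And>x. peval F x = x v ^ g * peval F' x" "F0 \<noteq> 0"
      "\<And>x. x v = 0 \<Longrightarrow> peval F' x = peval F0 x"
      "\<And>m. m \<in> keys F0 \<Longrightarrow> v \<notin> keys m \<and> keys m \<subseteq> \<Union>(keys ` keys F)"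
      by (rule split_variable[where v = v]) blast
    \<comment> \<open>On a line in the direction \<open>v\<close> the split-off power is nonzero
      away from \<open>0\<close>, so \<open>F'\<close> vanishes there. Being polynomial in the
      parameter, it also vanishes at \<open>0\<close>, where it equals \<open>F0\<close>.\<close>
    have "peval F0 x = 0" for x
    proof -
      obtain q where q: "\<And>s. peval F' (\<lambda>w. poly (if w = v then [:0, 1:] else [:x w:]) s) = poly q s"
        using peval_poly[of F' "\<lambda>w. if w = v then [:0, 1:] else [:x w:]"] by metis
      have q: "peval F' (x(v := s)) = poly q s" for s
        unfolding q[symmetric] by (intro arg_cong[where f = "peval F'"]) auto
      have "poly q s = 0" if "s \<noteq> 0" for s
        using s(1)[of "x(v := s)"] insert.prems(2) that q by simp
      then have "q = 0" by (rule poly_zero_if_zero_away_from_0)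
      then have "peval F0 (x(v := 0)) = 0" using q[of 0] s(3)[of "x(v := 0)"] by simp
      then show ?thesis using s(4) by (subst peval_cong_keys[of F0 x "x(v := 0)"]) auto
    qed
    moreover have "keys m \<subseteq> I" if "m \<in> keys F0" for m
      using s(4)[OF that] insert.prems(1) by blast
    ultimately show False using insert.IH s(2) by blast
  qed
qed

lemma forms_nonzero_value:
  fixes F :: "('v, 'k::field_char_0) mpol"
  assumes "finite I" "F \<in> forms I D" "F \<noteq> 0"
  shows "\<exists>x. peval F x \<noteq> 0"
  using peval_zero_imp_zero[of I F] assms by (auto simp: forms_def pps_def)

text \<open>
  If the values of \<open>\<Phi>\<close> vanish along curves \<open>(y\<^sub>0 + \<dots>, s v\<^sub>1 + \<dots>, s v\<^sub>2 + \<dots>)\<close> with arbitrary tangent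
  vectors, the lowest-order term in \<open>s\<close> shows that \<open>\<Phi> = 0\<close>.
\<close>

lemma forms_zero_if_zero_on_curves:
  fixes \<Phi> :: "(nat, 'k::field_char_0) mpol"
  assumes \<Phi>: "\<Phi> \<in> forms {0..i} t" and y0: "y0 \<noteq> 0"
    and curve: "\<And>v :: nat \<Rightarrow> 'k. \<exists>q. coeff (q 0) 0 = y0 \<and> (\<forall>j\<in>{1..i}. coeff (q j) 0 = 0 \<and> coeff (q j) 1 = v j)
       \<and> (\<forall>s. peval \<Phi> (\<lambda>j. poly (q j) s) = 0)"
  shows "\<Phi> = 0"
proof (rule ccontr)
  assume "\<Phi> \<noteq> 0"
  then have ne: "keys \<Phi> \<noteq> {}" by simp
  \<comment> \<open>Terms of the highest degree \<open>k\<close> in the variable \<open>0\<close>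
    have the lowest degree \<open>t - k\<close> in the others, hence the lowest order in
    \<open>s\<close>. They make up \<open>\<Psi>\<close>.\<close>
  define k where "k = Max ((\<lambda>m. lookup m 0) ` keys \<Phi>)"
  have k: "lookup m 0 \<le> k" if "m \<in> keys \<Phi>" for m
    unfolding k_def using that by (intro Max_ge) auto
  have "k \<in> (\<lambda>m. lookup m 0) ` keys \<Phi>"
    unfolding k_def using ne by (intro Max_in) auto
  then obtain m0 where m0: "m0 \<in> keys \<Phi>" "lookup m0 0 = k" by blast
  define N where "N = {m \<in> keys \<Phi>. lookup m 0 = k}"
  define \<Psi> where "\<Psi> = (\<Sum>m\<in>N. Poly_Mapping.single m (lookup \<Phi> m))"
  have I: "{0..i} = insert 0 {1..i}" by auto
  have sup: "keys m \<subseteq> {0..i}" and deg: "t = lookup m 0 + sum (lookup m) {1..i}" if "m \<in> keys \<Phi>" for m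
    using \<Phi> that by (auto simp: forms_def pps_def pp_deg_superset[of "{0..i}"] I)
  have mon: "(\<Prod>j\<in>keys m. x j ^ lookup m j) = x 0 ^ lookup m 0 * (\<Prod>j\<in>{1..i}. x j ^ lookup m j)"
    if "m \<in> keys \<Phi>" for m and x :: "nat \<Rightarrow> 'k"
    using pp_monomial_superset[of "{0..i}" m x] sup[OF that] by (simp add: I)
  have "peval \<Psi> v = 0" for v
  proof -
    obtain q where q: "coeff (q 0) 0 = y0" "\<And>j. j \<in> {1..i} \<Longrightarrow> coeff (q j) 0 = 0 \<and> coeff (q j) 1 = v j"
      "\<And>s. peval \<Phi> (\<lambda>j. poly (q j) s) = 0"
      using curve[of v] by blast
    have "\<exists>r. q j = pCons 0 r \<and> coeff r 0 = v j" if "j \<in> {1..i}" for j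
      using q(2)[OF that] by (cases "q j") auto
    then obtain r where r: "\<And>j. j \<in> {1..i} \<Longrightarrow> q j = pCons 0 (r j) \<and> coeff (r j) 0 = v j" by metis
    \<comment> \<open>\<open>R\<close> is the value along the curve divided by
      \<open>s ^ (t - k)\<close>, so its value at \<open>0\<close> is the lowest-order
      coefficient.\<close>
    define R where "R = (\<Sum>m\<in>keys \<Phi>. smult (lookup \<Phi> m)
      (q 0 ^ lookup m 0 * monom 1 (k - lookup m 0) * (\<Prod>j\<in>{1..i}. r j ^ lookup m j)))"
    have "s ^ (t - k) * poly R s = peval \<Phi> (\<lambda>j. poly (q j) s)" for s
    proof -
      have "s ^ (t - k) * (poly (q 0) s ^ lookup m 0 * s ^ (k - lookup m 0) * (\<Prod>j\<in>{1..i}. poly (r j) s ^ lookup m j))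
         = (\<Prod>j\<in>keys m. poly (q j) s ^ lookup m j)" if m: "m \<in> keys \<Phi>" for m
      proof -
        have "(\<Prod>j\<in>{1..i}. poly (q j) s ^ lookup m j) = (\<Prod>j\<in>{1..i}. s ^ lookup m j * poly (r j) s ^ lookup m j)"
          using r by (intro prod.cong refl) (simp add: power_mult_distrib)
        also have "\<dots> = s ^ (t - lookup m 0) * (\<Prod>j\<in>{1..i}. poly (r j) s ^ lookup m j)"
          using deg[OF m] by (simp add: prod.distrib power_sum)
        also have "t - lookup m 0 = (t - k) + (k - lookup m 0)"
          using k[OF m] deg[OF m0(1)] m0(2) by simp
        finally show ?thesis by (simp add: mon[OF m] power_add mult_ac)
      qed
      then show ?thesis
        by (simp add: R_def peval_def poly_sum poly_prod poly_monom sum_distrib_left mult.left_commute)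
    qed
    then have "poly R s = 0" if "s \<noteq> 0" for s using q(3)[of s] that by (metis mult_eq_0_iff power_eq_0_iff)
    then have "R = 0" by (rule poly_zero_if_zero_away_from_0)
    then have "poly R 0 = 0" by simp
    moreover have "poly R 0 = (\<Sum>m\<in>keys \<Phi>. if lookup m 0 = k then lookup \<Phi> m * (y0 ^ k * (\<Prod>j\<in>{1..i}. v j ^ lookup m j)) else 0)"
      unfolding R_def poly_sum
    proof (intro sum.cong refl)
      fix m assume m: "m \<in> keys \<Phi>"
      have "(\<Prod>j\<in>{1..i}. poly (r j) 0 ^ lookup m j) = (\<Prod>j\<in>{1..i}. v j ^ lookup m j)"
        using r by (intro prod.cong refl) (simp add: poly_0_coeff_0)
      moreover have "poly (q 0) 0 = y0" by (simp add: poly_0_coeff_0 q(1))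
      ultimately show "poly (smult (lookup \<Phi> m) (q 0 ^ lookup m 0 * monom 1 (k - lookup m 0) * (\<Prod>j\<in>{1..i}. r j ^ lookup m j))) 0
         = (if lookup m 0 = k then lookup \<Phi> m * (y0 ^ k * (\<Prod>j\<in>{1..i}. v j ^ lookup m j)) else 0)"
        using k[OF m] by (auto simp: poly_prod poly_monom power_0_left)
    qed
    ultimately have *: "(\<Sum>m\<in>N. lookup \<Phi> m * (y0 ^ k * (\<Prod>j\<in>{1..i}. v j ^ lookup m j))) = 0"
      by (simp add: N_def sum.inter_filter[symmetric])
    \<comment> \<open>The curve fixes the value \<open>y0\<close> of the variable \<open>0\<close>.
      As \<open>\<Psi>\<close> has degree \<open>k\<close> in it throughout, an arbitrary value
      \<open>v 0\<close> can be put back.\<close>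
    have "peval \<Psi> v * y0 ^ k = v 0 ^ k * (\<Sum>m\<in>N. lookup \<Phi> m * (y0 ^ k * (\<Prod>j\<in>{1..i}. v j ^ lookup m j)))"
      unfolding \<Psi>_def peval_sum sum_distrib_left sum_distrib_right
    proof (intro sum.cong refl)
      fix m assume "m \<in> N"
      then have m: "m \<in> keys \<Phi>" "lookup m 0 = k" by (auto simp: N_def)
      show "peval (Poly_Mapping.single m (lookup \<Phi> m)) v * y0 ^ k
         = v 0 ^ k * (lookup \<Phi> m * (y0 ^ k * (\<Prod>j\<in>{1..i}. v j ^ lookup m j)))"
        unfolding peval_single mon[OF m(1)] m(2) by (simp only: mult_ac)
    qed
    then show ?thesis using * y0 by simp
  qed
  moreover have lk: "lookup \<Psi> m = (if m \<in> N then lookup \<Phi> m else 0)" for m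
    unfolding \<Psi>_def by (rule lookup_sum_single) (simp add: N_def)
  moreover have "keys m \<subseteq> {0..i}" if "m \<in> keys \<Psi>" for m
    using that sup lk by (auto simp: N_def in_keys_iff split: if_splits)
  ultimately have "\<Psi> = 0" by (intro peval_zero_imp_zero[of "{0..i}"]) auto
  then show False using lk[of m0] m0 by (auto simp: N_def in_keys_iff)
qed

section \<open>Linear algebra\<close>

text \<open>Induction on the columns: a functional for a new column \<open>x\<close> comes from the
  part of \<open>x\<close> not accounted for by the old columns, and the old functionals are then
  corrected to vanish on \<open>x\<close>. Later the rows of \<open>W\<close> become linear forms
  dual to the columns of a differential.\<close>

lemma left_inverse_of_independent_columns:
  fixes M :: "'b \<Rightarrow> 'a \<Rightarrow> 'k::field"
  assumes "finite A" "finite B"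
    and "\<And>u. (\<And>b. b \<in> B \<Longrightarrow> (\<Sum>a\<in>A. M b a * u a) = 0) \<Longrightarrow> (\<forall>a\<in>A. u a = 0)"
  shows "\<exists>W. \<forall>a\<in>A. \<forall>a'\<in>A. (\<Sum>b\<in>B. W a b * M b a') = (if a = a' then 1 else 0)"
  using assms(1,3)
proof (induction A rule: finite_induct)
  case (insert x A)
  have "\<forall>a\<in>A. u a = 0" if "\<And>b. b \<in> B \<Longrightarrow> (\<Sum>a\<in>A. M b a * u a) = 0" for u
  proof -
    have "\<forall>a\<in>insert x A. (u(x := 0)) a = 0"
    proof (rule insert.prems)
      fix b assume "b \<in> B"
      have "(\<Sum>a\<in>A. M b a * (u(x := 0)) a) = (\<Sum>a\<in>A. M b a * u a)"
        using insert.hyps by (intro sum.cong) auto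
      then show "(\<Sum>a\<in>insert x A. M b a * (u(x := 0)) a) = 0"
        using insert.hyps that[OF \<open>b \<in> B\<close>] by simp
    qed
    then show ?thesis using insert.hyps by (auto simp: fun_upd_def split: if_splits)
  qed
  then obtain W where W: "\<forall>a\<in>A. \<forall>a'\<in>A. (\<Sum>b\<in>B. W a b * M b a') = (if a = a' then 1 else 0)" using insert.IH by blast
  define c where "c a = (\<Sum>b\<in>B. W a b * M b x)" for a
  \<comment> \<open>\<open>v\<close> is column \<open>x\<close> minus the combination of old columns
    with coefficients \<open>c\<close>. If it were zero, the columns would be dependent.\<close>
  define v where "v b = M b x - (\<Sum>a\<in>A. M b a * c a)" for b
  have "\<exists>b\<in>B. v b \<noteq> 0"
  proof (rule ccontr)
    assume "\<not> ?thesis"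
    then have v0: "v b = 0" if "b \<in> B" for b using that by blast
    have "\<forall>a\<in>insert x A. ((\<lambda>a. - c a)(x := 1)) a = 0"
    proof (rule insert.prems)
      fix b assume "b \<in> B"
      have "(\<Sum>a\<in>A. M b a * ((\<lambda>a. - c a)(x := 1)) a) = (\<Sum>a\<in>A. - (M b a * c a))"
        using insert.hyps by (intro sum.cong) auto
      then show "(\<Sum>a\<in>insert x A. M b a * ((\<lambda>a. - c a)(x := 1)) a) = 0"
        using insert.hyps v0[OF \<open>b \<in> B\<close>] by (simp add: v_def sum_negf)
    qed
    then show False by auto
  qed
  then obtain b0 where b0: "b0 \<in> B" "v b0 \<noteq> 0" by blast
  \<comment> \<open>The functional subtracts from a vector its component in the old columns, as
    measured by \<open>W\<close>, and reads off entry \<open>b0\<close>. It kills the old columns,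
    and division by \<open>v b0\<close> normalises it to \<open>1\<close> on column
    \<open>x\<close>.\<close>
  define Wx where "Wx b = ((if b = b0 then 1 else 0) - (\<Sum>a\<in>A. M b0 a * W a b)) / v b0" for b
  have Wx: "(\<Sum>b\<in>B. Wx b * f b) = (f b0 - (\<Sum>a\<in>A. M b0 a * (\<Sum>b\<in>B. W a b * f b))) / v b0" for f
  proof -
    have "(\<Sum>b\<in>B. Wx b * f b) = (\<Sum>b\<in>B. (if b = b0 then f b0 else 0) - (\<Sum>a\<in>A. M b0 a * (W a b * f b))) / v b0"
      unfolding sum_divide_distrib Wx_def
      by (intro sum.cong refl) (auto simp: sum_distrib_right mult.assoc left_diff_distrib)
    also have "\<dots> = (f b0 - (\<Sum>b\<in>B. \<Sum>a\<in>A. M b0 a * (W a b * f b))) / v b0"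
      using b0 assms(2) by (simp add: sum_subtractf)
    finally show ?thesis by (subst (asm) sum.swap) (simp add: sum_distrib_left)
  qed
  have Wx_x: "(\<Sum>b\<in>B. Wx b * M b x) = 1"
    using b0 unfolding Wx by (simp add: v_def c_def)
  have Wx_A: "(\<Sum>b\<in>B. Wx b * M b a') = 0" if "a' \<in> A" for a'
  proof -
    have "(\<Sum>a\<in>A. M b0 a * (\<Sum>b\<in>B. W a b * M b a')) = (\<Sum>a\<in>A. if a = a' then M b0 a' else 0)"
      using W that by (intro sum.cong) auto
    then show ?thesis unfolding Wx using that insert.hyps by simp
  qed
  define W' where "W' a = (if a = x then Wx else (\<lambda>b. W a b - c a * Wx b))" for a
  have ne: "a \<noteq> x" if "a \<in> A" for a using that insert.hyps by auto
  have "(\<Sum>b\<in>B. W' a b * M b a') = (if a = a' then 1 else 0)" if "a \<in> insert x A" "a' \<in> insert x A" for a a'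
  proof (cases "a = x")
    case True
    then show ?thesis using that Wx_x Wx_A ne by (auto simp: W'_def)
  next
    case False
    then have "(\<Sum>b\<in>B. W' a b * M b a') = (\<Sum>b\<in>B. W a b * M b a') - c a * (\<Sum>b\<in>B. Wx b * M b a')"
      by (simp add: W'_def left_diff_distrib sum_subtractf sum_distrib_left mult.assoc)
    then show ?thesis using that Wx_x Wx_A W False ne by (auto simp: c_def)
  qed
  then show ?case by blast
qed simp

text \<open>Injectivity is an open condition. Elimination by cross-multiplication keeps all entries
  polynomial, and \<open>p\<close> is the product of the pivots, each of which is nonzero at
  \<open>0\<close>.\<close>

lemma injective_specialization:
  fixes V :: "'b \<Rightarrow> 'a \<Rightarrow> 'k::field poly"
  assumes "finite A"
    and "\<And>u. (\<And>b. b \<in> B \<Longrightarrow> (\<Sum>a\<in>A. poly (V b a) 0 * u a) = 0) \<Longrightarrow> (\<forall>a\<in>A. u a = 0)"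
  shows "\<exists>p. p \<noteq> 0 \<and> (\<forall>t. poly p t \<noteq> 0 \<longrightarrow>
    (\<forall>u. (\<forall>b\<in>B. (\<Sum>a\<in>A. poly (V b a) t * u a) = 0) \<longrightarrow> (\<forall>a\<in>A. u a = 0)))"
  using assms
proof (induction A arbitrary: V rule: finite_induct)
  case empty
  then show ?case by (intro exI[of _ 1]) auto
next
  case (insert x A)
  have "\<exists>b\<in>B. poly (V b x) 0 \<noteq> 0"
  proof (rule ccontr)
    assume "\<not> ?thesis"
    then have "\<forall>a\<in>insert x A. (\<lambda>a. if a = x then 1 else 0 :: 'k) a = 0"
      using insert.hyps by (intro insert.prems) (auto intro!: sum.neutral)
    then show False by simp
  qed
  then obtain b0 where b0: "b0 \<in> B" "poly (V b0 x) 0 \<noteq> 0" by blast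
  define V' where "V' b a = V b0 x * V b a - V b x * V b0 a" for b a
  have V': "(\<Sum>a\<in>A. poly (V' b a) t * u a)
    = poly (V b0 x) t * (\<Sum>a\<in>A. poly (V b a) t * u a) - poly (V b x) t * (\<Sum>a\<in>A. poly (V b0 a) t * u a)" for b t u
    by (simp add: V'_def left_diff_distrib sum_subtractf sum_distrib_left mult.assoc)
  have "\<forall>a\<in>A. u a = 0" if u: "\<And>b. b \<in> B \<Longrightarrow> (\<Sum>a\<in>A. poly (V' b a) 0 * u a) = 0" for u
  proof -
    define z where "z = - (\<Sum>a\<in>A. poly (V b0 a) 0 * u a) / poly (V b0 x) 0"
    have "\<forall>a\<in>insert x A. (u(x := z)) a = 0"
    proof (rule insert.prems)
      fix b assume b: "b \<in> B"
      have "(\<Sum>a\<in>A. poly (V b a) 0 * (u(x := z)) a) = (\<Sum>a\<in>A. poly (V b a) 0 * u a)"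
        using insert.hyps by (intro sum.cong) auto
      then show "(\<Sum>a\<in>insert x A. poly (V b a) 0 * (u(x := z)) a) = 0"
        using insert.hyps u[OF b, unfolded V'] b0 by (simp add: z_def field_simps)
    qed
    then show ?thesis using insert.hyps by (auto simp: fun_upd_def split: if_splits)
  qed
  then obtain p where p: "p \<noteq> 0" "\<And>t u. poly p t \<noteq> 0 \<Longrightarrow> (\<forall>b\<in>B. (\<Sum>a\<in>A. poly (V' b a) t * u a) = 0) \<Longrightarrow> (\<forall>a\<in>A. u a = 0)"
    using insert.IH[of V'] by blast
  show ?case
  proof (intro exI[of _ "p * V b0 x"] conjI allI impI)
    show "p * V b0 x \<noteq> 0" using p b0 by auto
    fix t u assume t: "poly (p * V b0 x) t \<noteq> 0" and u: "\<forall>b\<in>B. (\<Sum>a\<in>insert x A. poly (V b a) t * u a) = 0"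
    have u': "(\<Sum>a\<in>A. poly (V b a) t * u a) = - poly (V b x) t * u x" if "b \<in> B" for b
      using u that insert.hyps by (simp add: eq_neg_iff_add_eq_0 add.commute)
    then have "\<forall>a\<in>A. u a = 0" using t b0 by (intro p(2)[of t]) (auto simp: V')
    moreover from this have "u x = 0" using u'[OF b0(1)] t by simp
    ultimately show "\<forall>a\<in>insert x A. u a = 0" by simp
  qed
qed

section \<open>Chains of irreducible closed sets\<close>

definition vanishes_on :: "('v, 'a::field) mpol \<Rightarrow> ('v \<Rightarrow>\<^sub>0 'a) set set \<Rightarrow> bool" where
  "vanishes_on F Z \<longleftrightarrow> (\<forall>p\<in>Z. \<forall>f\<in>p. peval F (lookup f) = 0)"

lemma vanishes_on_mono: "vanishes_on F Z \<Longrightarrow> Y \<subseteq> Z \<Longrightarrow> vanishes_on F Y"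
  by (auto simp: vanishes_on_def)

lemma zero_locus_singleton: "zero_locus I {F} = {p \<in> proj_points I. vanishes_on F {p}}"
  by (auto simp: zero_locus_def vanishes_on_def)

lemma closedin_zero_locus_singleton:
  "homogeneous n F \<Longrightarrow> closedin (zariski I) (zero_locus I {F})"
  unfolding closedin_zariski by (intro exI[of _ "{F}"]) auto

lemma proj_class_in_proj_points: "f \<noteq> 0 \<Longrightarrow> keys f \<subseteq> I \<Longrightarrow> proj_class f \<in> proj_points I"
  by (auto simp: proj_points_def)

lemma vanishes_on_class:
  assumes "homogeneous n F" "f \<noteq> 0" "keys f \<subseteq> I"
  shows "vanishes_on F {proj_class f} \<longleftrightarrow> peval F (lookup f) = 0"
proof
  assume "vanishes_on F {proj_class f}"
  then show "peval F (lookup f) = 0" using proj_class_self[of f] by (simp add: vanishes_on_def)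
next
  assume f: "peval F (lookup f) = 0"
  have "peval F (lookup g) = 0" if "g \<in> proj_class f" for g
    using peval_proj_class[OF assms(1) proj_class_in_proj_points[OF assms(2,3)] that proj_class_self] f by simp
  then show "vanishes_on F {proj_class f}" by (simp add: vanishes_on_def)
qed

lemma closed_separation:
  assumes "closedin (zariski I) Z" "p \<in> proj_points I" "p \<notin> Z"
  shows "\<exists>F n. homogeneous n F \<and> vanishes_on F Z \<and> \<not> vanishes_on F {p}"
proof -
  obtain S where S: "\<forall>F\<in>S. \<exists>n. homogeneous n F" "Z = zero_locus I S"
    using assms(1) closedin_zariski by blast
  then obtain F where "F \<in> S" "\<not> vanishes_on F {p}"
    using assms(2,3) by (auto simp: zero_locus_def vanishes_on_def)
  moreover have "vanishes_on F Z" using S(2) \<open>F \<in> S\<close> by (auto simp: zero_locus_def vanishes_on_def)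
  ultimately show ?thesis using S(1) by blast
qed

lemma vanishes_on_closure:
  assumes "homogeneous n F" "vanishes_on F S" "S \<subseteq> proj_points I"
  shows "vanishes_on F (zariski I closure_of S)"
proof -
  have "S \<subseteq> zero_locus I {F}"
    using assms(2,3) by (auto simp: zero_locus_def vanishes_on_def)
  then have "zariski I closure_of S \<subseteq> zero_locus I {F}"
    by (rule closure_of_minimal[OF _ closedin_zero_locus_singleton[OF assms(1)]])
  then show ?thesis by (auto simp: zero_locus_def vanishes_on_def)
qed

lemma closedin_subset_proj_points: "closedin (zariski I) Z \<Longrightarrow> Z \<subseteq> proj_points I"
  using closedin_subset[of "zariski I" Z] by simp

text \<open>The zeros of \<open>F\<close> and those of \<open>G\<close> on \<open>Z\<close> are
  closed in \<open>Z\<close> and together cover it.\<close>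

lemma irreducible_prime:
  fixes F G :: "('v, 'a::field) mpol"
  assumes Z: "closedin (zariski I) Z" "irreducible_space (subtopology (zariski I) Z)"
    and "homogeneous m F" "homogeneous n G" "vanishes_on (F * G) Z"
  shows "vanishes_on F Z \<or> vanishes_on G Z"
proof -
  let ?A = "\<lambda>F. Z \<inter> zero_locus I {F}"
  have sub: "Z \<subseteq> proj_points I" by (rule closedin_subset_proj_points[OF Z(1)])
  have top: "topspace (subtopology (zariski I) Z) = Z" using sub by auto
  have closed: "closedin (subtopology (zariski I) Z) (?A H)" if "homogeneous k H" for k H
    using closedin_zero_locus_singleton[OF that]
    by (auto simp: closedin_subtopology)
  have "Z \<subseteq> ?A F \<union> ?A G"
  proof
    fix p assume p: "p \<in> Z"
    then obtain f where f: "f \<noteq> 0" "keys f \<subseteq> I" "p = proj_class f"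
      using sub by (auto simp: proj_points_def)
    have "peval F (lookup f) * peval G (lookup f) = 0"
      using assms(5) p proj_class_self[of f] by (auto simp: vanishes_on_def f peval_mult)
    then have "vanishes_on F {p} \<or> vanishes_on G {p}"
      using vanishes_on_class[OF assms(3) f(1,2)] vanishes_on_class[OF assms(4) f(1,2)] by (auto simp: f)
    then show "p \<in> ?A F \<union> ?A G"
      using p sub by (auto simp: zero_locus_singleton)
  qed
  then have "?A F \<union> ?A G = Z" by auto
  then have "?A F = Z \<or> ?A G = Z"
    using Z(2) closed[OF assms(3)] closed[OF assms(4)] unfolding irreducible_space_def top by blast
  moreover have "?A H = Z \<Longrightarrow> vanishes_on H Z" for H by (auto simp: zero_locus_singleton vanishes_on_def)
  ultimately show ?thesis by blast
qed

text \<open>Makes the closure rules for \<open>forms\<close> available where the set of variables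
  does not matter.\<close>

lemma homogeneous_iff_forms:
  fixes F :: "('v, 'a::comm_ring_1) mpol"
  shows "homogeneous D F \<longleftrightarrow> F \<in> forms UNIV D"
  by (auto simp: homogeneous_def forms_def pps_def)

lemma homogeneous_power:
  fixes F :: "('v, 'a::comm_ring_1) mpol"
  shows "homogeneous D F \<Longrightarrow> homogeneous (n * D) (F ^ n)"
  unfolding homogeneous_iff_forms by (rule forms_power)

lemma homogeneous_psubst:
  fixes G :: "'w \<Rightarrow> ('v, 'a::comm_ring_1) mpol"
  shows "\<Phi> \<in> forms I t \<Longrightarrow> (\<And>j. homogeneous D (G j)) \<Longrightarrow> homogeneous (t * D) (psubst \<Phi> G)"
  unfolding homogeneous_iff_forms by (intro psubst_forms) (auto simp: homogeneous_iff_forms[symmetric] forms_imp_homogeneous)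

lemma irreducible_prime_power:
  fixes F G :: "('v, 'a::field) mpol"
  assumes Z: "closedin (zariski I) Z" "irreducible_space (subtopology (zariski I) Z)"
    and "homogeneous m F" "homogeneous n G" "vanishes_on (F ^ g * G) Z" "\<not> vanishes_on F Z"
  shows "vanishes_on G Z"
  using assms(5)
proof (induction g)
  case (Suc g)
  then have "vanishes_on (F * (F ^ g * G)) Z" by (simp add: mult.assoc)
  moreover have "homogeneous (g * m + n) (F ^ g * G)"
    using homogeneous_mult homogeneous_power assms(3,4) by blast
  ultimately show ?case using irreducible_prime[OF Z assms(3)] assms(6) Suc.IH by blast
qed simp

section \<open>Algebraic independence along chains\<close>

lemma pps_singleton: "pps {v} t = {Poly_Mapping.single v t}"
proof -
  have "m = Poly_Mapping.single v t" if "m \<in> pps {v} t" for m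
  proof (rule poly_mapping_eqI)
    fix w
    have "keys m \<subseteq> {v}" "lookup m v = t"
      using that by (auto simp: pps_def pp_deg_superset[of "{v}"])
    then show "lookup m w = lookup (Poly_Mapping.single v t) w"
      by (auto simp: lookup_single when_def in_keys_iff subset_iff)
  qed
  moreover have "Poly_Mapping.single v t \<in> pps {v} t" by (simp add: pps_def)
  ultimately show ?thesis by blast
qed

lemma peval_forms_singleton:
  assumes "F \<in> forms {v} t"
  shows "peval F x = lookup F (Poly_Mapping.single v t) * x v ^ t"
proof -
  have "keys F \<subseteq> {Poly_Mapping.single v t}" using assms by (simp add: forms_def pps_singleton)
  then have "peval F x = peval (Poly_Mapping.single (Poly_Mapping.single v t) (lookup F (Poly_Mapping.single v t))) x"
    by (intro arg_cong[where f = "\<lambda>F. peval F x"] poly_mapping_eqI) (auto simp: lookup_single when_def in_keys_iff subset_iff)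
  then show ?thesis by (simp add: peval_single)
qed

text \<open>Induction on the length. Split off the power of the last variable from the relation. As
  \<open>Z i\<close> is irreducible and \<open>G i\<close> does not vanish on it, the quotient still
  gives a relation on \<open>Z i\<close>. On the preceding member \<open>G i\<close> vanishes, which
  leaves a nonzero relation between fewer forms.\<close>

lemma chain_independent:
  fixes G :: "nat \<Rightarrow> ('v, 'k::field_char_0) mpol" and \<Phi> :: "(nat, 'k) mpol"
  assumes Z: "\<And>j. j \<le> i \<Longrightarrow> closedin (zariski I) (Z j) \<and> irreducible_space (subtopology (zariski I) (Z j))"
    and G: "\<And>j. homogeneous D (G j)" "\<And>j. j \<le> i \<Longrightarrow> \<not> vanishes_on (G j) (Z j)"
      "\<And>j. j < i \<Longrightarrow> vanishes_on (G (Suc j)) (Z j)"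
    and mono: "\<And>j. j < i \<Longrightarrow> Z j \<subseteq> Z (Suc j)"
    and \<Phi>: "\<Phi> \<in> forms {0..i} t" "vanishes_on (psubst \<Phi> G) (Z i)"
  shows "\<Phi> = 0"
  using Z G(2,3) mono \<Phi>
proof (induction i arbitrary: \<Phi> t)
  case (0 \<Phi> t)
  show ?case
  proof (rule ccontr)
    assume "\<Phi> \<noteq> 0"
    have \<Phi>: "\<Phi> \<in> forms {0} t" using 0(5) by simp
    have "lookup \<Phi> (Poly_Mapping.single 0 t) \<noteq> 0"
    proof
      assume "lookup \<Phi> (Poly_Mapping.single 0 t) = 0"
      then have "Poly_Mapping.single 0 t \<notin> keys \<Phi>" by (simp add: in_keys_iff)
      moreover have "keys \<Phi> \<subseteq> {Poly_Mapping.single 0 t}" using \<Phi> by (simp add: forms_def pps_singleton)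
      ultimately have "keys \<Phi> = {}" by blast
      then show False using \<open>\<Phi> \<noteq> 0\<close> by simp
    qed
    moreover obtain p f where p: "p \<in> Z 0" "f \<in> p" "peval (G 0) (lookup f) \<noteq> 0"
      using 0(2)[of 0] by (auto simp: vanishes_on_def)
    moreover have "peval (psubst \<Phi> G) (lookup f) = 0" using 0(6) p(1,2) by (auto simp: vanishes_on_def)
    ultimately show False by (simp add: peval_psubst peval_forms_singleton[OF \<Phi>])
  qed
next
  case (Suc i \<Phi> t)
  show ?case
  proof (rule ccontr)
    assume "\<Phi> \<noteq> 0"
    then obtain g F' F0 where s: "\<And>x. peval \<Phi> x = x (Suc i) ^ g * peval F' x" "F0 \<noteq> 0"
      "\<And>x. x (Suc i) = 0 \<Longrightarrow> peval F' x = peval F0 x"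
      "\<And>I D. \<Phi> \<in> forms I D \<Longrightarrow> F' \<in> forms I (D - g) \<and> F0 \<in> forms (I - {Suc i}) (D - g)"
      by (rule split_variable[where v = "Suc i"]) blast
    have F': "F' \<in> forms {0..Suc i} (t - g)" and F0: "F0 \<in> forms {0..i} (t - g)"
      using s(4)[OF Suc.prems(5)] by (auto simp: atLeastAtMostSuc_conv)
    have "vanishes_on (G (Suc i) ^ g * psubst F' G) (Z (Suc i))"
      using Suc.prems(6) by (simp add: vanishes_on_def peval_mult peval_power peval_psubst s(1))
    then have "vanishes_on (psubst F' G) (Z (Suc i))"
      using Suc.prems(1)[of "Suc i"] Suc.prems(2)[of "Suc i"]
      by (intro irreducible_prime_power[OF _ _ G(1) homogeneous_psubst[OF F' G(1)]]) auto
    then have "vanishes_on (psubst F' G) (Z i)"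
      using Suc.prems(4)[of i] by (auto intro: vanishes_on_mono)
    then have "vanishes_on (psubst F0 G) (Z i)"
      using Suc.prems(3)[of i] s(3) by (auto simp: vanishes_on_def peval_psubst)
    moreover have "\<Psi> = 0" if "\<Psi> \<in> forms {0..i} k" "vanishes_on (psubst \<Psi> G) (Z i)" for \<Psi> k
      using that Suc.prems(1-4) by (intro Suc.IH[of \<Psi> k]) auto
    ultimately show False using s(2) F0 by blast
  qed
qed

text \<open>Scaling by \<open>0\<close> costs only the factor \<open>0 ^ 0 = 1\<close>, so every
  value equals the value at the origin.\<close>

lemma homogeneous_0_const:
  fixes F :: "('v, 'a::comm_ring_1) mpol"
  assumes "homogeneous 0 F" shows "peval F x = peval F y"
  using peval_scale[OF assms, of 0 x] peval_scale[OF assms, of 0 y] by simp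

text \<open>A chain with \<open>m \<ge> n\<close> would supply forms \<open>G 0\<close> to
  \<open>G n\<close> that are independent by \<open>chain_independent\<close>, against
  \<open>dep\<close>.\<close>

lemma chain_length_bound:
  fixes C :: "('v \<Rightarrow>\<^sub>0 'k::field_char_0) set set"
  assumes dep: "\<And>(G :: nat \<Rightarrow> ('v, 'k) mpol) D. (\<And>j. homogeneous D (G j)) \<Longrightarrow>
      \<exists>t \<Phi>. \<Phi> \<in> forms {0..n} t \<and> \<Phi> \<noteq> 0 \<and> vanishes_on (psubst \<Phi> G) C"
    and Z: "\<And>j. j \<le> m \<Longrightarrow> closedin (zariski I) (Z j) \<and> irreducible_space (subtopology (zariski I) (Z j)) \<and> Z j \<subseteq> C"
    and strict: "\<And>j. j < m \<Longrightarrow> Z j \<subset> Z (Suc j)"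
  shows "m < n"
proof (rule ccontr)
  assume "\<not> m < n"
  then have nm: "n \<le> m" by simp
  have sub: "Z j \<subseteq> proj_points I" if "j \<le> m" for j
    using Z[OF that] by (intro closedin_subset_proj_points) simp
  have ne: "Z j \<noteq> {}" if "j \<le> m" for j
    using Z[OF that] sub[OF that] by (auto simp: irreducible_space_def)
  obtain f0 where f0: "f0 \<noteq> 0" "keys f0 \<subseteq> I" "proj_class f0 \<in> Z 0"
    using ne[of 0] sub[of 0] by (force simp: proj_points_def)
  then obtain b where b: "lookup f0 b \<noteq> 0" by (metis poly_mapping_eqI lookup_zero)
  \<comment> \<open>Each member gets a form that vanishes on its predecessor but not on itself; for
    the first member a coordinate will do. Positive degrees allow the passage to a common
    degree.\<close>
  have "\<exists>F d. d > 0 \<and> homogeneous d F \<and> \<not> vanishes_on F (Z j) \<and> (j > 0 \<longrightarrow> vanishes_on F (Z (j - 1)))"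
    if "j \<le> m" for j
  proof (cases "j = 0")
    case True
    have 1: "homogeneous 1 (var b :: ('v, 'k) mpol)"
      unfolding homogeneous_iff_forms by (rule forms_var) simp
    have "peval (var b) (lookup f0) \<noteq> 0" using b by simp
    then have 2: "\<not> vanishes_on (var b) (Z 0)"
      unfolding vanishes_on_def using f0(3) proj_class_self[of f0] by blast
    show ?thesis unfolding True
    proof (intro exI conjI impI)
      show "homogeneous 1 (var b :: ('v, 'k) mpol)" by (rule 1)
      show "\<not> vanishes_on (var b) (Z 0)" by (rule 2)
    qed simp_all
  next
    case False
    then have k: "j = Suc (j - 1)" "j - 1 < m" using that by auto
    define k where "k = j - 1"
    have k: "j = Suc k" "k < m" using k by (simp_all add: k_def)
    obtain p where p: "p \<in> Z j" "p \<notin> Z k" using strict[of k] k by blast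
    obtain F d where F: "homogeneous d F" "vanishes_on F (Z k)" "\<not> vanishes_on F {p}"
      using closed_separation[of I "Z k" p] Z[of k] k p sub[of j] \<open>j \<le> m\<close> by auto
    have "d > 0"
    proof (rule ccontr)
      assume "\<not> d > 0"
      then have h0: "homogeneous 0 F" using F(1) by simp
      obtain q where "q \<in> Z k" using ne[of k] k by auto
      then obtain f where "q \<in> Z k" "f \<in> q"
        using sub[of k] k proj_class_self by (fastforce simp: proj_points_def)
      then have "peval F (lookup f) = 0" using F(2) by (auto simp: vanishes_on_def)
      then have "peval F x = 0" for x using homogeneous_0_const[OF h0, of x "lookup f"] by simp
      then show False using F(3) by (simp add: vanishes_on_def)
    qed
    moreover have "\<not> vanishes_on F (Z j)" using F(3) p(1) by (auto simp: vanishes_on_def)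
    ultimately show ?thesis using F(1,2) k by auto
  qed
  then obtain F d where Fd: "\<And>j. j \<le> m \<Longrightarrow> d j > 0 \<and> homogeneous (d j) (F j) \<and> \<not> vanishes_on (F j) (Z j)
      \<and> (j > 0 \<longrightarrow> vanishes_on (F j) (Z (j - 1)))"
    by metis
  \<comment> \<open>Powers bring all forms to the degree \<open>D\<close>. Beyond \<open>m\<close>
    the zero form is taken, which is homogeneous of every degree, as \<open>dep\<close> speaks of
    all indices.\<close>
  define D where "D = (\<Prod>j\<le>m. d j)"
  define G where "G j = (if j \<le> m then F j ^ (\<Prod>i\<in>{..m} - {j}. d i) else 0)" for j
  have Gh: "homogeneous D (G j)" for j
  proof (cases "j \<le> m")
    case True
    then have "D = (\<Prod>i\<in>{..m} - {j}. d i) * d j"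
      by (simp add: D_def prod.remove[of "{..m}" j])
    then show ?thesis using True homogeneous_power[of "d j" "F j"] Fd[OF True] by (simp add: G_def)
  qed (simp add: G_def homogeneous_def)
  \<comment> \<open>With exponent \<open>0\<close> the power would be \<open>1\<close> and would not
    vanish on the preceding member.\<close>
  have pos: "(\<Prod>i\<in>{..m} - {j}. d i) > 0" for j using Fd by (intro prod_pos) auto
  obtain t \<Phi> where \<Phi>: "\<Phi> \<in> forms {0..n} t" "\<Phi> \<noteq> 0" "vanishes_on (psubst \<Phi> G) C"
    using dep[of D G] Gh by blast
  have "\<Phi> = 0"
  proof (rule chain_independent[where Z = Z and i = n and G = G and D = D and I = I])
    show "closedin (zariski I) (Z j) \<and> irreducible_space (subtopology (zariski I) (Z j))" if "j \<le> n" for j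
      using Z[of j] that nm by auto
    show "homogeneous D (G j)" for j by (rule Gh)
    show "\<not> vanishes_on (G j) (Z j)" if "j \<le> n" for j
      using Fd[of j] that nm by (auto simp: G_def vanishes_on_def peval_power)
    show "vanishes_on (G (Suc j)) (Z j)" if "j < n" for j
      using Fd[of "Suc j"] that nm pos[of "Suc j"] by (auto simp: G_def vanishes_on_def peval_power)
    show "Z j \<subseteq> Z (Suc j)" if "j < n" for j using strict[of j] that nm by auto
    show "\<Phi> \<in> forms {0..n} t" by (rule \<Phi>(1))
    show "vanishes_on (psubst \<Phi> G) (Z n)"
      using \<Phi>(3) Z[of n] nm vanishes_on_mono by blast
  qed
  then show False using \<Phi>(2) by simp
qed

section \<open>Maps given by forms that are independent along a flag\<close>

text \<open>The map \<open>\<phi>\<close> is given on the space on \<open>A\<close> by forms of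
  degree \<open>e\<close>. The vectors \<open>dir 0\<close> to \<open>dir i\<close> generate the
  subspaces of a flag, and \<open>independent\<close> says that the first \<open>i + 1\<close>
  linear forms with coefficients \<open>Y j\<close>, composed with \<open>\<phi>\<close>, satisfy no
  nontrivial homogeneous relation on the \<open>i\<close>-th subspace. The instances are the Hessian
  and the identity, the latter for the dimension of the source.\<close>

locale independent_forms_map =
  fixes A :: "'a set" and B :: "'b set" and e :: nat
    and P :: "'b \<Rightarrow> ('a, 'k::{alg_closed_field, field_char_0}) mpol"
    and \<phi> :: "('a \<Rightarrow>\<^sub>0 'k) \<Rightarrow> ('b \<Rightarrow>\<^sub>0 'k)"
    and dir :: "nat \<Rightarrow> 'a \<Rightarrow> 'k" and Y :: "nat \<Rightarrow> 'b \<Rightarrow> 'k"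
  assumes finite_A: "finite A" and A_ne: "A \<noteq> {}" and finite_B: "finite B" and e_pos: "e > 0"
    and P_forms: "P b \<in> forms A e"
    and P_outside: "b \<notin> B \<Longrightarrow> P b = 0"
    and lookup_\<phi>: "keys f \<subseteq> A \<Longrightarrow> lookup (\<phi> f) b = peval (P b) (lookup f)"
    and dir_outside: "a \<notin> A \<Longrightarrow> dir k a = 0"
    and independent: "i < card A \<Longrightarrow> \<Phi> \<in> forms {0..i} t \<Longrightarrow>
      (\<And>u. peval \<Phi> (\<lambda>j. \<Sum>b\<in>B. Y j b * peval (P b) (\<lambda>a. \<Sum>k=0..i. u k * dir k a)) = 0) \<Longrightarrow> \<Phi> = 0"
begin

section \<open>The flag of subspaces and the closures of its images\<close>

definition vec :: "nat \<Rightarrow> (nat \<Rightarrow> 'k) \<Rightarrow> ('a \<Rightarrow>\<^sub>0 'k)" where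
  "vec i u = (\<Sum>a\<in>A. Poly_Mapping.single a (\<Sum>k=0..i. u k * dir k a))"

lemma lookup_vec: "lookup (vec i u) = (\<lambda>a. \<Sum>k=0..i. u k * dir k a)"
  unfolding vec_def by (rule ext) (simp add: lookup_sum_single[OF finite_A] dir_outside)

lemma keys_vec: "keys (vec i u) \<subseteq> A"
  unfolding vec_def by (rule keys_sum_single[OF finite_A])

lemma lookup_\<phi>_fun: "keys f \<subseteq> A \<Longrightarrow> lookup (\<phi> f) = (\<lambda>b. peval (P b) (lookup f))"
  by (rule ext) (rule lookup_\<phi>)

definition image_points :: "('b \<Rightarrow>\<^sub>0 'k) set set" where
  "image_points = {proj_class (\<phi> f) |f. keys f \<subseteq> A \<and> \<phi> f \<noteq> 0}"

definition sub_image :: "nat \<Rightarrow> ('b \<Rightarrow>\<^sub>0 'k) set set" where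
  "sub_image i = {proj_class (\<phi> (vec i u)) |u. \<phi> (vec i u) \<noteq> 0}"

definition sub_closure :: "nat \<Rightarrow> ('b \<Rightarrow>\<^sub>0 'k) set set" where
  "sub_closure i = zariski B closure_of sub_image i"

abbreviation C :: "('b \<Rightarrow>\<^sub>0 'k) set set" where
  "C \<equiv> zariski B closure_of image_points"

text \<open>The coordinate \<open>a\<close> on the \<open>i\<close>-th subspace as a linear form in
  the parameters, so that \<open>psubst (P b) (lin i)\<close> is the restriction of
  \<open>P b\<close> to that subspace.\<close>

definition lin :: "nat \<Rightarrow> 'a \<Rightarrow> (nat, 'k) mpol" where
  "lin i a = (\<Sum>k=0..i. const (dir k a) * var k)"

lemma peval_lin: "peval (lin i a) u = lookup (vec i u) a"
  by (simp add: lin_def peval_sum peval_mult lookup_vec mult.commute)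

lemma lin_forms: "lin i a \<in> forms {0..i} 1"
  unfolding lin_def by (intro forms_sum forms_const_mult forms_var) simp

definition Yform :: "nat \<Rightarrow> ('b, 'k) mpol" where
  "Yform j = (\<Sum>b\<in>B. const (Y j b) * var b)"

lemma homogeneous_Yform: "homogeneous 1 (Yform j)"
  unfolding Yform_def homogeneous_iff_forms by (intro forms_sum forms_const_mult forms_var) simp

lemma peval_Yform: "peval (Yform j) x = (\<Sum>b\<in>B. Y j b * x b)"
  by (simp add: Yform_def peval_sum peval_mult)

lemma keys_\<phi>: "keys f \<subseteq> A \<Longrightarrow> keys (\<phi> f) \<subseteq> B"
proof
  fix b assume "keys f \<subseteq> A" "b \<in> keys (\<phi> f)"
  then have "peval (P b) (lookup f) \<noteq> 0" using lookup_\<phi> by (simp add: in_keys_iff)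
  then have "P b \<noteq> 0" by auto
  then show "b \<in> B" using P_outside by blast
qed

lemma psubst_P_forms: "homogeneous D F \<Longrightarrow> psubst F P \<in> forms A (D * e)"
  by (rule psubst_forms[OF _ P_forms])

lemma peval_psubst_P: "keys f \<subseteq> A \<Longrightarrow> peval (psubst F P) (lookup f) = peval F (lookup (\<phi> f))"
  by (simp add: peval_psubst lookup_\<phi>_fun)

lemma image_subset: "image_points \<subseteq> proj_points B"
  using keys_\<phi> by (auto simp: image_points_def proj_points_def)

lemma sub_image_subset: "sub_image i \<subseteq> image_points"
  using keys_vec by (auto simp: sub_image_def image_points_def)

lemma sub_image_subset_proj: "sub_image i \<subseteq> proj_points B"
  by (rule subset_trans[OF sub_image_subset image_subset])

lemma vanishes_on_image:
  assumes "homogeneous D F" "\<And>f. keys f \<subseteq> A \<Longrightarrow> peval F (lookup (\<phi> f)) = 0"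
  shows "vanishes_on F C"
proof (rule vanishes_on_closure[OF assms(1) _ image_subset])
  have "vanishes_on F {proj_class (\<phi> f)}" if "keys f \<subseteq> A" "\<phi> f \<noteq> 0" for f
    using vanishes_on_class[OF assms(1) that(2) keys_\<phi>[OF that(1)]] assms(2)[OF that(1)] by simp
  then show "vanishes_on F image_points" by (fastforce simp: image_points_def vanishes_on_def)
qed

text \<open>Pulled back by \<open>\<phi>\<close>, these become \<open>card A + 1\<close> forms of
  one degree in \<open>card A\<close> variables. The result is the hypothesis \<open>dep\<close> of
  \<open>chain_length_bound\<close>.\<close>

lemma image_dependent:
  fixes G :: "nat \<Rightarrow> ('b, 'k) mpol"
  assumes G: "\<And>j. homogeneous D (G j)"
  shows "\<exists>t \<Phi>. \<Phi> \<in> forms {0..card A} t \<and> \<Phi> \<noteq> 0 \<and> vanishes_on (psubst \<Phi> G) C"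
proof -
  obtain t \<Phi> where \<Phi>: "\<Phi> \<in> forms {0..card A} t" "\<Phi> \<noteq> 0"
    "\<And>x. peval \<Phi> (\<lambda>j. peval (psubst (G j) P) x) = 0"
    using forms_dependent[OF finite_A A_ne, of "{0..card A}" "\<lambda>j. psubst (G j) P" "D * e"] psubst_P_forms[OF G]
    by auto
  have "vanishes_on (psubst \<Phi> G) C"
  proof (rule vanishes_on_image)
    show "homogeneous (t * D) (psubst \<Phi> G)" by (rule homogeneous_psubst[OF \<Phi>(1) G])
    show "peval (psubst \<Phi> G) (lookup (\<phi> f)) = 0" if "keys f \<subseteq> A" for f
      using \<Phi>(3)[of "lookup f"] by (simp add: peval_psubst lookup_\<phi>_fun[OF that])
  qed
  with \<Phi>(1,2) show ?thesis by blast
qed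

text \<open>Applied to a single variable as the relation, \<open>independent\<close> shows that the
  linear form with coefficients \<open>Y 0\<close> is not identically zero on the image of the
  subspace.\<close>

lemma nonzero_on_subspace:
  assumes "i < card A"
  obtains b u where "peval (psubst (P b) (lin i)) u \<noteq> 0"
proof -
  have "var 0 \<in> forms {0..i} (1::nat)" by (rule forms_var) simp
  moreover have "var (0::nat) \<noteq> (0 :: (nat, 'k) mpol)"
  proof
    assume "var (0::nat) = (0 :: (nat, 'k) mpol)"
    then have "peval (var (0::nat)) (\<lambda>_. 1) = peval (0 :: (nat, 'k) mpol) (\<lambda>_. 1)" by (rule arg_cong[where f = "\<lambda>F. peval F (\<lambda>_. 1)"])
    then show False by (simp only: peval_var peval_zero one_neq_zero)
  qed
  ultimately obtain u where "peval (var 0) (\<lambda>j. \<Sum>b\<in>B. Y j b * peval (P b) (\<lambda>a. \<Sum>k=0..i. u k * dir k a)) \<noteq> (0 :: 'k)"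
    using independent[OF assms, of "var 0" 1] by blast
  then have "(\<Sum>b\<in>B. Y 0 b * peval (P b) (\<lambda>a. \<Sum>k=0..i. u k * dir k a)) \<noteq> 0" by simp
  then obtain b where "peval (P b) (\<lambda>a. \<Sum>k=0..i. u k * dir k a) \<noteq> 0"
    by (metis (no_types, lifting) mult_zero_right sum.not_neutral_contains_not_neutral)
  then have "peval (psubst (P b) (lin i)) u \<noteq> 0" by (simp add: peval_psubst peval_lin lookup_vec)
  then show ?thesis by (rule that)
qed

lemma sub_closure_closed: "closedin (zariski B) (sub_closure i)"
  by (simp add: sub_closure_def)

lemma sub_image_le_closure: "sub_image i \<subseteq> sub_closure i"
  unfolding sub_closure_def using sub_image_subset_proj by (intro closure_of_subset) simp

lemma sub_image_mono: "sub_image i \<subseteq> sub_image (Suc i)"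
proof
  fix p assume "p \<in> sub_image i"
  then obtain u where u: "p = proj_class (\<phi> (vec i u))" "\<phi> (vec i u) \<noteq> 0" by (auto simp: sub_image_def)
  have "vec i u = vec (Suc i) (u(Suc i := 0))"
    by (rule poly_mapping_eqI) (simp add: lookup_vec)
  then show "p \<in> sub_image (Suc i)" using u by (auto simp: sub_image_def)
qed

lemma point_in_sub_image:
  assumes "peval (psubst (P b) (lin i)) u \<noteq> 0"
  shows "\<phi> (vec i u) \<noteq> 0" "proj_class (\<phi> (vec i u)) \<in> sub_image i"
proof -
  have "lookup (\<phi> (vec i u)) b \<noteq> 0"
    using assms by (simp add: peval_psubst peval_lin lookup_\<phi>_fun[OF keys_vec])
  then show "\<phi> (vec i u) \<noteq> 0" by auto
  then show "proj_class (\<phi> (vec i u)) \<in> sub_image i" by (auto simp: sub_image_def)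
qed

lemma sub_image_separation:
  assumes "closedin (zariski B) S" "\<not> sub_image i \<subseteq> S"
  obtains F n u where "homogeneous n F" "vanishes_on F S" "peval (psubst F (\<lambda>b. psubst (P b) (lin i))) u \<noteq> 0"
proof -
  obtain p where p: "p \<in> sub_image i" "p \<notin> S" using assms(2) by blast
  then obtain u where u: "p = proj_class (\<phi> (vec i u))" "\<phi> (vec i u) \<noteq> 0" by (auto simp: sub_image_def)
  have "p \<in> proj_points B" using sub_image_subset_proj p(1) by blast
  then obtain F n where F: "homogeneous n F" "vanishes_on F S" "\<not> vanishes_on F {p}"
    using closed_separation[OF assms(1) _ p(2)] by blast
  have "peval F (lookup (\<phi> (vec i u))) \<noteq> 0"
    using F(3) vanishes_on_class[OF F(1) u(2) keys_\<phi>[OF keys_vec]] unfolding u(1) by blast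
  then have "peval (psubst F (\<lambda>b. psubst (P b) (lin i))) u \<noteq> 0"
    by (simp add: peval_psubst peval_lin lookup_\<phi>_fun[OF keys_vec])
  with F(1,2) show ?thesis by (rule that)
qed

text \<open>Forms witnessing that neither part contains the image pull back to nonzero polynomials
  in the parameters. A common non-zero of both gives an image point in neither part.\<close>

lemma sub_closure_irreducible:
  assumes "i < card A"
  shows "irreducible_space (subtopology (zariski B) (sub_closure i))"
  unfolding irreducible_space_def
proof (intro conjI allI impI)
  have top: "topspace (subtopology (zariski B) (sub_closure i)) = sub_closure i"
    using closedin_subset_proj_points[OF sub_closure_closed[of i]] by auto
  obtain b0 u0 where nz: "peval (psubst (P b0) (lin i)) u0 \<noteq> 0" by (rule nonzero_on_subspace[OF assms])
  show "topspace (subtopology (zariski B) (sub_closure i)) \<noteq> {}"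
    unfolding top using point_in_sub_image(2)[OF nz] sub_image_le_closure[of i] by blast
  fix S T
  assume ST: "closedin (subtopology (zariski B) (sub_closure i)) S \<and> closedin (subtopology (zariski B) (sub_closure i)) T
      \<and> S \<union> T = topspace (subtopology (zariski B) (sub_closure i))"
  then have S: "closedin (zariski B) S" "S \<subseteq> sub_closure i" and T: "closedin (zariski B) T" "T \<subseteq> sub_closure i"
    and un: "S \<union> T = sub_closure i"
    unfolding top by (simp_all add: closedin_closed_subtopology[OF sub_closure_closed])
  have "sub_image i \<subseteq> S \<or> sub_image i \<subseteq> T"
  proof (rule ccontr)
    assume "\<not> (sub_image i \<subseteq> S \<or> sub_image i \<subseteq> T)"
    then have nS: "\<not> sub_image i \<subseteq> S" and nT: "\<not> sub_image i \<subseteq> T" by auto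
    obtain F m u where F: "homogeneous m F" "vanishes_on F S" "peval (psubst F (\<lambda>b. psubst (P b) (lin i))) u \<noteq> 0"
      by (rule sub_image_separation[OF S(1) nS])
    obtain G n w where G: "homogeneous n G" "vanishes_on G T" "peval (psubst G (\<lambda>b. psubst (P b) (lin i))) w \<noteq> 0"
      by (rule sub_image_separation[OF T(1) nT])
    let ?F = "psubst F (\<lambda>b. psubst (P b) (lin i))" and ?G = "psubst G (\<lambda>b. psubst (P b) (lin i))"
    obtain y where "peval ?F y \<noteq> 0" "peval ?G y \<noteq> 0"
      using peval_both_nonzero[OF F(3) G(3)] by blast
    then have "peval (?F * ?G) y \<noteq> 0" by (simp add: peval_mult)
    \<comment> \<open>The additional condition ensures that \<open>z\<close> is mapped to a nonzero
      vector, hence to a point.\<close>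
    then obtain z where "peval (?F * ?G) z \<noteq> 0" and z0: "peval (psubst (P b0) (lin i)) z \<noteq> 0"
      using peval_both_nonzero[OF _ nz] by blast
    then have zF: "peval ?F z \<noteq> 0" and zG: "peval ?G z \<noteq> 0" by (auto simp: peval_mult)
    let ?g = "\<phi> (vec i z)"
    have "proj_class ?g \<in> S \<union> T"
      using point_in_sub_image(2)[OF z0] sub_image_le_closure[of i] unfolding un by blast
    then have "peval F (lookup ?g) = 0 \<or> peval G (lookup ?g) = 0"
      using F(2) G(2) proj_class_self[of ?g] unfolding vanishes_on_def by blast
    then show False
      using zF zG by (simp add: peval_psubst peval_lin lookup_\<phi>_fun[OF keys_vec])
  qed
  then have "sub_closure i \<subseteq> S \<or> sub_closure i \<subseteq> T"
    unfolding sub_closure_def using closure_of_minimal S(1) T(1) by blast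
  then show "S = topspace (subtopology (zariski B) (sub_closure i)) \<or> T = topspace (subtopology (zariski B) (sub_closure i))"
    unfolding top using S(2) T(2) by blast
qed

text \<open>The \<open>i + 2\<close> forms \<open>Yform 0\<close> to \<open>Yform (Suc i)\<close>
  satisfy a relation on the image of the \<open>i\<close>-th subspace, which has only
  \<open>i + 1\<close> parameters. By \<open>independent\<close> this relation fails on the next
  image.\<close>

lemma sub_closure_strict:
  assumes "Suc i < card A"
  shows "sub_closure i \<subset> sub_closure (Suc i)"
proof
  show "sub_closure i \<subseteq> sub_closure (Suc i)"
    unfolding sub_closure_def by (intro closure_of_mono sub_image_mono)
  show "sub_closure i \<noteq> sub_closure (Suc i)"
  proof
    assume eq: "sub_closure i = sub_closure (Suc i)"
    define R where "R l j = psubst (Yform j) (\<lambda>b. psubst (P b) (lin l))" for l j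
    have inner: "psubst (P b) (lin l) \<in> forms {0..l} e" for b l
      using psubst_forms[OF forms_imp_homogeneous[OF P_forms[of b]] lin_forms[of l]] by simp
    have R: "R l j \<in> forms {0..l} e" for l j
      unfolding R_def using psubst_forms[OF homogeneous_Yform inner[of _ l], of j] by simp
    have pR: "peval (R l j) u = peval (Yform j) (lookup (\<phi> (vec l u)))" for l j u
      by (simp add: R_def peval_psubst peval_lin lookup_\<phi>_fun[OF keys_vec])
    obtain t \<Phi> where \<Phi>: "\<Phi> \<in> forms {0..Suc i} t" "\<Phi> \<noteq> 0" "\<And>x. peval \<Phi> (\<lambda>j. peval (R i j) x) = 0"
      using forms_dependent[of "{0..i}" "{0..Suc i}" "R i" e] R[of i] by auto
    define \<Psi> where "\<Psi> = psubst \<Phi> Yform"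
    have h\<Psi>: "homogeneous t \<Psi>"
      unfolding \<Psi>_def using homogeneous_psubst[OF \<Phi>(1) homogeneous_Yform] by simp
    have "vanishes_on \<Psi> (sub_image i)"
    proof -
      have "vanishes_on \<Psi> {proj_class (\<phi> (vec i u))}" if "\<phi> (vec i u) \<noteq> 0" for u
        using vanishes_on_class[OF h\<Psi> that keys_\<phi>[OF keys_vec]] \<Phi>(3)[of u] by (simp add: \<Psi>_def peval_psubst pR)
      then show ?thesis by (fastforce simp: sub_image_def vanishes_on_def)
    qed
    then have "vanishes_on \<Psi> (sub_closure i)"
      unfolding sub_closure_def by (rule vanishes_on_closure[OF h\<Psi> _ sub_image_subset_proj])
    then have van: "vanishes_on \<Psi> (sub_image (Suc i))"
      unfolding eq by (rule vanishes_on_mono[OF _ sub_image_le_closure])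
    obtain u where "peval \<Phi> (\<lambda>j. \<Sum>b\<in>B. Y j b * peval (P b) (\<lambda>a. \<Sum>k=0..Suc i. u k * dir k a)) \<noteq> 0"
      using independent[OF assms \<Phi>(1)] \<Phi>(2) by blast
    then have u: "peval (psubst \<Phi> (R (Suc i))) u \<noteq> 0"
      by (simp add: peval_psubst pR peval_Yform lookup_\<phi>_fun[OF keys_vec] lookup_vec)
    obtain b0 u0 where nz: "peval (psubst (P b0) (lin (Suc i))) u0 \<noteq> 0" by (rule nonzero_on_subspace[OF assms])
    obtain z where z: "peval (psubst \<Phi> (R (Suc i))) z \<noteq> 0" "peval (psubst (P b0) (lin (Suc i))) z \<noteq> 0"
      using peval_both_nonzero[OF u nz] by blast
    have "peval \<Psi> (lookup (\<phi> (vec (Suc i) z))) = 0"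
      using van point_in_sub_image(2)[OF z(2)] proj_class_self[of "\<phi> (vec (Suc i) z)"] unfolding vanishes_on_def by blast
    then show False using z(1) by (simp add: \<Psi>_def peval_psubst pR)
  qed
qed

text \<open>\<open>chain_length_bound\<close> and \<open>image_dependent\<close> bound the chains.
  The closures along the flag, indexed from \<open>0\<close> to \<open>card A - 1\<close>, attain
  the bound.\<close>

theorem top_dim_image: "top_dim (subtopology (zariski B) C) = enat (card A - 1)"
proof -
  have Cc: "closedin (zariski B) C" by simp
  have sub: "subtopology (subtopology (zariski B) C) Z = subtopology (zariski B) Z" if "Z \<subseteq> C" for Z
    using that by (simp add: subtopology_subtopology inf.absorb2)
  let ?S = "{enat n |n. \<exists>Z :: nat \<Rightarrow> _ set.
     (\<forall>i\<le>n. closedin (subtopology (zariski B) C) (Z i) \<and> irreducible_space (subtopology (subtopology (zariski B) C) (Z i)))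
     \<and> (\<forall>i<n. Z i \<subset> Z (Suc i))}"
  have cpos: "card A > 0" using finite_A A_ne by (simp add: card_gt_0_iff)
  have "Sup ?S = enat (card A - 1)"
  proof (rule antisym)
    show "Sup ?S \<le> enat (card A - 1)"
    proof (rule Sup_least)
      fix x assume "x \<in> ?S"
      then obtain n Z where x: "x = enat n"
        and Z: "\<And>i. i \<le> n \<Longrightarrow> closedin (subtopology (zariski B) C) (Z i)"
          "\<And>i. i \<le> n \<Longrightarrow> irreducible_space (subtopology (subtopology (zariski B) C) (Z i))"
        and strict: "\<And>i. i < n \<Longrightarrow> Z i \<subset> Z (Suc i)" by blast
      have Z1: "closedin (zariski B) (Z i)" "Z i \<subseteq> C" if "i \<le> n" for i
        using Z(1)[OF that] by (simp_all add: closedin_closed_subtopology[OF Cc])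
      have "n < card A"
      proof (rule chain_length_bound[where C = C and I = B and Z = Z])
        show "\<exists>t \<Phi>. \<Phi> \<in> forms {0..card A} t \<and> \<Phi> \<noteq> 0 \<and> vanishes_on (psubst \<Phi> G) C"
          if "\<And>j. homogeneous D (G j)" for G :: "nat \<Rightarrow> ('b, 'k) mpol" and D
          using that by (rule image_dependent)
        show "closedin (zariski B) (Z j) \<and> irreducible_space (subtopology (zariski B) (Z j)) \<and> Z j \<subseteq> C" if "j \<le> n" for j
          using Z1[OF that] Z(2)[OF that] by (simp add: sub)
        show "Z j \<subset> Z (Suc j)" if "j < n" for j by (rule strict[OF that])
      qed
      then show "x \<le> enat (card A - 1)" using x by simp
    qed
    show "enat (card A - 1) \<le> Sup ?S"
    proof (rule Sup_upper, rule CollectI, intro exI conjI allI impI)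
      have subC: "sub_closure i \<subseteq> C" for i
        unfolding sub_closure_def by (intro closure_of_mono sub_image_subset)
      show "enat (card A - 1) = enat (card A - 1)" by simp
      show "closedin (subtopology (zariski B) C) (sub_closure i)" for i
        using sub_closure_closed[of i] subC[of i] by (simp add: closedin_closed_subtopology[OF Cc])
      show "irreducible_space (subtopology (subtopology (zariski B) C) (sub_closure i))" if "i \<le> card A - 1" for i
        using sub_closure_irreducible[of i] that cpos by (simp add: sub[OF subC])
      show "sub_closure i \<subset> sub_closure (Suc i)" if "i < card A - 1" for i
        using that by (intro sub_closure_strict) simp
    qed
  qed
  then show ?thesis unfolding top_dim_def .
qed

text \<open>The \<open>n\<close> pulled back linear forms and the \<open>e\<close>-th power of the
  coordinate \<open>a\<close> satisfy a relation. Over a fixed \<open>y\<close> it is a polynomial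
  equation for that power, and \<open>K\<close> is its lowest coefficient in this power, so the
  equation is nontrivial where \<open>K\<close> does not vanish.\<close>

lemma fibre_coordinate:
  assumes a: "a \<in> A"
  shows "\<exists>K t. homogeneous t K \<and> (\<exists>x. peval (psubst K P) x \<noteq> 0)
    \<and> (\<forall>y. peval K y \<noteq> 0 \<longrightarrow> finite {lookup f a |f. keys f \<subseteq> A \<and> lookup (\<phi> f) = y})"
proof -
  define n where "n = card A"
  have n: "n > 0" using finite_A A_ne by (simp add: card_gt_0_iff n_def)
  \<comment> \<open>The exponent \<open>e\<close> gives the coordinate the same degree as the other
    forms.\<close>
  define G where "G j = (if j < n then psubst (Yform j) P else var a ^ e)" for j
  have G: "G j \<in> forms A e" for j
  proof (cases "j < n")
    case True
    then show ?thesis using psubst_P_forms[OF homogeneous_Yform[of j]] by (simp add: G_def)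
  next
    case False
    then show ?thesis using forms_power[OF forms_var[OF a], of e] by (simp add: G_def)
  qed
  obtain t \<Phi> where \<Phi>: "\<Phi> \<in> forms {0..n} t" "\<Phi> \<noteq> 0" "\<And>x. peval \<Phi> (\<lambda>j. peval (G j) x) = 0"
    using forms_dependent[OF finite_A A_ne, of "{0..n}" G e] G by (auto simp: n_def)
  obtain g F' F0 where s: "\<And>x. peval \<Phi> x = x n ^ g * peval F' x" "F0 \<noteq> 0"
      "\<And>x. x n = 0 \<Longrightarrow> peval F' x = peval F0 x"
      "\<And>m. m \<in> keys F0 \<Longrightarrow> n \<notin> keys m \<and> keys m \<subseteq> \<Union>(keys ` keys \<Phi>)"
      "\<And>I D. \<Phi> \<in> forms I D \<Longrightarrow> F' \<in> forms I (D - g) \<and> F0 \<in> forms (I - {n}) (D - g)"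
    using split_variable[OF \<Phi>(2), of n] by metis
  have "{0..n} - {n} = {0..n - 1}" using n by auto
  then have F0: "F0 \<in> forms {0..n - 1} (t - g)" using s(5)[OF \<Phi>(1)] by simp
  define K where "K = psubst F0 Yform"
  have "homogeneous ((t - g) * 1) K" unfolding K_def by (rule homogeneous_psubst[OF F0 homogeneous_Yform])
  moreover have "\<exists>x. peval (psubst K P) x \<noteq> 0"
  proof -
    have "n - 1 < card A" using n by (simp add: n_def)
    then obtain u where "peval F0 (\<lambda>j. \<Sum>b\<in>B. Y j b * peval (P b) (\<lambda>a. \<Sum>k=0..n - 1. u k * dir k a)) \<noteq> 0"
      using independent[OF _ F0] s(2) by blast
    then show ?thesis unfolding K_def peval_psubst peval_Yform by blast
  qed
  moreover have "finite {lookup f a |f. keys f \<subseteq> A \<and> lookup (\<phi> f) = y}" if y: "peval K y \<noteq> 0" for y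
  proof -
    define v where "v = (\<lambda>j. peval (Yform j) y)"
    have Kv: "peval K y = peval F0 v" by (simp add: K_def peval_psubst v_def)
    obtain q where q: "\<And>c. peval F' (\<lambda>w. poly (if w = n then [:0, 1:] else [:v w:]) c) = poly q c"
      using peval_poly[of F' "\<lambda>w. if w = n then [:0, 1:] else [:v w:]"] by metis
    have q: "peval F' (v(n := c)) = poly q c" for c
      unfolding q[symmetric] by (intro arg_cong[where f = "peval F'"]) auto
    have "peval F0 (v(n := 0)) = peval F0 v"
      using s(4) by (intro peval_cong_keys) auto
    then have "poly q 0 \<noteq> 0" using y q[of 0] s(3)[of "v(n := 0)"] by (simp add: Kv)
    then have "q \<noteq> 0" by auto
    then have fin: "finite (insert 0 {c. poly q c = 0})" by (simp add: poly_roots_finite)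
    have "finite {x. x ^ e = c}" for c :: 'k
    proof -
      have "coeff (monom (1::'k) e - [:c:]) e = 1"
        using e_pos by (simp add: coeff_pCons split: nat.split)
      then have "monom (1::'k) e - [:c:] \<noteq> 0" by (metis coeff_0 zero_neq_one)
      then have "finite {x. poly (monom (1::'k) e - [:c:]) x = 0}" by (rule poly_roots_finite)
      then show ?thesis by (simp add: poly_monom)
    qed
    then have "finite (\<Union>c\<in>insert 0 {c. poly q c = 0}. {x. x ^ e = c})" using fin by blast
    moreover have "lookup f a \<in> (\<Union>c\<in>insert 0 {c. poly q c = 0}. {x. x ^ e = c})"
      if f: "keys f \<subseteq> A" "lookup (\<phi> f) = y" for f
    proof -
      have "v j = peval (psubst (Yform j) P) (lookup f)" for j
        using peval_psubst_P[OF f(1)] f(2) by (simp add: v_def)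
      then have "peval \<Phi> (v(n := lookup f a ^ e)) = peval \<Phi> (\<lambda>j. peval (G j) (lookup f))"
        using \<Phi>(1) by (intro peval_cong_keys) (fastforce simp: G_def peval_power forms_def pps_def)
      then have "lookup f a ^ e = 0 \<or> poly q (lookup f a ^ e) = 0"
        using \<Phi>(3) q s(1)[of "v(n := lookup f a ^ e)"] by auto
      then show ?thesis by blast
    qed
    ultimately show ?thesis by (elim finite_subset[rotated]) blast
  qed
  ultimately show ?thesis by blast
qed

lemma \<phi>_scale:
  assumes "keys f \<subseteq> A"
  shows "\<phi> (Poly_Mapping.map ((*) c) f) = Poly_Mapping.map ((*) (c ^ e)) (\<phi> f)"
proof (rule poly_mapping_eqI)
  fix b
  have k: "keys (Poly_Mapping.map ((*) c) f) \<subseteq> A"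
    using assms by (auto simp: in_keys_iff lookup_map_mult)
  have "lookup (Poly_Mapping.map ((*) c) f) = (\<lambda>v. c * lookup f v)"
    by (rule ext) (rule lookup_map_mult)
  then show "lookup (\<phi> (Poly_Mapping.map ((*) c) f)) b = lookup (Poly_Mapping.map ((*) (c ^ e)) (\<phi> f)) b"
    by (simp add: lookup_\<phi>[OF k] lookup_\<phi>[OF assms] lookup_map_mult peval_scale[OF forms_imp_homogeneous[OF P_forms]])
qed

text \<open>On \<open>V\<close> none of the forms \<open>K a\<close> vanishes, so every coordinate
  takes finitely many values over a fixed representative \<open>y\<close>. Each point of the fibre
  has a representative mapped to \<open>y\<close> itself, found by extracting an \<open>e\<close>-th
  root.\<close>

theorem generically_finite:
  obtains V where "openin (subtopology (zariski B) C) V" "V \<noteq> {}"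
    "\<And>y. y \<in> V \<Longrightarrow> finite {proj_class f |f. keys f \<subseteq> A \<and> \<phi> f \<noteq> 0 \<and> proj_class (\<phi> f) = y}"
proof -
  have "\<forall>a\<in>A. \<exists>Kt. homogeneous (snd Kt) (fst Kt) \<and> (\<exists>x. peval (psubst (fst Kt) P) x \<noteq> 0)
    \<and> (\<forall>y. peval (fst Kt) y \<noteq> 0 \<longrightarrow> finite {lookup f a |f. keys f \<subseteq> A \<and> lookup (\<phi> f) = y})"
    using fibre_coordinate by force
  from bchoice[OF this] obtain Kt where Kt: "\<forall>a\<in>A. homogeneous (snd (Kt a)) (fst (Kt a)) \<and> (\<exists>x. peval (psubst (fst (Kt a)) P) x \<noteq> 0)
    \<and> (\<forall>y. peval (fst (Kt a)) y \<noteq> 0 \<longrightarrow> finite {lookup f a |f. keys f \<subseteq> A \<and> lookup (\<phi> f) = y})"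
    by blast
  define K where "K a = fst (Kt a)" for a
  have K: "homogeneous (snd (Kt a)) (K a)" "\<exists>x. peval (psubst (K a) P) x \<noteq> 0"
    "\<And>y. peval (K a) y \<noteq> 0 \<Longrightarrow> finite {lookup f a |f. keys f \<subseteq> A \<and> lookup (\<phi> f) = y}" if "a \<in> A" for a
    using bspec[OF Kt that] by (simp_all add: K_def)
  define H where "H = (\<Prod>a\<in>A. K a)"
  have H: "homogeneous (\<Sum>a\<in>A. snd (Kt a)) H"
    unfolding H_def homogeneous_iff_forms using K(1) by (intro forms_prod finite_A) (simp add: homogeneous_iff_forms)
  define V where "V = C - zero_locus B {H}"
  have "openin (zariski B) (proj_points B - zero_locus B {H})"
    using closedin_zero_locus_singleton[OF H, of B] by (simp add: closedin_def)
  moreover have C: "C \<subseteq> proj_points B" using closure_of_subset_topspace[of "zariski B"] by simp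
  then have "V = C \<inter> (proj_points B - zero_locus B {H})" by (auto simp: V_def)
  ultimately have V: "openin (subtopology (zariski B) C) V"
    unfolding openin_subtopology by blast
  have "V \<noteq> {}"
  proof -
    obtain x where x: "peval (\<Prod>a\<in>A. psubst (K a) P) x \<noteq> 0"
      using peval_prod_nonzero[OF finite_A, of "\<lambda>a. psubst (K a) P"] K(2) by blast
    \<comment> \<open>As \<open>H\<close> may have degree \<open>0\<close>, its nonvanishing does
      not guarantee a nonzero image vector. Some \<open>P b\<close> has to be nonzero as
      well.\<close>
    obtain b u where "peval (psubst (P b) (lin 0)) u \<noteq> 0"
      by (rule nonzero_on_subspace[of 0]) (use finite_A A_ne in \<open>simp add: card_gt_0_iff\<close>)
    then have nz: "peval (P b) (lookup (vec 0 u)) \<noteq> 0" by (simp add: peval_psubst peval_lin)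
    obtain z where z: "peval (\<Prod>a\<in>A. psubst (K a) P) z \<noteq> 0" "peval (P b) z \<noteq> 0"
      using peval_both_nonzero[OF x nz] by blast
    define f where "f = (\<Sum>a\<in>A. Poly_Mapping.single a (z a))"
    have kf: "keys f \<subseteq> A" unfolding f_def by (rule keys_sum_single[OF finite_A])
    have Pz: "peval (P b) z = peval (P b) (lookup f)" for b
      using P_forms[of b] by (intro peval_cong_keys) (auto simp: f_def lookup_sum_single[OF finite_A] forms_def pps_def)
    have "lookup (\<phi> f) b \<noteq> 0" using z(2) by (simp add: lookup_\<phi>[OF kf] Pz)
    then have f0: "\<phi> f \<noteq> 0" by auto
    have "peval H (lookup (\<phi> f)) \<noteq> 0"
      using z(1) by (simp add: H_def peval_prod peval_psubst lookup_\<phi>_fun[OF kf] Pz)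
    then have "proj_class (\<phi> f) \<notin> zero_locus B {H}"
      using vanishes_on_class[OF H f0 keys_\<phi>[OF kf]] by (simp add: zero_locus_singleton)
    moreover have "proj_class (\<phi> f) \<in> C"
      using closure_of_subset[of image_points "zariski B"] image_subset kf f0 by (auto simp: image_points_def)
    ultimately show ?thesis by (auto simp: V_def)
  qed
  moreover have "finite {proj_class f |f. keys f \<subseteq> A \<and> \<phi> f \<noteq> 0 \<and> proj_class (\<phi> f) = p}" if p: "p \<in> V" for p
  proof -
    obtain y where y: "y \<noteq> 0" "keys y \<subseteq> B" "p = proj_class y"
      using p C by (auto simp: V_def proj_points_def)
    have "\<not> vanishes_on H {p}" using p C by (auto simp: V_def zero_locus_singleton)
    then have Hy: "peval H (lookup y) \<noteq> 0" using vanishes_on_class[OF H y(1,2)] y(3) by simp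
    let ?R = "\<lambda>a. {lookup f a |f. keys f \<subseteq> A \<and> lookup (\<phi> f) = lookup y}"
    let ?N = "{f. keys f \<subseteq> A \<and> \<phi> f = y}"
    have "finite (?R a)" if "a \<in> A" for a
      using Hy that finite_A by (intro K(3)) (auto simp: H_def peval_prod)
    then have "finite (PiE A ?R)" using finite_A by (intro finite_PiE) auto
    moreover have "(\<lambda>f. restrict (lookup f) A) ` ?N \<subseteq> PiE A ?R" by (intro image_subsetI restrict_PiE_iff[THEN iffD2]) auto
    ultimately have "finite ((\<lambda>f. restrict (lookup f) A) ` ?N)" by (rule finite_subset[rotated])
    moreover have "inj_on (\<lambda>f. restrict (lookup f) A) ?N"
    proof (rule inj_onI, rule poly_mapping_eqI)
      fix f g a assume f: "f \<in> ?N" "g \<in> ?N" "restrict (lookup f) A = restrict (lookup g) A"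
      show "lookup f a = lookup g a"
      proof (cases "a \<in> A")
        case True then show ?thesis using fun_cong[OF f(3), of a] by simp
      next
        case False
        then have "a \<notin> keys f" "a \<notin> keys g" using f(1,2) by auto
        then show ?thesis by (simp add: in_keys_iff)
      qed
    qed
    ultimately have "finite ?N" by (rule finite_imageD)
    moreover have "proj_class f \<in> proj_class ` ?N" if f: "keys f \<subseteq> A" "\<phi> f \<noteq> 0" "proj_class (\<phi> f) = p" for f
    proof -
      have "y \<in> proj_class (\<phi> f)" using proj_class_self[of y] y(3) f(3) by simp
      then obtain c where c: "c \<noteq> 0" "y = Poly_Mapping.map ((*) c) (\<phi> f)" by (auto simp: proj_class_def)
      \<comment> \<open>Scaling \<open>f\<close> by \<open>l\<close> multiplies
        \<open>\<phi> f\<close> by \<open>l ^ e\<close>, which turns it into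
        \<open>y\<close>.\<close>
      obtain l where l: "l ^ e = c" using nth_root_exists[OF e_pos] by blast
      then have "l \<noteq> 0" using c(1) e_pos by (auto simp: power_0_left)
      have k: "keys (Poly_Mapping.map ((*) l) f) \<subseteq> A"
        using f(1) by (auto simp: in_keys_iff lookup_map_mult)
      have "\<phi> (Poly_Mapping.map ((*) l) f) = y" using \<phi>_scale[OF f(1), of l] l c(2) by simp
      then show ?thesis using k proj_class_scale[OF \<open>l \<noteq> 0\<close>, of f] by (intro image_eqI[of _ _ "Poly_Mapping.map ((*) l) f"]) auto
    qed
    ultimately show ?thesis by (elim finite_subset[OF _ finite_imageI, rotated]) blast
  qed
  ultimately show ?thesis using that V by blast
qed

end

section \<open>Logarithmic derivatives\<close>

lemma coeff_prod_linear:
  fixes h :: "'i \<Rightarrow> 'a::comm_ring_1"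
  assumes "finite E"
  shows "coeff (\<Prod>i\<in>E. [:1, h i:]) 0 = 1 \<and> coeff (\<Prod>i\<in>E. [:1, h i:]) 1 = (\<Sum>i\<in>E. h i)"
  using assms
proof (induction E rule: finite_induct)
  case (insert i E)
  then show ?case by (simp add: mult_pCons_left add.commute)
qed simp

text \<open>
  The derivative of \<open>\<Sum>\<^sub>\<tau> K b \<tau> \<Prod>\<^sub>i x (\<tau> i)\<close> at \<open>p\<close> in the direction \<open>a \<mapsto> p a * u a\<close>.
\<close>

definition log_derivative ::
    "'i set \<Rightarrow> 'a set \<Rightarrow> ('b \<Rightarrow> ('i \<Rightarrow> 'a) \<Rightarrow> 'k::field) \<Rightarrow> ('a \<Rightarrow> 'k) \<Rightarrow> 'b \<Rightarrow> ('a \<Rightarrow> 'k) \<Rightarrow> 'k" where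
  "log_derivative E A K p b u = (\<Sum>\<tau>\<in>PiE E (\<lambda>_. A). K b \<tau> * (\<Prod>i\<in>E. p (\<tau> i)) * (\<Sum>i\<in>E. u (\<tau> i)))"

lemma log_derivative_sum:
  "log_derivative E A K p b (\<lambda>a. \<Sum>k\<in>J. w k * U k a) = (\<Sum>k\<in>J. w k * log_derivative E A K p b (U k))"
proof -
  have "(\<Sum>i\<in>E. \<Sum>k\<in>J. w k * U k (\<tau> i)) = (\<Sum>k\<in>J. w k * (\<Sum>i\<in>E. U k (\<tau> i)))" for \<tau>
    by (subst sum.swap) (simp add: sum_distrib_left)
  then have "log_derivative E A K p b (\<lambda>a. \<Sum>k\<in>J. w k * U k a)
    = (\<Sum>\<tau>\<in>PiE E (\<lambda>_. A). \<Sum>k\<in>J. w k * (K b \<tau> * (\<Prod>i\<in>E. p (\<tau> i)) * (\<Sum>i\<in>E. U k (\<tau> i))))"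
    by (simp add: log_derivative_def sum_distrib_left mult_ac)
  also have "\<dots> = (\<Sum>k\<in>J. w k * log_derivative E A K p b (U k))"
    by (subst sum.swap) (simp add: log_derivative_def sum_distrib_left)
  finally show ?thesis .
qed

text \<open>Linear forms dual to the images of a basis under the differential at \<open>p\<close>
  have prescribed first-order behaviour along lines through \<open>p\<close>. Hence
  \<open>forms_zero_if_zero_on_curves\<close> excludes relations between them.\<close>

lemma independent_forms_map_if_log_derivative_injective:
  fixes K :: "'b \<Rightarrow> ('i \<Rightarrow> 'a) \<Rightarrow> 'k::{alg_closed_field, field_char_0}"
  assumes A: "finite A" "A \<noteq> {}" and B: "finite B" and E: "finite E" "E \<noteq> {}"
    and \<phi>: "\<And>f b. keys f \<subseteq> A \<Longrightarrow> b \<in> B \<Longrightarrow>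
      lookup (\<phi> f) b = (\<Sum>\<tau>\<in>PiE E (\<lambda>_. A). K b \<tau> * (\<Prod>i\<in>E. lookup f (\<tau> i)))"
    and keys_\<phi>: "\<And>f. keys f \<subseteq> A \<Longrightarrow> keys (\<phi> f) \<subseteq> B"
    and p: "\<And>a. a \<in> A \<Longrightarrow> p a \<noteq> 0"
    and inj: "\<And>u. (\<And>b. b \<in> B \<Longrightarrow> log_derivative E A K p b u = 0) \<Longrightarrow> (\<forall>a\<in>A. u a = 0)"
  shows "\<exists>P dir Y. independent_forms_map A B (card E) P \<phi> dir Y"
proof -
  define n where "n = card A"
  have n: "n > 0" using A by (simp add: n_def card_gt_0_iff)
  define e where "e = card E"
  have e: "e > 0" using E by (simp add: e_def card_gt_0_iff)
  obtain \<alpha> where \<alpha>: "bij_betw \<alpha> {0..<n} A"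
    using ex_bij_betw_nat_finite[OF A(1)] by (auto simp: n_def)
  \<comment> \<open>\<open>U 0\<close> is the direction of \<open>p\<close> itself, in which by
    Euler's formula the derivative is \<open>e\<close> times the value. The other \<open>U j\<close>
    are the coordinate directions except that of \<open>\<alpha> 0\<close>.\<close>
  define U :: "nat \<Rightarrow> 'a \<Rightarrow> 'k" where "U j a = (if j = 0 then 1 else if a = \<alpha> j then 1 else 0)" for j a
  define P where "P b = (if b \<in> B then \<Sum>\<tau>\<in>PiE E (\<lambda>_. A). const (K b \<tau>) * (\<Prod>i\<in>E. var (\<tau> i)) else 0)" for b
  define dir where "dir k a = (if a \<in> A then p a * U k a else 0)" for k a
  have inA: "\<alpha> j \<in> A" if "j < n" for j using bij_betwE[OF \<alpha>] that by simp
  have \<alpha>_eq: "\<alpha> j = \<alpha> k \<longleftrightarrow> j = k" if "j < n" "k < n" for j k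
    using bij_betw_imp_inj_on[OF \<alpha>] that by (simp add: inj_on_eq_iff)
  \<comment> \<open>The \<open>U k\<close> with \<open>k < n\<close> form a basis, so their images
    under the injective differential have a dual system \<open>Y\<close>.\<close>
  have "\<exists>Y. \<forall>j\<in>{0..<n}. \<forall>k\<in>{0..<n}.
      (\<Sum>b\<in>B. Y j b * log_derivative E A K p b (U k)) = (if j = k then 1 else 0)"
  proof (rule left_inverse_of_independent_columns)
    fix w assume w: "\<And>b. b \<in> B \<Longrightarrow> (\<Sum>k\<in>{0..<n}. log_derivative E A K p b (U k) * w k) = 0"
    have "\<forall>a\<in>A. (\<Sum>k\<in>{0..<n}. w k * U k a) = 0"
      by (rule inj) (use w in \<open>simp add: log_derivative_sum mult.commute\<close>)
    then have *: "(\<Sum>k\<in>{0..<n}. w k * U k (\<alpha> j)) = 0" if "j < n" for j using inA[OF that] by blast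
    have I: "{0..<n} = insert 0 {1..<n}" using n by auto
    have **: "(\<Sum>k\<in>{0..<n}. w k * U k (\<alpha> j)) = w 0 + (\<Sum>k\<in>{1..<n}. if k = j then w j else 0)" if "j < n" for j
    proof -
      have "(\<Sum>k\<in>{1..<n}. w k * U k (\<alpha> j)) = (\<Sum>k\<in>{1..<n}. if k = j then w j else 0)"
        by (intro sum.cong refl) (use that in \<open>auto simp: U_def \<alpha>_eq\<close>)
      then show ?thesis unfolding I by (simp add: U_def)
    qed
    have w0: "w 0 = 0" using *[of 0] **[of 0] n by simp
    show "\<forall>j\<in>{0..<n}. w j = 0"
    proof
      fix j assume "j \<in> {0..<n}"
      then show "w j = 0" using *[of j] **[of j] w0 by (cases "j = 0") auto
    qed
  qed (use B in auto)
  then obtain Y where Y: "\<And>j k. j < n \<Longrightarrow> k < n \<Longrightarrow>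
      (\<Sum>b\<in>B. Y j b * log_derivative E A K p b (U k)) = (if j = k then 1 else 0)"
    by (metis atLeastLessThan_iff zero_le)
  have pP: "peval (P b) x = (\<Sum>\<tau>\<in>PiE E (\<lambda>_. A). K b \<tau> * (\<Prod>i\<in>E. x (\<tau> i)))" if "b \<in> B" for b x
    using that by (simp add: P_def peval_hom)
  have "independent_forms_map A B e P \<phi> dir Y"
  proof
    show "finite A" "A \<noteq> {}" "finite B" "e > 0" by (fact A B e)+
    show "P b \<in> forms A e" for b
    proof (cases "b \<in> B")
      case True
      have "(\<Prod>i\<in>E. var (\<tau> i)) \<in> forms A (\<Sum>i\<in>E. 1)" if "\<tau> \<in> PiE E (\<lambda>_. A)" for \<tau>
        using that by (intro forms_prod forms_var E) auto
      then have "const (K b \<tau>) * (\<Prod>i\<in>E. var (\<tau> i)) \<in> forms A e" if "\<tau> \<in> PiE E (\<lambda>_. A)" for \<tau>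
        using that forms_const_mult by (fastforce simp: e_def)
      then have "(\<Sum>\<tau>\<in>PiE E (\<lambda>_. A). const (K b \<tau>) * (\<Prod>i\<in>E. var (\<tau> i))) \<in> forms A e"
        by (rule forms_sum)
      then show ?thesis using True by (simp add: P_def)
    qed (simp add: P_def)
    show "P b = 0" if "b \<notin> B" for b using that by (simp add: P_def)
    show "lookup (\<phi> f) b = peval (P b) (lookup f)" if "keys f \<subseteq> A" for f b
    proof (cases "b \<in> B")
      case True then show ?thesis using \<phi>[OF that True] pP[OF True] by simp
    next
      case False
      then have "lookup (\<phi> f) b = 0" using keys_\<phi>[OF that] by (auto simp: in_keys_iff)
      then show ?thesis using False by (simp add: P_def)
    qed
    show "dir k a = 0" if "a \<notin> A" for a k using that by (simp add: dir_def)
    fix i t and \<Phi> :: "(nat, 'k) mpol"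
    assume i: "i < card A" and \<Phi>: "\<Phi> \<in> forms {0..i} t"
      and van: "\<And>u. peval \<Phi> (\<lambda>j. \<Sum>b\<in>B. Y j b * peval (P b) (\<lambda>a. \<Sum>k=0..i. u k * dir k a)) = 0"
    show "\<Phi> = 0"
    proof (rule forms_zero_if_zero_on_curves[OF \<Phi>])
      \<comment> \<open>By duality and Euler's formula, \<open>e\<close> times the initial value is
        \<open>1\<close> for the form \<open>0\<close> and \<open>0\<close> for the others.\<close>
      show "1 / of_nat e \<noteq> (0 :: 'k)" using e by simp
      fix v :: "nat \<Rightarrow> 'k"
      define h where "h a = (\<Sum>k\<in>{1..i}. v k * U k a)" for a
      define c where "c b \<tau> = K b \<tau> * (\<Prod>i\<in>E. p (\<tau> i))" for b \<tau>
      \<comment> \<open>The value of the \<open>j\<close>-th linear form at the point with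
        coordinates \<open>p a * (1 + s * h a)\<close>, as a polynomial in \<open>s\<close>.\<close>
      define q where "q j = (\<Sum>b\<in>B. smult (Y j b) (\<Sum>\<tau>\<in>PiE E (\<lambda>_. A). smult (c b \<tau>) (\<Prod>i\<in>E. [:1, h (\<tau> i):])))" for j
      have q0: "of_nat e * coeff (q j) 0 = (\<Sum>b\<in>B. Y j b * log_derivative E A K p b (U 0))" for j
        by (simp add: coeff_prod_linear[OF E(1)] q_def coeff_sum log_derivative_def c_def U_def e_def sum_distrib_left sum_distrib_right mult_ac)
      have q1: "coeff (q j) 1 = (\<Sum>k\<in>{1..i}. v k * (\<Sum>b\<in>B. Y j b * log_derivative E A K p b (U k)))" for j
      proof -
        have "coeff (q j) 1 = (\<Sum>b\<in>B. Y j b * log_derivative E A K p b h)"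
          using coeff_prod_linear[OF E(1), where 'a = 'k] by (simp add: q_def coeff_sum log_derivative_def c_def)
        also have "\<dots> = (\<Sum>b\<in>B. \<Sum>k\<in>{1..i}. v k * (Y j b * log_derivative E A K p b (U k)))"
          unfolding h_def[abs_def] log_derivative_sum by (simp add: sum_distrib_left mult_ac)
        also have "\<dots> = (\<Sum>k\<in>{1..i}. v k * (\<Sum>b\<in>B. Y j b * log_derivative E A K p b (U k)))"
          by (subst sum.swap) (simp add: sum_distrib_left)
        finally show ?thesis .
      qed
      have zero: "peval \<Phi> (\<lambda>j. poly (q j) s) = 0" for s
      proof -
        define u where "u k = (if k = 0 then 1 else s * v k)" for k
        have I: "{0..i} = insert 0 {1..i}" by auto
        have x: "(\<Sum>k=0..i. u k * dir k a) = p a * (1 + s * h a)" if "a \<in> A" for a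
        proof -
          have "(\<Sum>k\<in>{1..i}. u k * dir k a) = p a * (s * h a)"
            using that unfolding h_def sum_distrib_left
            by (intro sum.cong) (auto simp: u_def dir_def)
          then show ?thesis unfolding I using that
            by (simp add: u_def dir_def U_def distrib_left)
        qed
        have "(\<Sum>b\<in>B. Y j b * peval (P b) (\<lambda>a. \<Sum>k=0..i. u k * dir k a)) = poly (q j) s" for j
        proof -
          have "peval (P b) (\<lambda>a. \<Sum>k=0..i. u k * dir k a)
              = (\<Sum>\<tau>\<in>PiE E (\<lambda>_. A). c b \<tau> * (\<Prod>i\<in>E. 1 + s * h (\<tau> i)))" if "b \<in> B" for b
            unfolding pP[OF that]
          proof (intro sum.cong refl)
            fix \<tau> assume \<tau>: "\<tau> \<in> PiE E (\<lambda>_. A)"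
            have "(\<Prod>l\<in>E. \<Sum>k=0..i. u k * dir k (\<tau> l)) = (\<Prod>l\<in>E. p (\<tau> l) * (1 + s * h (\<tau> l)))"
              using \<tau> by (intro prod.cong refl x) auto
            then show "K b \<tau> * (\<Prod>l\<in>E. \<Sum>k=0..i. u k * dir k (\<tau> l)) = c b \<tau> * (\<Prod>i\<in>E. 1 + s * h (\<tau> i))"
              by (simp add: c_def prod.distrib)
          qed
          then show ?thesis
            by (simp add: q_def poly_sum poly_prod)
        qed
        then show ?thesis using van[of u] by simp
      qed
      show "\<exists>q. coeff (q 0) 0 = 1 / of_nat e \<and> (\<forall>j\<in>{1..i}. coeff (q j) 0 = 0 \<and> coeff (q j) 1 = v j)
          \<and> (\<forall>s. peval \<Phi> (\<lambda>j. poly (q j) s) = 0)"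
      proof (intro exI[of _ q] conjI ballI allI)
        have "of_nat e * coeff (q 0) 0 = 1" using q0[of 0] Y[of 0 0] n by simp
        then show "coeff (q 0) 0 = 1 / of_nat e" using e by (simp add: field_simps)
        fix j assume j: "j \<in> {1..i}"
        then have jn: "j < n" using i by (simp add: n_def)
        have "of_nat e * coeff (q j) 0 = 0" using q0[of j] Y[OF jn n] j by simp
        then show "coeff (q j) 0 = 0" using e by simp
        have "coeff (q j) 1 = (\<Sum>k\<in>{1..i}. if k = j then v j else 0)"
          unfolding q1 using Y[OF jn] i by (intro sum.cong) (auto simp: n_def)
        then show "coeff (q j) 1 = v j" using j by simp
      qed (rule zero)
    qed
  qed
  then show ?thesis unfolding e_def by blast
qed

text \<open>
  The rows \<open>\<tau>\<^sub>0 \<in> T\<close> single out, for the point \<open>p a = t\<^bsup>\<omega> a\<^esup>\<close>, coordinates \<open>\<beta> \<tau>\<^sub>0\<close> of which \<open>\<tau>\<^sub>0\<close>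
  gives the unique term of lowest order in \<open>t\<close>. After division by that power of \<open>t\<close>, the logarithmic
  derivative at \<open>t = 0\<close> is the linear form \<open>u \<mapsto> \<Sum>\<^sub>i u (\<tau>\<^sub>0 i)\<close>, up to a factor.
\<close>

lemma log_derivative_injective_if_initial_rows:
  fixes K :: "'b \<Rightarrow> ('i \<Rightarrow> 'a) \<Rightarrow> 'k::field_char_0" and \<omega> :: "'a \<Rightarrow> nat"
  assumes A: "finite A" and E: "finite E"
    and T: "T \<subseteq> PiE E (\<lambda>_. A)" "\<And>\<tau>. \<tau> \<in> T \<Longrightarrow> \<beta> \<tau> \<in> B" "\<And>\<tau>. \<tau> \<in> T \<Longrightarrow> K (\<beta> \<tau>) \<tau> \<noteq> 0"
    and lowest: "\<And>\<tau>0 \<tau>. \<tau>0 \<in> T \<Longrightarrow> \<tau> \<in> PiE E (\<lambda>_. A) \<Longrightarrow> K (\<beta> \<tau>0) \<tau> \<noteq> 0 \<Longrightarrow> \<tau> \<noteq> \<tau>0 \<Longrightarrow>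
      (\<Sum>i\<in>E. \<omega> (\<tau>0 i)) < (\<Sum>i\<in>E. \<omega> (\<tau> i))"
    and inj: "\<And>u :: 'a \<Rightarrow> 'k. (\<And>\<tau>. \<tau> \<in> T \<Longrightarrow> (\<Sum>i\<in>E. u (\<tau> i)) = 0) \<Longrightarrow> (\<forall>a\<in>A. u a = 0)"
  shows "\<exists>p. (\<forall>a. p a \<noteq> 0) \<and> (\<forall>u. (\<forall>b\<in>B. log_derivative E A K p b u = 0) \<longrightarrow> (\<forall>a\<in>A. u a = 0))"
proof -
  define \<Omega> where "\<Omega> \<tau> = (\<Sum>i\<in>E. \<omega> (\<tau> i))" for \<tau>
  \<comment> \<open>The number of occurrences of \<open>a\<close> in \<open>\<tau>\<close>, which
    turns a row into a vector indexed by \<open>A\<close>.\<close>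
  define cnt :: "('i \<Rightarrow> 'a) \<Rightarrow> 'a \<Rightarrow> 'k" where "cnt \<tau> a = (\<Sum>i\<in>E. if \<tau> i = a then 1 else 0)" for \<tau> a
  have cnt: "(\<Sum>a\<in>A. cnt \<tau> a * u a) = (\<Sum>i\<in>E. u (\<tau> i))" if "\<tau> \<in> PiE E (\<lambda>_. A)" for \<tau> u
  proof -
    have "(\<Sum>a\<in>A. cnt \<tau> a * u a) = (\<Sum>i\<in>E. \<Sum>a\<in>A. if \<tau> i = a then u a else 0)"
      by (subst sum.swap) (simp add: cnt_def sum_distrib_right if_distrib[of "\<lambda>x. x * _"] cong: if_cong)
    also have "\<dots> = (\<Sum>i\<in>E. u (\<tau> i))" using that A by (intro sum.cong) auto
    finally show ?thesis .
  qed
  \<comment> \<open>Truncation of the difference is harmless: by \<open>lowest\<close>, the factor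
    \<open>K (\<beta> \<tau>0) \<tau>\<close> is zero when
    \<open>\<Omega> \<tau> < \<Omega> \<tau>0\<close>.\<close>
  define V where "V \<tau>0 a = (\<Sum>\<tau>\<in>PiE E (\<lambda>_. A). smult (K (\<beta> \<tau>0) \<tau> * cnt \<tau> a) (monom 1 (\<Omega> \<tau> - \<Omega> \<tau>0)))" for \<tau>0 a
  have finPi: "finite (PiE E (\<lambda>_. A))" using A E by (intro finite_PiE) auto
  have Vu: "(\<Sum>a\<in>A. poly (V \<tau>0 a) t * u a)
      = (\<Sum>\<tau>\<in>PiE E (\<lambda>_. A). K (\<beta> \<tau>0) \<tau> * t ^ (\<Omega> \<tau> - \<Omega> \<tau>0) * (\<Sum>i\<in>E. u (\<tau> i)))" for \<tau>0 t u
  proof -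
    have "(\<Sum>a\<in>A. poly (V \<tau>0 a) t * u a)
      = (\<Sum>\<tau>\<in>PiE E (\<lambda>_. A). \<Sum>a\<in>A. K (\<beta> \<tau>0) \<tau> * t ^ (\<Omega> \<tau> - \<Omega> \<tau>0) * (cnt \<tau> a * u a))"
      by (subst sum.swap) (simp add: V_def poly_sum poly_monom sum_distrib_right sum_distrib_left mult_ac)
    then show ?thesis by (simp add: cnt flip: sum_distrib_left)
  qed
  have "\<exists>p. p \<noteq> 0 \<and> (\<forall>t. poly p t \<noteq> 0 \<longrightarrow>
    (\<forall>u. (\<forall>\<tau>0\<in>T. (\<Sum>a\<in>A. poly (V \<tau>0 a) t * u a) = 0) \<longrightarrow> (\<forall>a\<in>A. u a = 0)))"
  proof (rule injective_specialization[OF A])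
    fix u assume u: "\<And>\<tau>0. \<tau>0 \<in> T \<Longrightarrow> (\<Sum>a\<in>A. poly (V \<tau>0 a) 0 * u a) = 0"
    show "\<forall>a\<in>A. u a = 0"
    proof (rule inj)
      fix \<tau>0 assume \<tau>0: "\<tau>0 \<in> T"
      have "(\<Sum>a\<in>A. poly (V \<tau>0 a) 0 * u a)
          = (\<Sum>\<tau>\<in>PiE E (\<lambda>_. A). if \<tau> = \<tau>0 then K (\<beta> \<tau>0) \<tau>0 * (\<Sum>i\<in>E. u (\<tau>0 i)) else 0)"
        unfolding Vu
      proof (intro sum.cong refl)
        fix \<tau> assume \<tau>: "\<tau> \<in> PiE E (\<lambda>_. A)"
        have "K (\<beta> \<tau>0) \<tau> = 0 \<or> \<tau> = \<tau>0 \<or> \<Omega> \<tau>0 < \<Omega> \<tau>"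
          using lowest[OF \<tau>0 \<tau>] by (auto simp: \<Omega>_def)
        then show "K (\<beta> \<tau>0) \<tau> * 0 ^ (\<Omega> \<tau> - \<Omega> \<tau>0) * (\<Sum>i\<in>E. u (\<tau> i))
            = (if \<tau> = \<tau>0 then K (\<beta> \<tau>0) \<tau>0 * (\<Sum>i\<in>E. u (\<tau>0 i)) else 0)"
          by (elim disjE) (auto simp: power_0_left)
      qed
      also have "\<dots> = K (\<beta> \<tau>0) \<tau>0 * (\<Sum>i\<in>E. u (\<tau>0 i))"
        using finPi T(1) \<tau>0 by (auto simp: subset_iff)
      finally show "(\<Sum>i\<in>E. u (\<tau>0 i)) = 0" using u[OF \<tau>0] T(3)[OF \<tau>0] by simp
    qed
  qed
  then obtain p where p: "p \<noteq> 0" "\<And>t u. poly p t \<noteq> 0 \<Longrightarrow>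
    (\<And>\<tau>0. \<tau>0 \<in> T \<Longrightarrow> (\<Sum>a\<in>A. poly (V \<tau>0 a) t * u a) = 0) \<Longrightarrow> (\<forall>a\<in>A. u a = 0)"
    by blast
  \<comment> \<open>A nonzero \<open>t\<close> keeps all coordinates of the point nonzero and allows
    the power \<open>t ^ \<Omega> \<tau>0\<close> to be cancelled.\<close>
  obtain t where t: "t \<noteq> 0" "poly p t \<noteq> 0"
    using poly_zero_if_zero_away_from_0[of p] p(1) by blast
  show ?thesis
  proof (intro exI[of _ "\<lambda>a. t ^ \<omega> a"] conjI allI impI)
    show "t ^ \<omega> a \<noteq> 0" for a using t(1) by simp
    fix u assume u: "\<forall>b\<in>B. log_derivative E A K (\<lambda>a. t ^ \<omega> a) b u = 0"
    show "\<forall>a\<in>A. u a = 0"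
    proof (rule p(2)[OF t(2)])
      fix \<tau>0 assume \<tau>0: "\<tau>0 \<in> T"
      have "t ^ \<Omega> \<tau>0 * (\<Sum>a\<in>A. poly (V \<tau>0 a) t * u a) = log_derivative E A K (\<lambda>a. t ^ \<omega> a) (\<beta> \<tau>0) u"
        unfolding Vu log_derivative_def sum_distrib_left[of "t ^ \<Omega> \<tau>0"]
      proof (intro sum.cong refl)
        fix \<tau> assume \<tau>: "\<tau> \<in> PiE E (\<lambda>_. A)"
        have "K (\<beta> \<tau>0) \<tau> = 0 \<or> \<Omega> \<tau>0 \<le> \<Omega> \<tau>"
          using lowest[OF \<tau>0 \<tau>] by (cases "\<tau> = \<tau>0") (auto simp: \<Omega>_def)
        moreover have "t ^ \<Omega> \<tau>0 * t ^ (\<Omega> \<tau> - \<Omega> \<tau>0) = t ^ \<Omega> \<tau>" if "\<Omega> \<tau>0 \<le> \<Omega> \<tau>"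
          using that by (simp flip: power_add)
        moreover have "(\<Prod>i\<in>E. t ^ \<omega> (\<tau> i)) = t ^ \<Omega> \<tau>" by (simp add: \<Omega>_def power_sum)
        ultimately show "t ^ \<Omega> \<tau>0 * (K (\<beta> \<tau>0) \<tau> * t ^ (\<Omega> \<tau> - \<Omega> \<tau>0) * (\<Sum>i\<in>E. u (\<tau> i)))
            = K (\<beta> \<tau>0) \<tau> * (\<Prod>i\<in>E. t ^ \<omega> (\<tau> i)) * (\<Sum>i\<in>E. u (\<tau> i))"
          by (auto simp: mult_ac)
      qed
      then show "(\<Sum>a\<in>A. poly (V \<tau>0 a) t * u a) = 0"
        using u T(2)[OF \<tau>0] t(1) by simp
    qed
  qed
qed

section \<open>Coefficients of the Hessian\<close>

lemma partial_superset:
  assumes "finite S" "keys f \<subseteq> S"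
  shows "partial i f = (\<Sum>m\<in>S. Poly_Mapping.single (m - Poly_Mapping.single i 1) (of_nat (lookup m i) * lookup f m))"
  unfolding partial_def using assms by (intro sum.mono_neutral_left) (auto simp: in_keys_iff)

lemma partial_add: "partial i (f + g) = partial i f + partial i g"
proof -
  let ?S = "keys f \<union> keys g"
  have "keys (f + g) \<subseteq> ?S" by (rule Poly_Mapping.keys_add)
  then show ?thesis
    by (simp add: partial_superset[of ?S] lookup_add distrib_left single_add sum.distrib)
qed

lemma partial_zero [simp]: "partial i 0 = 0"
  by (simp add: partial_def)

lemma partial_sum: "partial i (\<Sum>a\<in>A. f a) = (\<Sum>a\<in>A. partial i (f a))"
  by (induction A rule: infinite_finite_induct) (simp_all add: partial_add)

lemma partial_single:
  "partial i (Poly_Mapping.single m c) = Poly_Mapping.single (m - Poly_Mapping.single i 1) (of_nat (lookup m i) * c)"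
  by (subst partial_superset[of "{m}"]) auto

lemma partial_partial:
  fixes f :: "('v, 'a::comm_ring_1) mpol"
  assumes "finite A" "keys f \<subseteq> A"
  shows "partial i (partial j f) = (\<Sum>a\<in>A. Poly_Mapping.single (a - Poly_Mapping.single j 1 - Poly_Mapping.single i 1)
    (of_nat (lookup (a - Poly_Mapping.single j 1) i) * (of_nat (lookup a j) * lookup f a)))"
  by (simp add: partial_superset[OF assms, of j] partial_sum partial_single)

lemma prod_single:
  fixes c :: "'i \<Rightarrow> 'a::comm_ring_1" and m :: "'i \<Rightarrow> 'v pp"
  shows "finite E \<Longrightarrow> (\<Prod>i\<in>E. Poly_Mapping.single (m i) (c i)) = Poly_Mapping.single (\<Sum>i\<in>E. m i) (\<Prod>i\<in>E. c i)"
  by (induction E rule: finite_induct) (simp_all add: mult_single)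

definition idx :: "nat \<Rightarrow> nat set" where
  "idx r = {0..<r + 1}"

lemma finite_idx [simp]: "finite (idx r)"
  by (simp add: idx_def)

lemma mem_idx: "i \<in> idx r \<longleftrightarrow> i \<le> r"
  by (auto simp: idx_def)

lemma card_idx [simp]: "card (idx r) = r + 1"
  by (simp add: idx_def)

text \<open>
  The coefficient of the monomial \<open>\<Prod>\<^sub>i \<partial>\<^sub>i \<partial>\<^bsub>p i\<^esub> x\<^bsup>\<tau> i\<^esup>\<close>. Its exponent is \<open>\<Sum>\<^sub>i \<tau> i - 2 (1, \<dots>, 1)\<close> for every
  permutation \<open>p\<close>, so the signed sum over \<open>p\<close> collects like terms.
\<close>

definition hess_term :: "nat \<Rightarrow> (nat \<Rightarrow> nat) \<Rightarrow> (nat \<Rightarrow> nat pp) \<Rightarrow> 'k::comm_ring_1" where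
  "hess_term r p \<tau> = (\<Prod>i\<in>idx r. of_nat (lookup (\<tau> i - Poly_Mapping.single (p i) 1) i) * of_nat (lookup (\<tau> i) (p i)))"

definition hess_coeff :: "nat \<Rightarrow> (nat \<Rightarrow> nat pp) \<Rightarrow> 'k::comm_ring_1" where
  "hess_coeff r \<tau> = (\<Sum>p\<in>{p. p permutes idx r}. signof p * hess_term r p \<tau>)"

definition ones :: "nat \<Rightarrow> nat pp" where
  "ones r = (\<Sum>i\<in>idx r. Poly_Mapping.single i 1)"

lemma hess_term_zero:
  assumes "i \<in> idx r" "lookup (\<tau> i) (p i) = 0 \<or> lookup (\<tau> i - Poly_Mapping.single (p i) 1) i = 0"
  shows "hess_term r p \<tau> = (0 :: 'k::comm_ring_1)"
  unfolding hess_term_def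
proof (rule prod_zero)
  have "(of_nat (lookup (\<tau> i - Poly_Mapping.single (p i) 1) i) * of_nat (lookup (\<tau> i) (p i)) :: 'k) = 0"
    using assms(2) by auto
  then show "\<exists>i\<in>idx r. (of_nat (lookup (\<tau> i - Poly_Mapping.single (p i) 1) i) * of_nat (lookup (\<tau> i) (p i)) :: 'k) = 0"
    using assms(1) by (rule bexI)
qed simp

text \<open>In a nonzero term every monomial contains the variables by which it is differentiated,
  so no subtraction truncates. The unit vectors at \<open>p i\<close> add up to
  \<open>ones r\<close> because \<open>p\<close> is a permutation.\<close>

lemma hess_term_nonzero_sum:
  fixes \<tau> :: "nat \<Rightarrow> nat pp"
  assumes "hess_term r p \<tau> \<noteq> (0 :: 'k::comm_ring_1)" "p permutes idx r"
  shows "(\<Sum>i\<in>idx r. \<tau> i)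
    = (\<Sum>i\<in>idx r. \<tau> i - Poly_Mapping.single (p i) 1 - Poly_Mapping.single i 1) + ones r + ones r"
proof -
  have eq: "\<tau> i = \<tau> i - Poly_Mapping.single (p i) 1 - Poly_Mapping.single i 1 + Poly_Mapping.single (p i) 1 + Poly_Mapping.single i 1"
    if "i \<in> idx r" for i
  proof -
    have nz: "lookup (\<tau> i - Poly_Mapping.single (p i) 1) i \<noteq> 0" "lookup (\<tau> i) (p i) \<noteq> 0"
      using hess_term_zero[OF that, of \<tau> p, where 'k = 'k] assms(1) by metis+
    show ?thesis
    proof (rule poly_mapping_eqI)
      fix k
      show "lookup (\<tau> i) k = lookup (\<tau> i - Poly_Mapping.single (p i) 1 - Poly_Mapping.single i 1
          + Poly_Mapping.single (p i) 1 + Poly_Mapping.single i 1) k"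
        using nz by (cases "p i = i"; cases "k = i"; cases "k = p i")
          (simp_all add: lookup_add lookup_minus lookup_single when_def)
    qed
  qed
  have "(\<Sum>i\<in>idx r. \<tau> i) = (\<Sum>i\<in>idx r. \<tau> i - Poly_Mapping.single (p i) 1 - Poly_Mapping.single i 1
      + Poly_Mapping.single (p i) 1 + Poly_Mapping.single i 1)"
    by (rule sum.cong[OF refl eq])
  also have "\<dots> = (\<Sum>i\<in>idx r. \<tau> i - Poly_Mapping.single (p i) 1 - Poly_Mapping.single i 1)
      + (\<Sum>i\<in>idx r. Poly_Mapping.single (p i) 1) + ones r"
    by (simp only: sum.distrib ones_def)
  also have "(\<Sum>i\<in>idx r. Poly_Mapping.single (p i) (1::nat)) = ones r"
    using sum.permute[OF assms(2), of "\<lambda>i. Poly_Mapping.single i (1::nat)"] by (simp add: ones_def comp_def)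
  finally show ?thesis .
qed

lemma lookup_sign_mult:
  fixes F :: "('v, 'a::comm_ring_1) mpol"
  shows "lookup (signof p * F) m = signof p * lookup F m"
  by (simp add: sign_def)

text \<open>Multiplying out the Leibniz formula gives a term for each choice \<open>\<tau>\<close>
  of one monomial per row. The exponent condition does not depend on the permutation, so the signed
  sum over permutations can be taken first. The result has the shape needed for
  \<open>log_derivative\<close>.\<close>

lemma lookup_hess:
  fixes f :: "(nat, 'a::comm_ring_1) mpol"
  assumes A: "finite A" "keys f \<subseteq> A"
  shows "lookup (hess r f) m = (\<Sum>\<tau>\<in>PiE (idx r) (\<lambda>_. A).
    (if (\<Sum>i\<in>idx r. \<tau> i) = m + ones r + ones r then hess_coeff r \<tau> else 0) * (\<Prod>i\<in>idx r. lookup f (\<tau> i)))"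
proof -
  let ?E = "idx r" and ?S = "{p. p permutes idx r}"
  let ?s = "\<lambda>p \<tau>. \<Sum>i\<in>?E. \<tau> i - Poly_Mapping.single (p i) 1 - Poly_Mapping.single i 1"
  have pr: "(\<Prod>i\<in>?E. partial i (partial (p i) f))
      = (\<Sum>\<tau>\<in>PiE ?E (\<lambda>_. A). Poly_Mapping.single (?s p \<tau>) (hess_term r p \<tau> * (\<Prod>i\<in>?E. lookup f (\<tau> i))))" for p
  proof -
    have "(\<Prod>i\<in>?E. partial i (partial (p i) f)) = (\<Sum>\<tau>\<in>PiE ?E (\<lambda>_. A). \<Prod>i\<in>?E.
        Poly_Mapping.single (\<tau> i - Poly_Mapping.single (p i) 1 - Poly_Mapping.single i 1)
          (of_nat (lookup (\<tau> i - Poly_Mapping.single (p i) 1) i) * (of_nat (lookup (\<tau> i) (p i)) * lookup f (\<tau> i))))"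
      unfolding partial_partial[OF A] by (rule prod_sum_PiE) (use A in auto)
    then show ?thesis
      by (simp only: prod_single[OF finite_idx] hess_term_def prod.distrib mult.assoc)
  qed
  have "hess r f = (\<Sum>p\<in>?S. signof p * (\<Prod>i\<in>?E. partial i (partial (p i) f)))"
    unfolding hess_def det_def idx_def
    by (auto intro!: sum.cong prod.cong arg_cong2[where f = "(*)"] dest: permutes_in_image)
  then have "lookup (hess r f) m = (\<Sum>p\<in>?S. signof p * (\<Sum>\<tau>\<in>PiE ?E (\<lambda>_. A).
      (hess_term r p \<tau> * (\<Prod>i\<in>?E. lookup f (\<tau> i)) when ?s p \<tau> = m)))"
    by (simp only: lookup_sum lookup_sign_mult pr lookup_single)
  also have "\<dots> = (\<Sum>\<tau>\<in>PiE ?E (\<lambda>_. A). \<Sum>p\<in>?S. signof p *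
      (hess_term r p \<tau> * (\<Prod>i\<in>?E. lookup f (\<tau> i)) when ?s p \<tau> = m))"
    by (simp only: sum_distrib_left) (rule sum.swap)
  also have "\<dots> = (\<Sum>\<tau>\<in>PiE ?E (\<lambda>_. A). \<Sum>p\<in>?S. (if (\<Sum>i\<in>?E. \<tau> i) = m + ones r + ones r then signof p * hess_term r p \<tau> else 0)
      * (\<Prod>i\<in>?E. lookup f (\<tau> i)))"
  proof (intro sum.cong refl)
    fix \<tau> p assume "p \<in> ?S"
    then have p: "p permutes ?E" by simp
    show "signof p * (hess_term r p \<tau> * (\<Prod>i\<in>?E. lookup f (\<tau> i)) when ?s p \<tau> = m)
      = (if (\<Sum>i\<in>?E. \<tau> i) = m + ones r + ones r then signof p * hess_term r p \<tau> else 0) * (\<Prod>i\<in>?E. lookup f (\<tau> i))"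
    proof (cases "hess_term r p \<tau> = (0 :: 'a)")
      case True then show ?thesis by (simp only: mult_zero_left mult_zero_right when_def if_cancel)
    next
      case False
      have "?s p \<tau> = m \<longleftrightarrow> (\<Sum>i\<in>?E. \<tau> i) = m + ones r + ones r"
        unfolding hess_term_nonzero_sum[OF False p] by (simp only: add_right_cancel)
      then show ?thesis by (simp only: when_def mult.assoc mult_zero_left mult_zero_right split: if_split) simp
    qed
  qed
  also have "\<dots> = (\<Sum>\<tau>\<in>PiE ?E (\<lambda>_. A). (if (\<Sum>i\<in>?E. \<tau> i) = m + ones r + ones r then hess_coeff r \<tau> else 0)
      * (\<Prod>i\<in>?E. lookup f (\<tau> i)))"
    by (intro sum.cong refl) (simp add: hess_coeff_def sum_distrib_right)
  finally show ?thesis .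
qed

lemma hess_coeff_nonzero_term:
  assumes "hess_coeff r \<tau> \<noteq> (0 :: 'k::comm_ring_1)"
  obtains p where "p permutes idx r" "hess_term r p \<tau> \<noteq> (0 :: 'k)"
  using assms unfolding hess_coeff_def
  by (metis (mono_tags, lifting) mem_Collect_eq mult_zero_right sum.not_neutral_contains_not_neutral)

lemma hess_coeff_nonzero_diag:
  assumes "hess_coeff r \<tau> \<noteq> (0 :: 'k::comm_ring_1)" "i \<in> idx r"
  shows "lookup (\<tau> i) i > 0"
proof -
  obtain p where "hess_term r p \<tau> \<noteq> (0 :: 'k)" using assms(1) by (rule hess_coeff_nonzero_term)
  then have "lookup (\<tau> i - Poly_Mapping.single (p i) 1) i \<noteq> 0"
    using hess_term_zero[OF assms(2), of \<tau> p, where 'k = 'k] by blast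
  then show ?thesis by (simp add: lookup_minus)
qed

text \<open>The derivative of a pure power of the variable \<open>i\<close> with respect to any
  other variable is zero, so a permutation that moves an index outside \<open>S\<close> contributes
  nothing.\<close>

lemma hess_coeff_sub:
  fixes \<tau> :: "nat \<Rightarrow> nat pp"
  assumes S: "S \<subseteq> idx r" and \<tau>: "\<And>i. i \<in> idx r - S \<Longrightarrow> \<tau> i = Poly_Mapping.single i d"
  shows "hess_coeff r \<tau> = (\<Sum>p\<in>{p. p permutes S}. signof p * hess_term r p \<tau> :: 'k::comm_ring_1)"
  unfolding hess_coeff_def
proof (rule sum.mono_neutral_right)
  show "{p. p permutes S} \<subseteq> {p. p permutes idx r}" using S permutes_subset by blast
  show "\<forall>p\<in>{p. p permutes idx r} - {p. p permutes S}. signof p * hess_term r p \<tau> = (0 :: 'k)"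
  proof
    fix p assume "p \<in> {p. p permutes idx r} - {p. p permutes S}"
    then have p: "p permutes idx r" "\<not> p permutes S" by auto
    then obtain i where i: "i \<in> idx r - S" "p i \<noteq> i" using permutes_superset by blast
    then have "hess_term r p \<tau> = (0 :: 'k)"
      using \<tau>[OF i(1)] by (intro hess_term_zero[of i]) (auto simp: lookup_single)
    then show "signof p * hess_term r p \<tau> = (0 :: 'k)" by simp
  qed
qed (simp add: finite_permutations)

section \<open>Coefficients with a unique term of lowest order\<close>

text \<open>The pure powers, one in each row. The restriction makes the tuple a member of the
  extensional product \<open>PiE\<close>.\<close>

definition fermat :: "nat \<Rightarrow> nat \<Rightarrow> nat \<Rightarrow> nat pp" where
  "fermat d r = (\<lambda>i\<in>idx r. Poly_Mapping.single i d)"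

definition squarefree_pp :: "nat pp \<Rightarrow> bool" where
  "squarefree_pp \<alpha> \<longleftrightarrow> (\<forall>i. lookup \<alpha> i \<le> 1)"

definition weight :: "nat \<Rightarrow> nat pp \<Rightarrow> nat" where
  "weight d \<alpha> = (if \<exists>i. \<alpha> = Poly_Mapping.single i d then 0 else if squarefree_pp \<alpha> then 1 else 2)"

lemma fermat_apply: "i \<in> idx r \<Longrightarrow> fermat d r i = Poly_Mapping.single i d"
  by (simp add: fermat_def)

lemma weight_single [simp]: "weight d (Poly_Mapping.single i d) = 0"
  by (auto simp: weight_def)

lemma weight_le: "weight d \<alpha> \<le> 2"
  by (simp add: weight_def)

lemma weight_eq_1: "weight d \<alpha> = 1 \<Longrightarrow> squarefree_pp \<alpha>"
  by (simp add: weight_def split: if_split_asm)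

lemma pps_eq_single:
  assumes "\<alpha> \<in> pps I d" "lookup \<alpha> l \<ge> d" "d > 0"
  shows "\<alpha> = Poly_Mapping.single l d"
proof (rule poly_mapping_eqI)
  fix k
  have l: "l \<in> keys \<alpha>" using assms(2,3) by (simp add: in_keys_iff)
  have "d = lookup \<alpha> l + sum (lookup \<alpha>) (keys \<alpha> - {l})"
    using assms(1) l by (simp add: pps_def pp_deg_def sum.remove)
  then have "lookup \<alpha> l = d" "sum (lookup \<alpha>) (keys \<alpha> - {l}) = 0" using assms(2) by auto
  then have "keys \<alpha> \<subseteq> {l}" by (auto simp: in_keys_iff)
  then have "lookup \<alpha> k = 0" if "k \<noteq> l" using that by (auto simp: in_keys_iff)
  then show "lookup \<alpha> k = lookup (Poly_Mapping.single l d) k"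
    using \<open>lookup \<alpha> l = d\<close> by (auto simp: lookup_single when_def)
qed

text \<open>Only the identity contributes, and a row with diagonal exponent \<open>a\<close> gives
  it the factor \<open>(a - 1) * a\<close>.\<close>

lemma hess_coeff_one:
  fixes \<tau> :: "nat \<Rightarrow> nat pp"
  assumes l: "l \<in> idx r" and \<tau>: "\<And>i. i \<in> idx r - {l} \<Longrightarrow> \<tau> i = Poly_Mapping.single i d"
    and d: "d \<ge> 2"
  shows "hess_coeff r \<tau> \<noteq> (0 :: 'k::field_char_0) \<longleftrightarrow> lookup (\<tau> l) l \<ge> 2"
proof -
  have "hess_coeff r \<tau> = (hess_term r id \<tau> :: 'k)"
    using hess_coeff_sub[of "{l}" r \<tau> d] l \<tau> by simp
  also have "\<dots> \<noteq> 0 \<longleftrightarrow> (\<forall>i\<in>idx r. lookup (\<tau> i) i \<ge> 2)"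
    by (fastforce simp: hess_term_def lookup_minus)
  also have "\<dots> \<longleftrightarrow> lookup (\<tau> l) l \<ge> 2"
    using l \<tau> d by (metis Diff_iff lookup_single_eq singletonD)
  finally show ?thesis .
qed

text \<open>Only the identity and the transposition can contribute. The identity does not, as the
  variable \<open>l\<close> occurs just once in row \<open>l\<close>, whereas the mixed derivatives
  of the transposition survive.\<close>

lemma hess_coeff_two:
  fixes \<tau> :: "nat \<Rightarrow> nat pp"
  assumes l: "l \<in> idx r" "l' \<in> idx r" "l \<noteq> l'"
    and \<tau>: "\<And>i. i \<in> idx r - {l, l'} \<Longrightarrow> \<tau> i = Poly_Mapping.single i d"
    and d: "d \<ge> 2"
    and one: "lookup (\<tau> l) l = 1" "lookup (\<tau> l) l' = 1" "lookup (\<tau> l') l = 1" "lookup (\<tau> l') l' = 1"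
  shows "hess_coeff r \<tau> \<noteq> (0 :: 'k::field_char_0)"
proof -
  let ?t = "Transposition.transpose l l'"
  have ne: "?t \<noteq> id" using l(3) by (metis id_apply transpose_apply_first)
  have "{p. p permutes {l, l'}} = {id, ?t}" by (auto simp: permutes_doubleton_iff)
  then have "hess_coeff r \<tau> = (hess_term r id \<tau> - hess_term r ?t \<tau> :: 'k)"
    using hess_coeff_sub[of "{l, l'}" r \<tau> d] l \<tau> ne by (simp add: sign_swap_id)
  moreover have "hess_term r id \<tau> = (0 :: 'k)"
    using l(1) one(1) by (intro hess_term_zero[of l]) (auto simp: lookup_minus)
  moreover have "hess_term r ?t \<tau> \<noteq> (0 :: 'k)"
    unfolding hess_term_def
  proof (subst prod_zero_iff, simp, rule notI, elim bexE)
    fix i assume i: "i \<in> idx r"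
      and z: "of_nat (lookup (\<tau> i - Poly_Mapping.single (?t i) 1) i) * of_nat (lookup (\<tau> i) (?t i)) = (0 :: 'k)"
    consider "i = l" | "i = l'" | "i \<notin> {l, l'}" by blast
    then show False
    proof cases
      case 1
      then show False using z one l(3) by (simp add: lookup_minus lookup_single when_def)
    next
      case 2
      then show False using z one l(3) by (simp add: lookup_minus lookup_single when_def)
    next
      case 3
      then have "?t i = i" by (simp add: transpose_apply_other)
      moreover have "\<tau> i = Poly_Mapping.single i d" using \<tau> i 3 by blast
      ultimately show False using z d by (simp add: lookup_minus lookup_single)
    qed
  qed
  ultimately show ?thesis by simp
qed

text \<open>The tuples behind the two families of linear forms. In the second family both rows carry
  the same monomial, so that the tuple can be recovered from its sum.\<close>

definition rows :: "nat \<Rightarrow> nat \<Rightarrow> (nat \<Rightarrow> nat pp) set" where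
  "rows d r = {(fermat d r)(l := \<alpha>) |l \<alpha>. l \<in> idx r \<and> \<alpha> \<in> pps {0..r} d \<and> 2 \<le> lookup \<alpha> l}
     \<union> {(fermat d r)(l := I, l' := I) |l l' I. l \<in> idx r \<and> l' \<in> idx r \<and> l \<noteq> l'
          \<and> I \<in> pps {0..r} d \<and> squarefree_pp I \<and> lookup I l = 1 \<and> lookup I l' = 1}"

lemma single_in_pps: "i \<in> idx r \<Longrightarrow> Poly_Mapping.single i d \<in> pps {0..r} d"
  by (auto simp: pps_def mem_idx)

lemma fermat_in: "fermat d r \<in> PiE (idx r) (\<lambda>_. pps {0..r} d)"
  by (auto simp: fermat_def single_in_pps)

lemma update_in_PiE: "\<tau> \<in> PiE E (\<lambda>_. A) \<Longrightarrow> l \<in> E \<Longrightarrow> a \<in> A \<Longrightarrow> \<tau>(l := a) \<in> PiE E (\<lambda>_. A)"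
  by (auto simp: PiE_iff extensional_def)

lemma rows_subset: "rows d r \<subseteq> PiE (idx r) (\<lambda>_. pps {0..r} d)"
  unfolding rows_def using fermat_in[of d r] by (fastforce intro: update_in_PiE)

lemma hess_coeff_rows:
  assumes "d \<ge> 2" "\<tau> \<in> rows d r"
  shows "hess_coeff r \<tau> \<noteq> (0 :: 'k::field_char_0)"
  using assms(2) unfolding rows_def
proof (elim UnE CollectE exE conjE)
  fix l \<alpha> assume "\<tau> = (fermat d r)(l := \<alpha>)" "l \<in> idx r" "2 \<le> lookup \<alpha> l"
  then show ?thesis using assms(1) hess_coeff_one[of l r \<tau> d, where 'k = 'k] by (simp add: fermat_apply)
next
  fix l l' I assume "\<tau> = (fermat d r)(l := I, l' := I)" "l \<in> idx r" "l' \<in> idx r" "l \<noteq> l'"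
    "lookup I l = 1" "lookup I l' = 1"
  then show ?thesis using assms(1) by (intro hess_coeff_two[of l r l' \<tau> d]) (auto simp: fermat_apply)
qed

text \<open>Stated without subtraction, so that it serves for weights, exponents, power products and
  values of \<open>u\<close> alike.\<close>

lemma sum_fermat_one:
  assumes "l \<in> idx r" "\<tau> = (fermat d r)(l := \<alpha>)"
  shows "(\<Sum>i\<in>idx r. f (\<tau> i)) + f (Poly_Mapping.single l d)
    = (\<Sum>i\<in>idx r. f (Poly_Mapping.single i d)) + (f \<alpha> :: 'c::comm_monoid_add)"
proof -
  have "(\<Sum>i\<in>idx r - {l}. f (\<tau> i)) = (\<Sum>i\<in>idx r - {l}. f (Poly_Mapping.single i d))"
    using assms(2) by (intro sum.cong) (auto simp: fermat_apply)
  then show ?thesis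
    unfolding sum.remove[OF finite_idx assms(1)] using assms(2) by (simp add: ac_simps)
qed

lemma sum_fermat_two:
  assumes "l \<in> idx r" "l' \<in> idx r" "l \<noteq> l'" "\<tau> = (fermat d r)(l := \<alpha>, l' := \<beta>)"
  shows "(\<Sum>i\<in>idx r. f (\<tau> i)) + (f (Poly_Mapping.single l d) + f (Poly_Mapping.single l' d))
    = (\<Sum>i\<in>idx r. f (Poly_Mapping.single i d)) + (f \<alpha> + f \<beta> :: 'c::comm_monoid_add)"
proof -
  have l': "l' \<in> idx r - {l}" using assms by simp
  have "(\<Sum>i\<in>idx r - {l} - {l'}. f (\<tau> i)) = (\<Sum>i\<in>idx r - {l} - {l'}. f (Poly_Mapping.single i d))"
    using assms(4) by (intro sum.cong) (auto simp: fermat_apply)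
  then show ?thesis
    unfolding sum.remove[OF finite_idx assms(1)] sum.remove[OF finite_Diff[OF finite_idx] l']
    using assms(3,4) by (simp add: ac_simps)
qed

lemma weight_rows:
  assumes "\<tau> \<in> rows d r" shows "(\<Sum>i\<in>idx r. weight d (\<tau> i)) \<le> 2"
  using assms unfolding rows_def
proof (elim UnE CollectE exE conjE)
  fix l \<alpha> assume "\<tau> = (fermat d r)(l := \<alpha>)" "l \<in> idx r"
  then show ?thesis using sum_fermat_one[of l r \<tau> d \<alpha> "weight d"] weight_le[of d \<alpha>] by simp
next
  fix l l' I assume *: "\<tau> = (fermat d r)(l := I, l' := I)" "l \<in> idx r" "l' \<in> idx r" "l \<noteq> l'" "squarefree_pp I"
  have "weight d I \<le> 1" using *(5) by (simp add: weight_def)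
  then show ?thesis using sum_fermat_two[OF *(2,3,4,1), of "weight d"] by simp
qed

text \<open>At most two rows have nonzero weight. A row of weight \<open>0\<close> is a pure power,
  and the positive diagonal exponent forces it to be the right one. Two rows of nonzero weight have
  weight \<open>1\<close> each and are therefore squarefree.\<close>

lemma low_weight_cases:
  fixes \<tau> :: "nat \<Rightarrow> nat pp"
  assumes d: "d \<ge> 3" and \<tau>: "\<tau> \<in> PiE (idx r) (\<lambda>_. pps {0..r} d)"
    and nz: "hess_coeff r \<tau> \<noteq> (0 :: 'k::field_char_0)"
    and wt: "(\<Sum>i\<in>idx r. weight d (\<tau> i)) \<le> 2"
  obtains (one) l \<alpha> where "l \<in> idx r" "\<alpha> \<in> pps {0..r} d" "\<tau> = (fermat d r)(l := \<alpha>)"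
  | (two) l l' I J where "l \<in> idx r" "l' \<in> idx r" "l \<noteq> l'" "squarefree_pp I" "squarefree_pp J"
      "\<tau> = (fermat d r)(l := I, l' := J)"
proof -
  let ?E = "idx r"
  define N where "N = {i \<in> ?E. weight d (\<tau> i) \<noteq> 0}"
  have finN: "finite N" by (simp add: N_def)
  have F: "\<tau> i = fermat d r i" if "i \<notin> N" for i
  proof (cases "i \<in> ?E")
    case True
    then have "weight d (\<tau> i) = 0" using that by (simp add: N_def)
    then obtain j where j: "\<tau> i = Poly_Mapping.single j d" by (auto simp: weight_def split: if_splits)
    have "j = i" using hess_coeff_nonzero_diag[OF nz True] by (auto simp: j lookup_single when_def split: if_splits)
    then show ?thesis using j True by (simp add: fermat_apply)
  next
    case False then show ?thesis using \<tau> by (auto simp: fermat_def PiE_iff extensional_def)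
  qed
  have sumN: "(\<Sum>i\<in>N. weight d (\<tau> i)) \<le> 2"
    using wt sum_mono2[of ?E N "\<lambda>i. weight d (\<tau> i)"] by (simp add: N_def)
  have "card N \<le> (\<Sum>i\<in>N. weight d (\<tau> i))"
    using sum_mono[of N "\<lambda>_. 1" "\<lambda>i. weight d (\<tau> i)"] by (auto simp: N_def)
  then have "card N \<le> 2" using sumN by simp
  then consider "card N = 0" | "card N = 1" | "card N = 2" by linarith
  then show ?thesis
  proof cases
    case 1
    \<comment> \<open>The Fermat tuple is put into the first case, with a trivial replacement in row
      \<open>0\<close>.\<close>
    then have "N = {}" using finN by simp
    then have "\<tau> = (fermat d r)(0 := Poly_Mapping.single 0 d)"
      by (intro ext) (simp add: F fermat_apply mem_idx)
    then show ?thesis by (intro one[of 0]) (simp_all add: mem_idx single_in_pps)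
  next
    case 2
    then obtain l where l: "N = {l}" by (auto simp: card_1_singleton_iff)
    then have lE: "l \<in> ?E" by (auto simp: N_def)
    have "\<tau> = (fermat d r)(l := \<tau> l)" by (intro ext) (simp add: F l)
    moreover have "\<tau> l \<in> pps {0..r} d" using \<tau> lE by auto
    ultimately show ?thesis using lE by (intro one[of l "\<tau> l"])
  next
    case 3
    then obtain l l' where l: "N = {l, l'}" "l \<noteq> l'" by (auto simp: card_2_iff)
    then have lE: "l \<in> N" "l' \<in> N" by auto
    have "weight d (\<tau> l) + weight d (\<tau> l') \<le> 2" using sumN l by simp
    moreover have "weight d (\<tau> l) \<noteq> 0" "weight d (\<tau> l') \<noteq> 0" using lE by (auto simp: N_def)
    ultimately have "weight d (\<tau> l) = 1" "weight d (\<tau> l') = 1" by auto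
    then have sq: "squarefree_pp (\<tau> l)" "squarefree_pp (\<tau> l')" by (simp_all only: weight_eq_1)
    have eq: "\<tau> = (fermat d r)(l := \<tau> l, l' := \<tau> l')" by (intro ext) (simp add: F l)
    have "l \<in> ?E" "l' \<in> ?E" using lE by (simp_all add: N_def)
    then show ?thesis using l(2) sq eq by (rule two)
  qed
qed

section \<open>Recovering a tuple from the sum of its entries\<close>

lemma sum_lookup_fermat:
  "k \<in> idx r \<Longrightarrow> (\<Sum>i\<in>idx r. lookup (Poly_Mapping.single i d) k) = d"
  by (simp add: lookup_single when_def eq_commute[of _ k])

text \<open>
  The exponents smaller than \<open>d\<close> in the sum of all entries of \<open>\<tau>\<close> show which entries differ from
  the Fermat tuple.
\<close>

lemma small_exponents_one:
  assumes "l \<in> idx r" "\<tau> = (fermat d r)(l := \<alpha>)" "\<alpha> \<in> pps {0..r} d" "d > 0"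
  shows "{k \<in> idx r. lookup (\<Sum>i\<in>idx r. \<tau> i) k < d}
    = (if \<alpha> = Poly_Mapping.single l d then {} else {l})"
proof -
  have *: "lookup (\<Sum>i\<in>idx r. \<tau> i) k + (if k = l then d else 0) = d + lookup \<alpha> k" if "k \<in> idx r" for k
    using sum_fermat_one[OF assms(1,2), of "\<lambda>m. lookup m k"] sum_lookup_fermat[OF that, of d]
    by (auto simp: lookup_sum lookup_single when_def)
  have "lookup \<alpha> l < d \<longleftrightarrow> \<alpha> \<noteq> Poly_Mapping.single l d"
    using pps_eq_single[OF assms(3) _ assms(4), of l] by (auto simp: not_less[symmetric])
  moreover have "lookup (\<Sum>i\<in>idx r. \<tau> i) k < d \<longleftrightarrow> k = l \<and> lookup \<alpha> l < d" if "k \<in> idx r" for k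
    using *[OF that] by (auto split: if_splits)
  ultimately show ?thesis using assms(1) by auto
qed

lemma small_exponents_two:
  assumes "l \<in> idx r" "l' \<in> idx r" "l \<noteq> l'" "\<tau> = (fermat d r)(l := I, l' := J)"
    "squarefree_pp I" "squarefree_pp J" "d \<ge> 3"
  shows "{k \<in> idx r. lookup (\<Sum>i\<in>idx r. \<tau> i) k < d} = {l, l'}"
proof -
  have *: "lookup (\<Sum>i\<in>idx r. \<tau> i) k + (if k = l \<or> k = l' then d else 0) = d + (lookup I k + lookup J k)"
    if "k \<in> idx r" for k
    using sum_fermat_two[OF assms(1-4), of "\<lambda>m. lookup m k"] sum_lookup_fermat[OF that, of d] assms(3)
    by (auto simp: lookup_sum lookup_single when_def)
  \<comment> \<open>Two squarefree monomials contribute at most \<open>2\<close> to an exponent, and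
    \<open>d \<ge> 3\<close>.\<close>
  have "lookup I k + lookup J k < d" for k
    using assms(5,6,7) unfolding squarefree_pp_def by (metis add_mono le_trans not_less numeral_3_eq_3 one_add_one not_less_eq_eq numeral_2_eq_2)
  then have "lookup (\<Sum>i\<in>idx r. \<tau> i) k < d \<longleftrightarrow> k \<in> {l, l'}" if "k \<in> idx r" for k
    using *[OF that] by (auto split: if_splits)
  then show ?thesis using assms(1,2) by auto
qed

text \<open>The small exponents of the common sum show which rows were replaced, and cancellation
  then yields the new entries. This gives the uniqueness of the lowest-order term.\<close>

lemma rows_unique:
  fixes \<tau> \<tau>0 :: "nat \<Rightarrow> nat pp"
  assumes d: "d \<ge> 3" and \<tau>: "\<tau> \<in> PiE (idx r) (\<lambda>_. pps {0..r} d)"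
    and nz: "hess_coeff r \<tau> \<noteq> (0 :: 'k::field_char_0)"
    and wt: "(\<Sum>i\<in>idx r. weight d (\<tau> i)) \<le> 2"
    and \<tau>0: "\<tau>0 \<in> rows d r"
    and eq: "(\<Sum>i\<in>idx r. \<tau> i) = (\<Sum>i\<in>idx r. \<tau>0 i)"
  shows "\<tau> = \<tau>0"
proof -
  let ?E = "idx r"
  let ?M = "\<lambda>\<tau>. {k \<in> ?E. lookup (\<Sum>i\<in>?E. \<tau> i) k < d}"
  have M: "?M \<tau> = ?M \<tau>0" by (simp only: eq)
  have dpos: "d > 0" using d by simp
  have F: "(fermat d r)(l := Poly_Mapping.single l d) = fermat d r" if "l \<in> ?E" for l
    using fermat_apply[OF that, of d] by (intro ext) simp
  from d \<tau> nz wt show ?thesis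
  proof (cases rule: low_weight_cases)
    case (one l \<alpha>)
    note M1 = small_exponents_one[OF one(1,3,2) dpos]
    from \<tau>0 show ?thesis unfolding rows_def
    proof (elim UnE CollectE exE conjE)
      fix l0 \<alpha>0 assume a: "\<tau>0 = (fermat d r)(l0 := \<alpha>0)" "l0 \<in> ?E" "\<alpha>0 \<in> pps {0..r} d"
      note M0 = small_exponents_one[OF a(2,1,3) dpos]
      have key: "(if \<alpha> = Poly_Mapping.single l d then {} else {l}) = (if \<alpha>0 = Poly_Mapping.single l0 d then {} else {l0})"
        using M unfolding M1 M0 .
      show ?thesis
      proof (cases "\<alpha>0 = Poly_Mapping.single l0 d")
        case True
        then have "\<alpha> = Poly_Mapping.single l d" using key by (simp split: if_split_asm)
        then show ?thesis unfolding one(3) a(1) True by (simp only: F[OF one(1)] F[OF a(2)])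
      next
        case False
        then have l: "l = l0" using key by (simp split: if_split_asm)
        have "(\<Sum>i\<in>?E. \<tau> i) + Poly_Mapping.single l0 d = (\<Sum>i\<in>?E. Poly_Mapping.single i d) + \<alpha>"
          using sum_fermat_one[OF one(1,3), of "\<lambda>m. m"] unfolding l .
        moreover have "(\<Sum>i\<in>?E. \<tau>0 i) + Poly_Mapping.single l0 d = (\<Sum>i\<in>?E. Poly_Mapping.single i d) + \<alpha>0"
          by (rule sum_fermat_one[OF a(2,1), of "\<lambda>m. m"])
        ultimately have "(\<Sum>i\<in>?E. Poly_Mapping.single i d) + \<alpha> = (\<Sum>i\<in>?E. Poly_Mapping.single i d) + \<alpha>0"
          unfolding eq by (rule trans[OF sym])
        then have "\<alpha> = \<alpha>0" by (rule add_left_imp_eq)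
        then show ?thesis unfolding one(3) a(1) l by simp
      qed
    next
      fix l0 l0' I assume a: "\<tau>0 = (fermat d r)(l0 := I, l0' := I)" "l0 \<in> ?E" "l0' \<in> ?E" "l0 \<noteq> l0'" "squarefree_pp I"
      note M0 = small_exponents_two[OF a(2,3,4,1,5,5) d]
      have "(if \<alpha> = Poly_Mapping.single l d then {} else {l}) = {l0, l0'}" using M unfolding M1 M0 .
      then show ?thesis using a(4) by (simp add: doubleton_eq_iff split: if_split_asm)
    qed
  next
    case (two l l' I J)
    note M1 = small_exponents_two[OF two(1-3,6,4,5) d]
    from \<tau>0 show ?thesis unfolding rows_def
    proof (elim UnE CollectE exE conjE)
      fix l0 \<alpha> assume a: "\<tau>0 = (fermat d r)(l0 := \<alpha>)" "l0 \<in> ?E" "\<alpha> \<in> pps {0..r} d"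
      note M0 = small_exponents_one[OF a(2,1,3) dpos]
      have "{l, l'} = (if \<alpha> = Poly_Mapping.single l0 d then {} else {l0})" using M unfolding M1 M0 .
      then show ?thesis using two(3) by (simp add: doubleton_eq_iff split: if_split_asm)
    next
      fix l0 l0' I0 assume a: "\<tau>0 = (fermat d r)(l0 := I0, l0' := I0)" "l0 \<in> ?E" "l0' \<in> ?E" "l0 \<noteq> l0'" "squarefree_pp I0"
      note M0 = small_exponents_two[OF a(2,3,4,1,5,5) d]
      have ll: "{l, l'} = {l0, l0'}" using M unfolding M1 M0 .
      then have ll: "l = l0 \<and> l' = l0' \<or> l = l0' \<and> l' = l0" by (simp add: doubleton_eq_iff)
      have single: "Poly_Mapping.single l d + Poly_Mapping.single l' d = Poly_Mapping.single l0 d + Poly_Mapping.single l0' d"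
        using ll by (auto simp: add.commute)
      have "(\<Sum>i\<in>?E. \<tau> i) + (Poly_Mapping.single l0 d + Poly_Mapping.single l0' d) = (\<Sum>i\<in>?E. Poly_Mapping.single i d) + (I + J)"
        using sum_fermat_two[OF two(1-3,6), of "\<lambda>m. m"] unfolding single .
      moreover have "(\<Sum>i\<in>?E. \<tau>0 i) + (Poly_Mapping.single l0 d + Poly_Mapping.single l0' d) = (\<Sum>i\<in>?E. Poly_Mapping.single i d) + (I0 + I0)"
        by (rule sum_fermat_two[OF a(2-4,1), of "\<lambda>m. m"])
      ultimately have "(\<Sum>i\<in>?E. Poly_Mapping.single i d) + (I + J) = (\<Sum>i\<in>?E. Poly_Mapping.single i d) + (I0 + I0)"
        unfolding eq by (rule trans[OF sym])
      then have II: "I + J = I0 + I0" by (rule add_left_imp_eq)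
      \<comment> \<open>The two exponents are at most \<open>1\<close> and their sum is
        \<open>0\<close> or \<open>2\<close>, so they are equal.\<close>
      have k: "lookup I k = lookup I0 k \<and> lookup J k = lookup I0 k" for k
      proof -
        have "lookup I k + lookup J k = lookup I0 k + lookup I0 k"
          using arg_cong[OF II, of "\<lambda>m. lookup m k"] by (simp add: lookup_add)
        moreover have "lookup I k \<le> 1" "lookup J k \<le> 1" "lookup I0 k \<le> 1"
          using two(4,5) a(5) by (simp_all add: squarefree_pp_def)
        ultimately show ?thesis by linarith
      qed
      have "I = I0" by (rule poly_mapping_eqI) (simp add: k)
      moreover have "J = I0" by (rule poly_mapping_eqI) (simp add: k)
      ultimately show ?thesis unfolding two(6) a(1) using ll a(4) by (auto simp: fun_upd_twist)
    qed
  qed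
qed

lemma rows_injective:
  fixes u :: "nat pp \<Rightarrow> 'k::field_char_0"
  assumes d: "d \<ge> 3" and r: "r \<ge> 2"
    and u: "\<And>\<tau>. \<tau> \<in> rows d r \<Longrightarrow> (\<Sum>i\<in>idx r. u (\<tau> i)) = 0"
  shows "\<forall>\<alpha>\<in>pps {0..r} d. u \<alpha> = 0"
proof -
  let ?E = "idx r"
  define x where "x i = u (Poly_Mapping.single i d)" for i
  define s where "s = (\<Sum>i\<in>?E. x i)"
  have r1: "s + u \<alpha> = x l" if "l \<in> ?E" "\<alpha> \<in> pps {0..r} d" "2 \<le> lookup \<alpha> l" for l \<alpha>
  proof -
    have "(fermat d r)(l := \<alpha>) \<in> rows d r" using that unfolding rows_def by blast
    then have "(\<Sum>i\<in>idx r. u (((fermat d r)(l := \<alpha>)) i)) = 0" by (rule u)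
    then show ?thesis using sum_fermat_one[OF that(1) refl, of u d \<alpha>] by (simp add: x_def s_def)
  qed
  \<comment> \<open>Replacing a pure power by itself makes \<open>x 0\<close> cancel.\<close>
  have "s = 0"
    using r1[of 0 "Poly_Mapping.single 0 d"] d single_in_pps[of 0 r d] by (simp add: x_def mem_idx)
  have r1: "u \<alpha> = x l" if "l \<in> ?E" "\<alpha> \<in> pps {0..r} d" "2 \<le> lookup \<alpha> l" for l \<alpha>
    using r1[OF that] \<open>s = 0\<close> by simp
  have r2: "u I + u I = x l + x l'"
    if "l \<in> ?E" "l' \<in> ?E" "l \<noteq> l'" "I \<in> pps {0..r} d" "squarefree_pp I" "lookup I l = 1" "lookup I l' = 1" for l l' I
  proof -
    have "(fermat d r)(l := I, l' := I) \<in> rows d r" using that unfolding rows_def by blast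
    then have "(\<Sum>i\<in>?E. u (((fermat d r)(l := I, l' := I)) i)) = 0" by (rule u)
    then show ?thesis using sum_fermat_two[OF that(1-3) refl, of u d I I] \<open>s = 0\<close> by (simp add: x_def s_def)
  qed
  have x_eq: "x l = x l'" if l: "l \<in> ?E" "l' \<in> ?E" "l \<noteq> l'" for l l'
  proof (cases "d = 3")
    case False
    \<comment> \<open>For \<open>d \<ge> 4\<close> this monomial is divisible by both squares, so
      \<open>r1\<close> applies to it with \<open>l\<close> and with \<open>l'\<close>.\<close>
    let ?\<alpha> = "Poly_Mapping.single l 2 + Poly_Mapping.single l' (d - 2)"
    have "?\<alpha> \<in> pps {0..r} (2 + (d - 2))"
      using l by (intro pps_add) (auto simp: pps_def mem_idx)
    moreover have "2 + (d - 2) = d" using d by simp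
    ultimately have \<alpha>: "?\<alpha> \<in> pps {0..r} d" by simp
    have "u ?\<alpha> = x l" using l by (intro r1 \<alpha>) (auto simp: lookup_add lookup_single)
    moreover have "u ?\<alpha> = x l'" using l False d by (intro r1 \<alpha>) (auto simp: lookup_add lookup_single)
    ultimately show ?thesis by simp
  next
    case True
    \<comment> \<open>As \<open>r \<ge> 2\<close> there is a third index \<open>k\<close>. The
      product of the three variables, taken with the pairs \<open>l, k\<close> and
      \<open>l', k\<close>, gives the equality.\<close>
    have "card {l, l'} < card ?E" using r l by simp
    then have "\<not> ?E \<subseteq> {l, l'}" by (meson card_mono finite.emptyI finite.insertI not_less)
    then obtain k where k: "k \<in> ?E" "k \<noteq> l" "k \<noteq> l'" by blast
    let ?I = "Poly_Mapping.single l 1 + Poly_Mapping.single l' 1 + Poly_Mapping.single k (1::nat)"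
    have "?I \<in> pps {0..r} (1 + 1 + 1)"
      using l k by (intro pps_add) (auto simp: pps_def mem_idx)
    then have I: "?I \<in> pps {0..r} d" using True by (simp add: numeral_3_eq_3)
    have sq: "squarefree_pp ?I" using l k by (auto simp: squarefree_pp_def lookup_add lookup_single when_def)
    have "u ?I + u ?I = x l + x k" using l k by (intro r2 I sq) (auto simp: lookup_add lookup_single)
    moreover have "u ?I + u ?I = x l' + x k" using l k by (intro r2 I sq) (auto simp: lookup_add lookup_single)
    ultimately show ?thesis by simp
  qed
  have x0: "x l = 0" if "l \<in> ?E" for l
  proof -
    have "s = (\<Sum>i\<in>?E. x l)" unfolding s_def
    proof (intro sum.cong refl)
      fix i assume "i \<in> ?E"
      then show "x i = x l" using x_eq[of i l] that by (cases "i = l") auto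
    qed
    \<comment> \<open>All \<open>r + 1\<close> values are equal and have sum zero, so they vanish in
      characteristic zero.\<close>
    then have "of_nat (r + 1) * x l = 0" using \<open>s = 0\<close> by (simp del: of_nat_add of_nat_Suc)
    then show ?thesis by (simp del: of_nat_add of_nat_Suc)
  qed
  show ?thesis
  proof
    fix \<alpha> assume \<alpha>: "\<alpha> \<in> pps {0..r} d"
    show "u \<alpha> = 0"
    proof (cases "\<exists>l\<in>?E. 2 \<le> lookup \<alpha> l")
      case True
      then obtain l where "l \<in> ?E" "2 \<le> lookup \<alpha> l" by blast
      then show ?thesis using r1[of l \<alpha>] x0[of l] \<alpha> by simp
    next
      case False
      have out: "lookup \<alpha> l = 0" if "l \<notin> ?E" for l
        using that \<alpha> by (auto simp: pps_def in_keys_iff mem_idx)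
      have le: "lookup \<alpha> l \<le> 1" for l using False out[of l] by (cases "l \<in> ?E") force+
      then have sq: "squarefree_pp \<alpha>" by (simp add: squarefree_pp_def)
      \<comment> \<open>A squarefree monomial of degree \<open>d\<close> involves \<open>d\<close>
        variables, in particular two, so \<open>r2\<close> applies.\<close>
      have "d \<le> card (keys \<alpha>)"
        using \<alpha> sum_bounded_above[of "keys \<alpha>" "lookup \<alpha>" 1] le by (simp add: pps_def pp_deg_def)
      then have "\<not> keys \<alpha> \<subseteq> {a}" for a using d card_mono[of "{a}" "keys \<alpha>"] by auto
      then obtain l l' where l: "l \<in> keys \<alpha>" "l' \<in> keys \<alpha>" "l \<noteq> l'" by blast
      have one: "lookup \<alpha> k = 1" if "k \<in> keys \<alpha>" for k using le[of k] that by (auto simp: in_keys_iff)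
      have E: "k \<in> ?E" if "k \<in> keys \<alpha>" for k using that out[of k] by (auto simp: in_keys_iff)
      have "u \<alpha> + u \<alpha> = 0"
        using r2[OF E[OF l(1)] E[OF l(2)] l(3) \<alpha> sq one[OF l(1)] one[OF l(2)]] x0 E l by simp
      then show ?thesis by (simp add: mult_2[symmetric])
    qed
  qed
qed

section \<open>The Hessian map\<close>

lemma monomials_eq_pps: "monomials d r = pps {0..r} d"
  by (simp add: monomials_def pps_def)

lemma pps_sum:
  "finite E \<Longrightarrow> (\<And>i. i \<in> E \<Longrightarrow> m i \<in> pps I d) \<Longrightarrow> (\<Sum>i\<in>E. m i) \<in> pps I (card E * d)"
proof (induction E rule: finite_induct)
  case (insert i E)
  then have "m i + (\<Sum>i\<in>E. m i) \<in> pps I (d + card E * d)" by (intro pps_add) auto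
  then show ?case using insert.hyps by simp
qed simp

lemma pps_summand:
  assumes "m + n \<in> pps I d" shows "m \<in> pps I (d - pp_deg n)"
proof -
  have "keys m \<subseteq> keys (m + n)" by (auto simp: in_keys_iff lookup_add)
  then show ?thesis using assms by (auto simp: pps_def pp_deg_add)
qed

lemma pp_deg_ones: "pp_deg (ones r) = r + 1"
proof -
  have "ones r \<in> pps {0..r} (card (idx r) * 1)"
    unfolding ones_def by (intro pps_sum) (auto simp: pps_def mem_idx)
  then show ?thesis by (simp add: pps_def)
qed

lemma hess_independent_forms_map:
  assumes d: "d \<ge> 3" and r: "r \<ge> 2"
  shows "\<exists>P dir Y. independent_forms_map (monomials d r) (monomials ((r + 1) * (d - 2)) r) (r + 1) P
    (hess r :: (nat, 'k::{alg_closed_field, field_char_0}) mpol \<Rightarrow> _) dir Y"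
proof -
  let ?E = "idx r" and ?A = "monomials d r" and ?B = "monomials ((r + 1) * (d - 2)) r"
  define K :: "nat pp \<Rightarrow> (nat \<Rightarrow> nat pp) \<Rightarrow> 'k" where
    "K b \<tau> = (if (\<Sum>i\<in>?E. \<tau> i) = b + ones r + ones r then hess_coeff r \<tau> else 0)" for b \<tau>
  \<comment> \<open>Second derivatives lower the exponent of each variable by \<open>2\<close> in
    total. For the chosen rows this subtraction does not truncate, since their coefficients are
    nonzero.\<close>
  define \<beta> where "\<beta> \<tau> = (\<Sum>i\<in>?E. \<tau> i) - (ones r + ones r)" for \<tau> :: "nat \<Rightarrow> nat pp"
  have finA: "finite ?A" and finB: "finite ?B" by (simp_all add: monomials_eq_pps finite_pps)
  have neA: "?A \<noteq> {}" using single_in_pps[of 0 r d] by (auto simp: monomials_eq_pps mem_idx)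
  have neE: "?E \<noteq> {}" using mem_idx[of 0 r] by auto
  have T: "rows d r \<subseteq> PiE ?E (\<lambda>_. ?A)" unfolding monomials_eq_pps by (rule rows_subset)
  have hc: "hess_coeff r \<tau> \<noteq> (0 :: 'k)" if "\<tau> \<in> rows d r" for \<tau>
    using that d by (intro hess_coeff_rows) auto
  have \<beta>: "(\<Sum>i\<in>?E. \<tau> i) = \<beta> \<tau> + ones r + ones r" if "\<tau> \<in> rows d r" for \<tau>
  proof -
    note nz = hc[OF that]
    obtain p where p: "p permutes ?E" "hess_term r p \<tau> \<noteq> (0 :: 'k)"
      using nz by (rule hess_coeff_nonzero_term)
    show ?thesis
      unfolding \<beta>_def hess_term_nonzero_sum[OF p(2,1)] by (simp only: add.assoc add_diff_cancel_right')
  qed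
  have "\<exists>p. (\<forall>a. p a \<noteq> 0) \<and> (\<forall>u. (\<forall>b\<in>?B. log_derivative ?E ?A K p b u = 0) \<longrightarrow> (\<forall>a\<in>?A. u a = 0))"
  proof (rule log_derivative_injective_if_initial_rows[where T = "rows d r" and \<beta> = \<beta> and \<omega> = "weight d"])
    show "\<beta> \<tau> \<in> ?B" if "\<tau> \<in> rows d r" for \<tau>
    proof -
      have "(\<Sum>i\<in>?E. \<tau> i) \<in> pps {0..r} (card ?E * d)"
        using T that by (intro pps_sum) (auto simp: monomials_eq_pps)
      then have "\<beta> \<tau> + (ones r + ones r) \<in> pps {0..r} ((r + 1) * d)"
        using \<beta>[OF that] by (simp add: add.assoc)
      then have "\<beta> \<tau> \<in> pps {0..r} ((r + 1) * d - pp_deg (ones r + ones r))" by (rule pps_summand)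
      moreover have "(r + 1) * d - pp_deg (ones r + ones r) = (r + 1) * (d - 2)"
        by (simp add: pp_deg_add pp_deg_ones diff_mult_distrib2)
      ultimately show ?thesis by (simp add: monomials_eq_pps)
    qed
    show "K (\<beta> \<tau>) \<tau> \<noteq> 0" if "\<tau> \<in> rows d r" for \<tau>
      using hc[OF that] \<beta>[OF that] by (simp add: K_def)
    show "(\<Sum>i\<in>?E. weight d (\<tau>0 i)) < (\<Sum>i\<in>?E. weight d (\<tau> i))"
      if "\<tau>0 \<in> rows d r" "\<tau> \<in> PiE ?E (\<lambda>_. ?A)" "K (\<beta> \<tau>0) \<tau> \<noteq> 0" "\<tau> \<noteq> \<tau>0" for \<tau>0 \<tau>
    \<comment> \<open>A competitor of no larger weight would have weight at most \<open>2\<close>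
      and the same exponent sum, contrary to \<open>rows_unique\<close>.\<close>
    proof (rule ccontr)
      assume "\<not> ?thesis"
      then have "(\<Sum>i\<in>?E. weight d (\<tau> i)) \<le> 2" using weight_rows[OF that(1)] by simp
      moreover have "hess_coeff r \<tau> \<noteq> (0 :: 'k)" "(\<Sum>i\<in>?E. \<tau> i) = (\<Sum>i\<in>?E. \<tau>0 i)"
        using that(3) unfolding \<beta>[OF that(1)] by (auto simp: K_def split: if_splits)
      ultimately have "\<tau> = \<tau>0"
        using rows_unique[OF d that(2)[unfolded monomials_eq_pps] _ _ that(1)] by blast
      then show False using that(4) by simp
    qed
    show "\<forall>a\<in>?A. u a = 0" if "\<And>\<tau>. \<tau> \<in> rows d r \<Longrightarrow> (\<Sum>i\<in>?E. u (\<tau> i)) = 0" for u :: "nat pp \<Rightarrow> 'k"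
      unfolding monomials_eq_pps using that by (rule rows_injective[OF d r])
  qed (use finA T in simp_all)
  then obtain p where p: "\<And>a. p a \<noteq> 0"
    "\<And>u. (\<And>b. b \<in> ?B \<Longrightarrow> log_derivative ?E ?A K p b u = 0) \<Longrightarrow> (\<forall>a\<in>?A. u a = 0)" by blast
  have "\<exists>P dir Y. independent_forms_map ?A ?B (card ?E) P (hess r :: (nat, 'k) mpol \<Rightarrow> _) dir Y"
  proof (rule independent_forms_map_if_log_derivative_injective[where K = K and p = p])
    show "lookup (hess r f) b = (\<Sum>\<tau>\<in>PiE ?E (\<lambda>_. ?A). K b \<tau> * (\<Prod>i\<in>?E. lookup f (\<tau> i)))"
      if "keys f \<subseteq> ?A" for f :: "(nat, 'k) mpol" and b
      unfolding K_def by (rule lookup_hess[OF finA that])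
    show "keys (hess r f) \<subseteq> ?B" if "keys f \<subseteq> ?A" for f :: "(nat, 'k) mpol"
      using that by (rule monomials_hess)
    show "\<forall>a\<in>?A. u a = 0" if "\<And>b. b \<in> ?B \<Longrightarrow> log_derivative ?E ?A K p b u = 0" for u
      using that by (rule p(2))
  qed (use finA finB neA neE p(1) in simp_all)
  then show ?thesis by simp
qed

text \<open>With this instance \<open>top_dim_image\<close> computes the dimension of projective
  space itself. Unit vectors serve both as the flag and as the linear forms, so a relation would
  vanish at all parameters.\<close>

lemma id_independent_forms_map:
  fixes A :: "'a set"
  assumes A: "finite A" "A \<noteq> {}"
  shows "\<exists>P dir Y. independent_forms_map A A 1 P (\<lambda>f :: 'a \<Rightarrow>\<^sub>0 'k::{alg_closed_field, field_char_0}. f) dir Y"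
proof -
  obtain \<alpha> where \<alpha>: "bij_betw \<alpha> {0..<card A} A"
    using ex_bij_betw_nat_finite[OF A(1)] by blast
  have inA: "\<alpha> j \<in> A" if "j < card A" for j using bij_betwE[OF \<alpha>] that by simp
  have \<alpha>_eq: "\<alpha> j = \<alpha> k \<longleftrightarrow> j = k" if "j < card A" "k < card A" for j k
    using bij_betw_imp_inj_on[OF \<alpha>] that by (simp add: inj_on_eq_iff)
  define P :: "'a \<Rightarrow> ('a, 'k) mpol" where "P b = (if b \<in> A then var b else 0)" for b
  define dir :: "nat \<Rightarrow> 'a \<Rightarrow> 'k" where "dir k a = (if k < card A \<and> a = \<alpha> k then 1 else 0)" for k a
  have "independent_forms_map A A 1 P (\<lambda>f. f) dir dir"
  proof
    show "finite A" "A \<noteq> {}" by (fact A)+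
    show "P b \<in> forms A 1" for b
    proof (cases "b \<in> A")
      case True then show ?thesis unfolding P_def if_P[OF True] by (rule forms_var)
    qed (simp add: P_def)
    show "lookup f b = peval (P b) (lookup f)" if "keys f \<subseteq> A" for f b
      using that by (auto simp: P_def in_keys_iff)
    show "dir k a = 0" if "a \<notin> A" for a k using that inA by (auto simp: dir_def)
    fix i t and \<Phi> :: "(nat, 'k) mpol"
    assume i: "i < card A" and \<Phi>: "\<Phi> \<in> forms {0..i} t"
      and van: "\<And>u. peval \<Phi> (\<lambda>j. \<Sum>b\<in>A. dir j b * peval (P b) (\<lambda>a. \<Sum>k=0..i. u k * dir k a)) = 0"
    have "peval \<Phi> u = 0" for u
    proof -
      have "(\<Sum>b\<in>A. dir j b * peval (P b) (\<lambda>a. \<Sum>k=0..i. u k * dir k a)) = u j" if "j \<le> i" for j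
      proof -
        have j: "j < card A" using that i by simp
        have "(\<Sum>b\<in>A. dir j b * peval (P b) (\<lambda>a. \<Sum>k=0..i. u k * dir k a))
            = (\<Sum>b\<in>A. if b = \<alpha> j then \<Sum>k=0..i. u k * dir k b else 0)"
          using j by (intro sum.cong refl) (simp add: dir_def P_def)
        also have "\<dots> = (\<Sum>k=0..i. u k * dir k (\<alpha> j))" using A inA[OF j] by simp
        also have "\<dots> = (\<Sum>k=0..i. if k = j then u j else 0)"
          using j i by (intro sum.cong refl) (auto simp: dir_def \<alpha>_eq)
        also have "\<dots> = u j" using that by simp
        finally show ?thesis .
      qed
      then have "peval \<Phi> u = peval \<Phi> (\<lambda>j. \<Sum>b\<in>A. dir j b * peval (P b) (\<lambda>a. \<Sum>k=0..i. u k * dir k a))"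
        using \<Phi> by (intro peval_cong_keys) (fastforce simp: forms_def pps_def)
      then show ?thesis using van by simp
    qed
    then show "\<Phi> = 0" using forms_nonzero_value[OF _ \<Phi>] by blast
  qed (simp_all add: P_def)
  then show ?thesis by blast
qed

text \<open>Exponent vectors correspond to lists of length \<open>r + 1\<close> with sum
  \<open>d\<close>, which are counted by stars and bars.\<close>

lemma card_monomials: "card (monomials d r) = (d + r choose d)"
proof -
  let ?L = "{l :: nat list. length l = r + 1 \<and> sum_list l = d}"
  let ?f = "\<lambda>m. map (lookup m) [0..<Suc r]"
  have sum: "sum_list (?f m) = sum (lookup m) {0..r}" for m :: "nat pp"
    by (simp only: interv_sum_list_conv_sum_set_nat set_upt) (simp add: atLeastLessThanSuc_atLeastAtMost)
  have "bij_betw ?f (monomials d r) ?L"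
  proof (rule bij_betw_byWitness[where f' = "\<lambda>l. \<Sum>i\<in>{0..r}. Poly_Mapping.single i (l ! i)"])
    have lk: "lookup (\<Sum>i\<in>{0..r}. Poly_Mapping.single i (g i)) k = (if k \<in> {0..r} then g k else 0)" for g :: "nat \<Rightarrow> nat" and k
      by (rule lookup_sum_single) simp
    show "\<forall>m\<in>monomials d r. (\<Sum>i\<in>{0..r}. Poly_Mapping.single i (?f m ! i)) = m"
    proof (intro ballI poly_mapping_eqI)
      fix m k assume "m \<in> monomials d r"
      then show "lookup (\<Sum>i\<in>{0..r}. Poly_Mapping.single i (?f m ! i)) k = lookup m k"
        unfolding lk by (auto simp: monomials_def in_keys_iff subset_iff simp del: upt_Suc)
    qed
    show "\<forall>l\<in>?L. ?f (\<Sum>i\<in>{0..r}. Poly_Mapping.single i (l ! i)) = l"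
      by (auto intro!: nth_equalityI simp: lk simp del: upt_Suc)
    show "?f ` monomials d r \<subseteq> ?L"
      by (auto simp: sum monomials_def pp_deg_superset[of "{0..r}"] simp del: upt_Suc)
    show "(\<lambda>l. \<Sum>i\<in>{0..r}. Poly_Mapping.single i (l ! i)) ` ?L \<subseteq> monomials d r"
    proof (intro image_subsetI)
      fix l :: "nat list" assume l: "l \<in> ?L"
      have k: "keys (\<Sum>i\<in>{0..r}. Poly_Mapping.single i (l ! i)) \<subseteq> {0..r}" by (rule keys_sum_single) simp
      have "length l = Suc r" "sum_list l = d" using l by simp_all
      then have "sum (\<lambda>i. l ! i) {0..r} = d"
        by (simp add: sum_list_sum_nth atLeastLessThanSuc_atLeastAtMost)
      then show "(\<Sum>i\<in>{0..r}. Poly_Mapping.single i (l ! i)) \<in> monomials d r"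
        using k by (simp add: monomials_def pp_deg_superset[OF _ k] lk)
    qed
  qed
  then have "card (monomials d r) = card ?L" by (rule bij_betw_same_card)
  then show ?thesis by (simp add: card_length_sum_list)
qed

theorem corollary7p3:
  fixes d r :: nat
  assumes "3 \<le> d" and "2 \<le> r"
  shows "generically_finite_onto_image
           (hypersurfaces ((r + 1) * (d - 2)) r)
           (hessian_domain d r)
           (hessian_map r :: (nat, 'k::{alg_closed_field, field_char_0}) mpol set \<Rightarrow> _)
       \<and> top_dim (subtopology (hypersurfaces ((r + 1) * (d - 2)) r)
                    (hessian_variety d r :: (nat, 'k) mpol set set))
           = enat ((d + r choose d) - 1)
       \<and> top_dim (hypersurfaces d r :: (nat, 'k) mpol set topology)
           = enat ((d + r choose d) - 1)"
proof -
  let ?A = "monomials d r" and ?B = "monomials ((r + 1) * (d - 2)) r"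
  let ?X = "zariski ?B :: (nat, 'k) mpol set topology"
  obtain P dir Y where H: "independent_forms_map ?A ?B (r + 1) P (hess r :: (nat, 'k) mpol \<Rightarrow> _) dir Y"
    using hess_independent_forms_map[OF assms] by blast
  then interpret H: independent_forms_map ?A ?B "r + 1" P "hess r :: (nat, 'k) mpol \<Rightarrow> _" dir Y .
  \<comment> \<open>The condition on all representatives reduces to one of them, because scaling
    \<open>f\<close> multiplies its Hessian by a nonzero constant.\<close>
  have dom: "p \<in> hessian_domain d r \<longleftrightarrow> (\<exists>f. keys f \<subseteq> ?A \<and> hess r f \<noteq> 0 \<and> p = proj_class f)"
    for p :: "(nat, 'k) mpol set"
  proof
    assume p: "p \<in> hessian_domain d r"
    then obtain f where "keys f \<subseteq> ?A" "p = proj_class f"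
      by (auto simp: hessian_domain_def proj_points_def)
    moreover from this have "hess r f \<noteq> 0" using p proj_class_self[of f] by (simp add: hessian_domain_def)
    ultimately show "\<exists>f. keys f \<subseteq> ?A \<and> hess r f \<noteq> 0 \<and> p = proj_class f" by blast
  next
    assume "\<exists>f. keys f \<subseteq> ?A \<and> hess r f \<noteq> 0 \<and> p = proj_class f"
    then obtain f where f: "keys f \<subseteq> ?A" "hess r f \<noteq> 0" "p = proj_class f" by blast
    have "Poly_Mapping.map ((*) 0) g = 0" for g :: "(nat, 'k) mpol"
      by (rule poly_mapping_eqI) (simp add: lookup_map_mult)
    \<comment> \<open>Homogeneity with the scaling factor \<open>0\<close>. It follows that
      \<open>f\<close> is nonzero and represents a point.\<close>
    then have "hess r (0 :: (nat, 'k) mpol) = 0" using H.\<phi>_scale[of 0 0] by simp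
    then have "f \<noteq> 0" using f(2) by auto
    moreover have "hess r g \<noteq> 0" if "g \<in> p" for g
    proof -
      obtain c where c: "c \<noteq> 0" "g = Poly_Mapping.map ((*) c) f" using \<open>g \<in> p\<close> f(3) by (auto simp: proj_class_def)
      have "hess r g = Poly_Mapping.map ((*) (c ^ (r + 1))) (hess r f)" unfolding c(2) by (rule hess_scale[OF c(1)])
      then have "hess r f \<in> {h. \<exists>a\<noteq>0. hess r g = Poly_Mapping.map ((*) a) h}"
        using c(1) by (intro CollectI exI[of _ "c ^ (r + 1)"]) simp
      moreover have "Poly_Mapping.map ((*) a) h \<noteq> 0" if "a \<noteq> 0" "h \<noteq> 0" for a :: 'k and h :: "(nat, 'k) mpol"
        using that by (metis lookup_map_mult lookup_zero mult_eq_0_iff poly_mapping_eqI)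
      ultimately show ?thesis using f(2) by auto
    qed
    ultimately show "p \<in> hessian_domain d r"
      using f by (auto simp: hessian_domain_def proj_points_def)
  qed
  have image: "hessian_map r ` hessian_domain d r = H.image_points"
  proof -
    have "hessian_domain d r = proj_class ` {f :: (nat, 'k) mpol. keys f \<subseteq> ?A \<and> hess r f \<noteq> 0}"
      using dom by auto
    then show ?thesis by (auto simp: H.image_points_def image_image hessian_map_proj_class)
  qed
  have fibre: "{p \<in> hessian_domain d r. hessian_map r p = y}
      = {proj_class f |f. keys f \<subseteq> ?A \<and> hess r f \<noteq> 0 \<and> proj_class (hess r f) = y}" for y :: "(nat, 'k) mpol set"
    by (auto simp: dom hessian_map_proj_class)
  obtain V where "openin (subtopology ?X (?X closure_of H.image_points)) V" "V \<noteq> {}"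
    "\<And>y. y \<in> V \<Longrightarrow> finite {proj_class f |f. keys f \<subseteq> ?A \<and> hess r f \<noteq> 0 \<and> proj_class (hess r f) = y}"
    using H.generically_finite by blast
  then have "generically_finite_onto_image ?X (hessian_domain d r) (hessian_map r)"
    unfolding generically_finite_onto_image_def image fibre by blast
  moreover have "top_dim (subtopology ?X (hessian_variety d r :: (nat, 'k) mpol set set)) = enat ((d + r choose d) - 1)"
    unfolding hessian_variety_def image using H.top_dim_image by (simp add: card_monomials)
  moreover have "top_dim (zariski ?A :: (nat, 'k) mpol set topology) = enat ((d + r choose d) - 1)"
  proof -
    \<comment> \<open>For the identity, the image is the whole projective space, so its closure is
      the space itself.\<close>
    obtain P' dir' Y' where "independent_forms_map ?A ?A 1 P' (\<lambda>f :: (nat, 'k) mpol. f) dir' Y'"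
      using id_independent_forms_map[OF H.finite_A H.A_ne] by blast
    then interpret I: independent_forms_map ?A ?A 1 P' "\<lambda>f :: (nat, 'k) mpol. f" dir' Y' .
    have "I.image_points = topspace (zariski ?A)"
      by (auto simp: I.image_points_def proj_points_def)
    then have "subtopology (zariski ?A) (zariski ?A closure_of I.image_points) = zariski ?A"
      by (simp only: closure_of_topspace subtopology_topspace)
    then show ?thesis using I.top_dim_image by (simp add: card_monomials)
  qed
  ultimately show ?thesis by blast
qed

end
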